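(* There exists a polynomial $P_3$ such that for every mean-payoff game $G$ and every rational $\epsilon\ge0$, the least $\epsilon$-fixed point $\lambda^*$ of the negotiation function of $G$ has size $\lVert\lambda^*\rVert\le P_3(\lVert G\rVert+\lVert\epsilon\rVert)$.
   Context: A mean-payoff game $G$ consists of a finite set $\Pi$ of players, a finite directed graph $(V,E)$ in which every vertex has an outgoing edge, a partition $(V_i)_{i\in\Pi}$ of $V$, and reward functions $r_i:E\to\mathbb{Q}$; $\lVert G\rVert$ is the size of its encoding with rationals in binary. Plays are infinite paths; $\mu_i(\rho)=\liminf_n\frac1n\sum_{k<n}r_i(\rho_k\rho_{k+1})$. Strategies, strategy profiles and outcomes $\langle\bar\sigma\rangle$ are as usual; $\bar\sigma_{\|hv}$ denotes the profile after history $hv$ ($\sigma_{i\|hv}(h')=\sigma_i(hh')$), and $-i=\Pi\setminus\{i\}$. A requirement is a map $\lambda:V\to\mathbb{R}\cup\{\pm\infty\}$. A play $\rho$ is $\lambda$-consistent if $\mu_i(\rho_{\ge n})\ge\lambda(\rho_n)$ for all $n$ and $i$ with $\rho_n\in V_i$. A profile $\bar\sigma_{-i}$ from $v$ is $\lambda$-rational if there is a strategy $\sigma_i$ such that for every history $hw$ from $v$ compatible with $\bar\sigma_{-i}$, the play $\langle\bar\sigma_{\|hw}\rangle$ is $\lambda$-consistent; $\lambda\mathsf{Rat}(v)$ is the set of such profiles. The negotiation function maps $\lambda$ to $\mathsf{nego}(\lambda)$ with $\mathsf{nego}(\lambda)(v)=\inf_{\bar\sigma_{-i}\in\lambda\mathsf{Rat}(v)}\sup_{\sigma_i}\mu_i(\langle\bar\sigma\rangle)$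 for $v\in V_i$ (with $\inf\emptyset=+\infty$). A requirement $\lambda$ is an $\epsilon$-fixed point of $\mathsf{nego}$ if $\mathsf{nego}(\lambda)(v)\in[\lambda(v)-\epsilon,\lambda(v)+\epsilon]$ for all $v$; a least $\epsilon$-fixed point (for the pointwise order) exists. Size: $\lVert p/q\rVert=1+\lceil\log_2(|p|+1)\rceil+\lceil\log_2(|q|+1)\rceil$ for coprime integers, $\lVert\pm\infty\rVert=1$, irrationals have size $+\infty$, and the size of $\lambda$ is $\mathsf{card}\,V+\sum_v\lVert\lambda(v)\rVert$. *)

theory Defs
  imports Complex_Main "HOL-Library.Extended_Real" "HOL-Library.Extended_Nat"
          "HOL-Computational_Algebra.Polynomial"
begin

text \<open>Players and vertices are natural numbers.  The partition (V_i) of V is given by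
  the owner function: v \<in> V_i iff owner v = i.  Edge rewards r_i(e) are rationals.\<close>

record mpgame =
  players :: "nat set"
  verts   :: "nat set"
  edges   :: "(nat \<times> nat) set"
  owner   :: "nat \<Rightarrow> nat"
  reward  :: "nat \<Rightarrow> nat \<times> nat \<Rightarrow> rat"

definition wf_game :: "mpgame \<Rightarrow> bool" where
  "wf_game G \<longleftrightarrow> finite (players G) \<and> finite (verts G)
     \<and> edges G \<subseteq> verts G \<times> verts G
     \<and> (\<forall>v\<in>verts G. \<exists>w. (v, w) \<in> edges G)
     \<and> (\<forall>v\<in>verts G. owner G v \<in> players G)"

definition size_rat :: "rat \<Rightarrow> nat" where
  "size_rat x = (case quotient_of x of (p, q) \<Rightarrow>
      1 + nat \<lceil>log 2 (real_of_int (\<bar>p\<bar> + 1))\<rceil> + nat \<lceil>log 2 (real_of_int (\<bar>q\<bar> + 1))\<rceil>)"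

definition size_ereal :: "ereal \<Rightarrow> enat" where
  "size_ereal x = (case x of
      ereal r \<Rightarrow> (if r \<in> \<rat> then enat (size_rat (THE q. real_of_rat q = r)) else \<infinity>)
    | PInfty \<Rightarrow> 1
    | MInfty \<Rightarrow> 1)"

definition game_size :: "mpgame \<Rightarrow> nat" where
  "game_size G = card (players G) + card (verts G) + card (edges G)
     + (\<Sum>i\<in>players G. \<Sum>e\<in>edges G. size_rat (reward G i e))"

definition req_size :: "mpgame \<Rightarrow> (nat \<Rightarrow> ereal) \<Rightarrow> enat" where
  "req_size G lam = enat (card (verts G)) + (\<Sum>v\<in>verts G. size_ereal (lam v))"

type_synonym play = "nat \<Rightarrow> nat"
type_synonym history = "nat list"
type_synonym strategy = "history \<Rightarrow> nat"
type_synonym profile = "nat \<Rightarrow> strategy"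

definition is_history :: "mpgame \<Rightarrow> history \<Rightarrow> bool" where
  "is_history G h \<longleftrightarrow> h \<noteq> [] \<and> set h \<subseteq> verts G
     \<and> (\<forall>k. Suc k < length h \<longrightarrow> (h ! k, h ! Suc k) \<in> edges G)"

definition history_from :: "mpgame \<Rightarrow> nat \<Rightarrow> history \<Rightarrow> bool" where
  "history_from G v h \<longleftrightarrow> is_history G h \<and> hd h = v"

definition is_strategy :: "mpgame \<Rightarrow> nat \<Rightarrow> strategy \<Rightarrow> bool" where
  "is_strategy G i \<sigma> \<longleftrightarrow>
     (\<forall>h. is_history G h \<and> owner G (last h) = i \<longrightarrow> (last h, \<sigma> h) \<in> edges G)"

definition compatible :: "mpgame \<Rightarrow> nat \<Rightarrow> profile \<Rightarrow> history \<Rightarrow> bool" where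
  "compatible G i \<sigma> h \<longleftrightarrow>
     (\<forall>k. Suc k < length h \<longrightarrow> owner G (h ! k) \<noteq> i \<longrightarrow>
          h ! Suc k = \<sigma> (owner G (h ! k)) (take (Suc k) h))"

fun out_hist :: "mpgame \<Rightarrow> profile \<Rightarrow> history \<Rightarrow> nat \<Rightarrow> history" where
  "out_hist G \<sigma> H 0 = H"
| "out_hist G \<sigma> H (Suc k) =
     (let h = out_hist G \<sigma> H k in h @ [\<sigma> (owner G (last h)) h])"

text \<open>outcome G \<sigma> (h @ [w]) is the play <\<sigma>_{|hw}> starting at w; in particular
  outcome G \<sigma> [v] is the outcome <\<sigma>> from v.\<close>
definition outcome :: "mpgame \<Rightarrow> profile \<Rightarrow> history \<Rightarrow> play" where
  "outcome G \<sigma> H k = last (out_hist G \<sigma> H k)"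

definition mean_payoff :: "mpgame \<Rightarrow> nat \<Rightarrow> play \<Rightarrow> ereal" where
  "mean_payoff G i \<rho> =
     liminf (\<lambda>n. ereal ((\<Sum>k<n. real_of_rat (reward G i (\<rho> k, \<rho> (Suc k)))) / real n))"

definition suffix_play :: "play \<Rightarrow> nat \<Rightarrow> play" where
  "suffix_play \<rho> n = (\<lambda>k. \<rho> (n + k))"

type_synonym requirement = "nat \<Rightarrow> ereal"

definition consistent :: "mpgame \<Rightarrow> requirement \<Rightarrow> play \<Rightarrow> bool" where
  "consistent G lam \<rho> \<longleftrightarrow>
     (\<forall>n. \<forall>i\<in>players G. owner G (\<rho> n) = i \<longrightarrow> mean_payoff G i (suffix_play \<rho> n) \<ge> lam (\<rho> n))"

text \<open>lambda-rational profiles sigma_{-i} from v (the i-th component of the profile is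
  irrelevant and gets replaced by the strategy of player i).\<close>
definition lam_rat :: "mpgame \<Rightarrow> requirement \<Rightarrow> nat \<Rightarrow> profile set" where
  "lam_rat G lam v = (let i = owner G v in
     {\<sigma>. (\<forall>j\<in>players G. j \<noteq> i \<longrightarrow> is_strategy G j (\<sigma> j))
         \<and> (\<exists>\<tau>. is_strategy G i \<tau> \<and>
              (\<forall>h. history_from G v h \<and> compatible G i \<sigma> h \<longrightarrow>
                    consistent G lam (outcome G (\<sigma>(i := \<tau>)) h)))})"

definition nego :: "mpgame \<Rightarrow> requirement \<Rightarrow> requirement" where
  "nego G lam v = (let i = owner G v in
     (INF \<sigma>\<in>lam_rat G lam v. SUP \<tau>\<in>{\<tau>. is_strategy G i \<tau>}.
         mean_payoff G i (outcome G (\<sigma>(i := \<tau>)) [v])))"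

definition eps_fixed_point :: "mpgame \<Rightarrow> rat \<Rightarrow> requirement \<Rightarrow> bool" where
  "eps_fixed_point G \<epsilon> lam \<longleftrightarrow>
     (\<forall>v\<in>verts G. lam v - ereal (real_of_rat \<epsilon>) \<le> nego G lam v
                 \<and> nego G lam v \<le> lam v + ereal (real_of_rat \<epsilon>))"

definition least_eps_fixed_point :: "mpgame \<Rightarrow> rat \<Rightarrow> requirement \<Rightarrow> bool" where
  "least_eps_fixed_point G \<epsilon> lam \<longleftrightarrow>
     eps_fixed_point G \<epsilon> lam \<and>
     (\<forall>lam'. eps_fixed_point G \<epsilon> lam' \<longrightarrow> (\<forall>v\<in>verts G. lam v \<le> lam' v))"

end

theory Submission
  imports Defs "HOL-Analysis.Analysis" "HOL-Library.Function_Algebras"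
begin

text \<open>
  Every requirement satisfies \<open>\<lambda> \<le> nego(\<lambda>)\<close>, so the \<open>\<epsilon>\<close>-fixed points are the solutions of
  \<open>nego(\<lambda>)(v) \<le> \<lambda>(v) + \<epsilon>\<close>.  The value \<open>nego(\<lambda>)(v)\<close> is that of a game in which a prover proposes
  \<open>\<lambda>\<close>-consistent plays and a challenger, player \<open>i\<close>, deviates from them.  The bound \<open>nego(\<lambda>)(v) \<le> c\<close> holds
  iff the prover has a finite certificate: for each vertex \<open>w\<close> of a closed region, a lasso whose cycle has
  mean at most \<open>c\<close>, a strongly connected set in which the play finally settles together with a circulation
  on its edges (the edge frequencies), and potentials that absorb the gain of every deviation along the
  lasso.  Given a certificate, the prover repeats the cycle until later deviations are harmless and
  then realises the circulation.  Conversely, a first-cycle game in the style of Ehrenfeucht and Mycielski makes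
  the prover's choices positional.

  For fixed combinatorial data the certificates for all vertices form a system of linear inequalities in
  \<open>\<lambda>\<close>, the potentials and the circulations, with polynomially many unknowns and coefficients of polynomial
  size, and every solution yields an \<open>\<epsilon>\<close>-fixed point.  The least \<open>\<epsilon>\<close>-fixed point is therefore determined by
  the constraints that are tight at it, so its values are rationals of polynomial size.
\<close>

section \<open>Weights of walks and mean payoffs\<close>

text \<open>Three obstacles shape the proof. Payoffs are limits inferior, so different players may
  attain theirs at different times of one play. Edge frequencies are therefore taken along times
  that realise the payoff of the challenger: this preserves his payoff and can only raise the
  others, as needed for the threshold and for consistency. Next, the flow in which a play settles
  may have value exactly \<open>c\<close> for the challenger, so that the sums relative to
  \<open>c\<close> may drift upwards without bound. Plays are built for a threshold
  \<open>c + d\<close> with \<open>d > 0\<close>, against which every lap of the cycle loses a fixed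
  amount. Finally, requirements and thresholds are themselves unknowns; the constraints stay linear
  because a threshold is only multiplied by the length of a fixed walk. There is one flow variable
  for every two vertices and an edge, so about \<open>s ^ 3\<close> unknowns, where \<open>s\<close>
  is the input size. Coefficients have a number of bits linear in \<open>s\<close>, which gives
  values of about \<open>s ^ 4\<close> bits and, summed over the vertices, degree 5.\<close>

abbreviation rew :: "mpgame \<Rightarrow> nat \<Rightarrow> nat \<times> nat \<Rightarrow> real" where
  "rew G j e \<equiv> real_of_rat (reward G j e)"

definition is_play :: "mpgame \<Rightarrow> play \<Rightarrow> bool" where
  "is_play G \<rho> \<longleftrightarrow> (\<forall>n. (\<rho> n, \<rho> (Suc n)) \<in> edges G)"

definition psum :: "(nat \<times> nat \<Rightarrow> real) \<Rightarrow> play \<Rightarrow> nat \<Rightarrow> real" where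
  "psum g \<rho> n = (\<Sum>k<n. g (\<rho> k, \<rho> (Suc k)))"

lemma psum_0 [simp]: "psum g \<rho> 0 = 0"
  by (simp add: psum_def)

lemma psum_Suc [simp]: "psum g \<rho> (Suc n) = psum g \<rho> n + g (\<rho> n, \<rho> (Suc n))"
  by (simp add: psum_def)

lemma psum_shift: "psum (\<lambda>e. g e - c) \<rho> n = psum g \<rho> n - real n * c"
  by (induction n) (auto simp: algebra_simps)

lemma psum_suffix: "psum g (suffix_play \<rho> m) n = psum g \<rho> (m + n) - psum g \<rho> m"
  by (induction n) (auto simp: suffix_play_def)

lemma mean_payoff_psum: "mean_payoff G i \<rho> = liminf (\<lambda>n. ereal (psum (rew G i) \<rho> n / real n))"
  by (simp add: mean_payoff_def psum_def)

lemma is_play_suffix: "is_play G \<rho> \<Longrightarrow> is_play G (suffix_play \<rho> n)"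
  by (simp add: is_play_def suffix_play_def)

lemma finite_edges: "wf_game G \<Longrightarrow> finite (edges G)"
  unfolding wf_game_def by (meson finite_SigmaI finite_subset)

lemma is_play_verts: "wf_game G \<Longrightarrow> is_play G \<rho> \<Longrightarrow> \<rho> n \<in> verts G"
  unfolding wf_game_def is_play_def by blast

lemma finite_weight_bound:
  assumes "finite A"
  obtains B :: real where "B \<ge> 0" "\<And>e. e \<in> A \<Longrightarrow> \<bar>g e\<bar> \<le> B"
proof
  show "(\<Sum>e\<in>A. \<bar>g e\<bar>) \<ge> 0" by (simp add: sum_nonneg)
  show "\<bar>g e\<bar> \<le> (\<Sum>e\<in>A. \<bar>g e\<bar>)" if "e \<in> A" for e
    using assms that by (intro member_le_sum) auto
qed

lemma psum_bound:
  assumes "\<And>e. e \<in> edges G \<Longrightarrow> \<bar>g e\<bar> \<le> B" "is_play G \<rho>"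
  shows "\<bar>psum g \<rho> n\<bar> \<le> real n * B"
proof (induction n)
  case (Suc n)
  have "\<bar>g (\<rho> n, \<rho> (Suc n))\<bar> \<le> B" using assms by (auto simp: is_play_def)
  then show ?case using Suc by (simp add: algebra_simps)
qed simp

lemma mean_payoff_ge:
  assumes "\<And>n. psum (\<lambda>e. rew G i e - c) \<rho> n \<ge> - B"
  shows "mean_payoff G i \<rho> \<ge> ereal c"
proof -
  have "(\<lambda>n. ereal (c - B / real n)) \<longlonglongrightarrow> ereal (c - 0)"
    by (intro tendsto_intros lim_const_over_n)
  then have "liminf (\<lambda>n. ereal (c - B / real n)) = ereal c"
    by (simp add: lim_imp_Liminf)
  moreover have "liminf (\<lambda>n. ereal (c - B / real n)) \<le> mean_payoff G i \<rho>"
    unfolding mean_payoff_psum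
  proof (intro Liminf_mono eventually_sequentiallyI[of 1])
    fix n :: nat assume n: "1 \<le> n"
    have "psum (rew G i) \<rho> n - real n * c \<ge> - B" using assms[of n] by (simp add: psum_shift)
    then have "(real n * c - B) / real n \<le> psum (rew G i) \<rho> n / real n"
      by (intro divide_right_mono) auto
    then show "ereal (c - B / real n) \<le> ereal (psum (rew G i) \<rho> n / real n)"
      using n by (simp add: diff_divide_distrib)
  qed
  ultimately show ?thesis by simp
qed

text \<open>For a limit inferior it suffices that the sums are bounded above infinitely often,
  whereas \<open>mean_payoff_ge\<close> needs a bound at all times. This asymmetry is why a
  challenger who keeps deviating has to be checked only at his deviations.\<close>

lemma mean_payoff_le:
  assumes "\<And>N. \<exists>n\<ge>N. psum (\<lambda>e. rew G i e - c) \<rho> n \<le> B"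
  shows "mean_payoff G i \<rho> \<le> ereal c"
proof (rule ereal_le_epsilon2)
  fix e :: real assume e: "0 < e"
  show "mean_payoff G i \<rho> \<le> ereal c + ereal e"
  proof (rule ccontr)
    assume "\<not> ?thesis"
    then have "ereal (c + e) < mean_payoff G i \<rho>" by simp
    then obtain N where N: "\<And>n. n \<ge> N \<Longrightarrow> ereal (c + e) < ereal (psum (rew G i) \<rho> n / real n)"
      unfolding mean_payoff_psum by (metis (no_types, lifting) less_LiminfD eventually_sequentially)
    obtain N' :: nat where N': "real N' > \<bar>B\<bar> / e" using reals_Archimedean2 by blast
    obtain n where n: "n \<ge> max (max N N') 1" "psum (\<lambda>e. rew G i e - c) \<rho> n \<le> B" using assms by blast
    have "c + e < psum (rew G i) \<rho> n / real n" using N[of n] n by simp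
    then have "real n * c + real n * e < psum (rew G i) \<rho> n" using n by (simp add: field_simps)
    then have "real n * e < B" using n by (simp add: psum_shift)
    moreover have "\<bar>B\<bar> / e < real n" using N' n by linarith
    then have "\<bar>B\<bar> < real n * e" using e by (simp add: field_simps)
    ultimately show False by linarith
  qed
qed

lemma mean_payoff_lim:
  assumes "(\<lambda>n. psum (rew G i) \<rho> n / real n) \<longlonglongrightarrow> z"
  shows "mean_payoff G i \<rho> = ereal z"
  unfolding mean_payoff_psum using assms by (intro lim_imp_Liminf) auto

text \<open>The average of the suffix at time \<open>n\<close> and that of the play at time
  \<open>n + m\<close> differ by at most \<open>2 * m * B / n\<close>. Prefix independence turns
  consistency into a condition on one payoff per player and play.\<close>

lemma mean_payoff_suffix_play:
  assumes wf: "wf_game G" and pl: "is_play G \<rho>"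
  shows "mean_payoff G i (suffix_play \<rho> m) = mean_payoff G i \<rho>"
proof -
  obtain B where B: "B \<ge> 0" "\<And>e. e \<in> edges G \<Longrightarrow> \<bar>rew G i e\<bar> \<le> B"
    using finite_weight_bound[OF finite_edges[OF wf], of "rew G i"] by blast
  let ?P = "psum (rew G i) \<rho>"
  let ?u = "\<lambda>n. ?P (n + m) / real (n + m)"
  let ?d = "\<lambda>n. (?P (n + m) - ?P m) / real n - ?u n"
  have "?d \<longlonglongrightarrow> 0"
  proof (rule Lim_null_comparison)
    show "(\<lambda>n. 2 * real m * B / real n) \<longlonglongrightarrow> 0"
      by (intro lim_const_over_n)
    show "\<forall>\<^sub>F n in sequentially. norm (?d n) \<le> 2 * real m * B / real n"
    proof (intro eventually_sequentiallyI[of 1])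
      fix n :: nat assume n: "1 \<le> n"
      have 1: "\<bar>?P (n + m)\<bar> \<le> real (n + m) * B" "\<bar>?P m\<bar> \<le> real m * B"
        by (rule psum_bound[OF _ pl, where g = "rew G i"], fact B(2))+
      have "\<bar>?u n\<bar> \<le> B" using 1(1) n by (simp add: field_simps)
      then have "\<bar>real m * ?u n\<bar> \<le> real m * B"
        unfolding abs_mult by (intro mult_mono) auto
      then have "\<bar>real m * ?u n - ?P m\<bar> \<le> real m * B + real m * B"
        using 1(2) by (intro order_trans[OF abs_triangle_ineq4] add_mono)
      then have "\<bar>real m * ?u n - ?P m\<bar> / real n \<le> (real m * B + real m * B) / real n"
        by (rule divide_right_mono) simp
      moreover have "?d n = (real m * ?u n - ?P m) / real n" using n by (simp add: field_simps)
      ultimately have "\<bar>?d n\<bar> \<le> (real m * B + real m * B) / real n"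
        by (simp only: abs_divide abs_of_nat)
      then show "norm (?d n) \<le> 2 * real m * B / real n" by (simp add: mult.commute mult.left_commute)
    qed
  qed
  then have "(\<lambda>n. ereal (?d n)) \<longlonglongrightarrow> ereal 0" by simp
  then have "liminf (\<lambda>n. ereal (?d n) + ereal (?u n)) = ereal 0 + liminf (\<lambda>n. ereal (?u n))"
    by (rule ereal_liminf_lim_add) simp
  moreover have "liminf (\<lambda>n. ereal (?u n)) = mean_payoff G i \<rho>"
    unfolding mean_payoff_psum by (rule liminf_shift_k)
  moreover have "mean_payoff G i (suffix_play \<rho> m) = liminf (\<lambda>n. ereal (?d n) + ereal (?u n))"
    unfolding mean_payoff_psum psum_suffix by (simp add: add.commute)
  ultimately show ?thesis by (simp add: zero_ereal_def[symmetric])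
qed

lemma mean_payoff_bounds:
  assumes "\<And>e. e \<in> edges G \<Longrightarrow> \<bar>rew G i e\<bar> \<le> B" "is_play G \<rho>"
  shows "ereal (- B) \<le> mean_payoff G i \<rho>" "mean_payoff G i \<rho> \<le> ereal B"
proof -
  have *: "\<bar>psum (rew G i) \<rho> n\<bar> \<le> real n * B" for n
    using assms by (rule psum_bound)
  show "ereal (- B) \<le> mean_payoff G i \<rho>"
  proof (rule mean_payoff_ge[where B = 0])
    show "- 0 \<le> psum (\<lambda>e. rew G i e - (- B)) \<rho> n" for n
      unfolding psum_shift using *[of n] by (simp add: abs_le_iff)
  qed
  show "mean_payoff G i \<rho> \<le> ereal B"
  proof (rule mean_payoff_le[where B = 0])
    show "\<exists>n\<ge>N. psum (\<lambda>e. rew G i e - B) \<rho> n \<le> 0" for N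
      unfolding psum_shift using *[of N] by (intro exI[of _ N]) (simp add: abs_le_iff)
  qed
qed

text \<open>Averages are bounded, so the payoff is a real number; a subsequence realising it is the
  starting point for extracting edge frequencies.\<close>

lemma mean_payoff_subseq:
  assumes wf: "wf_game G" and pl: "is_play G \<rho>"
  obtains z \<phi> where "mean_payoff G i \<rho> = ereal z" "strict_mono \<phi>"
    "(\<lambda>n. psum (rew G i) \<rho> (\<phi> n) / real (\<phi> n)) \<longlonglongrightarrow> z"
proof -
  obtain B where B: "B \<ge> 0" "\<And>e. e \<in> edges G \<Longrightarrow> \<bar>rew G i e\<bar> \<le> B"
    using finite_weight_bound[OF finite_edges[OF wf], of "rew G i"] by blast
  obtain z where z: "mean_payoff G i \<rho> = ereal z"
    using mean_payoff_bounds[OF B(2) pl] by (cases "mean_payoff G i \<rho>") auto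
  obtain \<phi> where "strict_mono \<phi>"
    "((\<lambda>n. ereal (psum (rew G i) \<rho> n / real n)) \<circ> \<phi>) \<longlonglongrightarrow> mean_payoff G i \<rho>"
    unfolding mean_payoff_psum using liminf_subseq_lim by blast
  with z that[OF z, of \<phi>] show ?thesis by (simp add: o_def)
qed

section \<open>Histories and outcomes\<close>

fun wsum :: "(nat \<times> nat \<Rightarrow> real) \<Rightarrow> nat list \<Rightarrow> real" where
  "wsum g (x # y # r) = g (x, y) + wsum g (y # r)"
| "wsum g _ = 0"

lemma wsum_snoc: "h \<noteq> [] \<Longrightarrow> wsum g (h @ [x]) = wsum g h + g (last h, x)"
  by (induction g h rule: wsum.induct) auto

text \<open>The two paths overlap in the vertex \<open>x\<close>, so that the edge into
  \<open>x\<close> is counted on the left and the edge out of it on the right.\<close>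

lemma wsum_append: "wsum g (xs @ x # ys) = wsum g (xs @ [x]) + wsum g (x # ys)"
  by (induction g xs rule: wsum.induct) auto

lemma wsum_map_play: "wsum g (map \<rho> [0..<Suc n]) = psum g \<rho> n"
proof (induction n)
  case (Suc n)
  have "wsum g (map \<rho> [0..<Suc n] @ [\<rho> (Suc n)]) = wsum g (map \<rho> [0..<Suc n]) + g (\<rho> n, \<rho> (Suc n))"
    by (subst wsum_snoc) (auto simp: last_map)
  then show ?case using Suc by simp
qed simp

lemma is_history_snoc:
  assumes "h \<noteq> []"
  shows "is_history G (h @ [x]) \<longleftrightarrow> is_history G h \<and> x \<in> verts G \<and> (last h, x) \<in> edges G"
proof -
  have "(\<forall>k. Suc k < length (h @ [x]) \<longrightarrow> ((h @ [x]) ! k, (h @ [x]) ! Suc k) \<in> edges G) \<longleftrightarrow>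
    (\<forall>k. Suc k < length h \<longrightarrow> (h ! k, h ! Suc k) \<in> edges G) \<and> (last h, x) \<in> edges G" (is "?L \<longleftrightarrow> ?R")
  proof
    assume L: ?L
    have "(h ! k, h ! Suc k) \<in> edges G" if "Suc k < length h" for k
      using L[rule_format, of k] that by (simp add: nth_append)
    moreover have "(last h, x) \<in> edges G"
      using L[rule_format, of "length h - 1"] assms by (simp add: nth_append last_conv_nth)
    ultimately show ?R by blast
  next
    assume R: ?R
    show ?L
    proof (intro allI impI)
      fix k assume "Suc k < length (h @ [x])"
      then consider "Suc k < length h" | "Suc k = length h" by fastforce
      then show "((h @ [x]) ! k, (h @ [x]) ! Suc k) \<in> edges G"
      proof cases
        case 2
        then have "h ! k = last h" using assms by (metis diff_Suc_1 last_conv_nth)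
        then show ?thesis using 2 R by (simp add: nth_append)
      qed (use R in \<open>simp add: nth_append\<close>)
    qed
  qed
  then show ?thesis using assms by (auto simp: is_history_def)
qed

lemma compatible_snoc:
  assumes "h \<noteq> []"
  shows "compatible G i \<sigma> (h @ [x]) \<longleftrightarrow>
    compatible G i \<sigma> h \<and> (owner G (last h) \<noteq> i \<longrightarrow> x = \<sigma> (owner G (last h)) h)" (is "?L \<longleftrightarrow> ?R")
proof
  assume L: ?L
  have "compatible G i \<sigma> h"
    unfolding compatible_def
  proof (intro allI impI)
    fix k assume "Suc k < length h" "owner G (h ! k) \<noteq> i"
    then show "h ! Suc k = \<sigma> (owner G (h ! k)) (take (Suc k) h)"
      using L[unfolded compatible_def, rule_format, of k] by (simp add: nth_append)
  qed
  moreover have "x = \<sigma> (owner G (last h)) h" if "owner G (last h) \<noteq> i"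
    using L[unfolded compatible_def, rule_format, of "length h - 1"] that assms
    by (simp add: nth_append last_conv_nth)
  ultimately show ?R by blast
next
  assume R: ?R
  show ?L
    unfolding compatible_def
  proof (intro allI impI)
    fix k assume k: "Suc k < length (h @ [x])" "owner G ((h @ [x]) ! k) \<noteq> i"
    then consider "Suc k < length h" | "Suc k = length h" by fastforce
    then show "(h @ [x]) ! Suc k = \<sigma> (owner G ((h @ [x]) ! k)) (take (Suc k) (h @ [x]))"
    proof cases
      case 1
      then show ?thesis using R k unfolding compatible_def by (simp add: nth_append)
    next
      case 2
      then have "h ! k = last h" using assms by (metis diff_Suc_1 last_conv_nth)
      then show ?thesis using 2 R k by (simp add: nth_append)
    qed
  qed
qed

lemma compatible_single [simp]: "compatible G i \<sigma> [v]"
  by (simp add: compatible_def)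

lemma is_history_single [simp]: "is_history G [v] \<longleftrightarrow> v \<in> verts G"
  by (simp add: is_history_def)

lemma is_history_play: "wf_game G \<Longrightarrow> is_play G \<rho> \<Longrightarrow> is_history G (map \<rho> [0..<Suc n])"
proof (induction n)
  case (Suc n)
  then have "is_history G (map \<rho> [0..<Suc n] @ [\<rho> (Suc n)])"
    by (subst is_history_snoc) (auto simp: is_play_verts last_map is_play_def)
  then show ?case by simp
qed (simp add: is_play_verts)

lemma out_hist_ne [simp]: "H \<noteq> [] \<Longrightarrow> out_hist G \<sigma> H k \<noteq> []"
  by (induction k) (auto simp: Let_def)

lemma out_hist_conv: "H \<noteq> [] \<Longrightarrow> out_hist G \<sigma> H k = H @ map (outcome G \<sigma> H) [1..<Suc k]"
proof (induction k)
  case (Suc k)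
  have "out_hist G \<sigma> H (Suc k) = out_hist G \<sigma> H k @ [outcome G \<sigma> H (Suc k)]"
    by (simp add: Let_def outcome_def)
  then show ?case using Suc by simp
qed simp

lemma outcome_0: "outcome G \<sigma> H 0 = last H"
  by (simp add: outcome_def)

lemma outcome_Suc:
  "outcome G \<sigma> H (Suc k) = \<sigma> (owner G (outcome G \<sigma> H k)) (out_hist G \<sigma> H k)"
  by (simp add: outcome_def Let_def)

lemma out_hist_single: "out_hist G \<sigma> [v] k = map (outcome G \<sigma> [v]) [0..<Suc k]"
proof (induction k)
  case (Suc k)
  have "out_hist G \<sigma> [v] (Suc k) = out_hist G \<sigma> [v] k @ [outcome G \<sigma> [v] (Suc k)]"
    by (simp add: Let_def outcome_def)
  then show ?case using Suc by simp
qed (simp add: outcome_def)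

lemma strategy_edge:
  assumes "wf_game G" "\<And>j. j \<in> players G \<Longrightarrow> is_strategy G j (\<sigma> j)" "is_history G h"
  shows "(last h, \<sigma> (owner G (last h)) h) \<in> edges G"
proof -
  have "last h \<in> verts G" using assms(3) by (auto simp: is_history_def)
  then show ?thesis using assms by (auto simp: wf_game_def is_strategy_def)
qed

lemma out_hist_history:
  assumes "wf_game G" "\<And>j. j \<in> players G \<Longrightarrow> is_strategy G j (\<sigma> j)" "is_history G h"
  shows "is_history G (out_hist G \<sigma> h k)"
proof (induction k)
  case (Suc k)
  have "h \<noteq> []" using assms(3) by (simp add: is_history_def)
  moreover have "(last (out_hist G \<sigma> h k), \<sigma> (owner G (last (out_hist G \<sigma> h k))) (out_hist G \<sigma> h k)) \<in> edges G"
    by (rule strategy_edge[OF assms(1,2) Suc])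
  ultimately show ?case using Suc assms(1) by (auto simp: Let_def is_history_snoc wf_game_def)
qed (use assms in simp)

lemma is_play_outcome:
  assumes "wf_game G" "\<And>j. j \<in> players G \<Longrightarrow> is_strategy G j (\<sigma> j)" "is_history G h"
  shows "is_play G (outcome G \<sigma> h)"
  unfolding is_play_def
proof
  fix n
  show "(outcome G \<sigma> h n, outcome G \<sigma> h (Suc n)) \<in> edges G"
    unfolding outcome_Suc using strategy_edge[OF assms(1,2) out_hist_history[OF assms, of n]]
    by (simp add: outcome_def)
qed

lemma compatible_out_hist:
  assumes "H \<noteq> []" "compatible G i \<sigma> H"
  shows "compatible G i \<sigma> (out_hist G (\<sigma>(i := \<tau>)) H k)"
  using assms by (induction k) (auto simp: Let_def compatible_snoc)

section \<open>A family of plans bounds the negotiation function\<close>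

text \<open>The state of the prover is the remainder of the play being proposed. Deviations are
  recognised by their target alone: a move to the expected vertex continues the play, any other move
  starts the play proposed at the new vertex.\<close>

definition plan_step :: "(nat \<Rightarrow> play) \<Rightarrow> play \<Rightarrow> nat \<Rightarrow> play" where
  "plan_step P q x = (if x = q 1 then suffix_play q 1 else P x)"

definition plan :: "(nat \<Rightarrow> play) \<Rightarrow> history \<Rightarrow> play" where
  "plan P h = foldl (plan_step P) (P (hd h)) (tl h)"

lemma plan_single [simp]: "plan P [v] = P v"
  by (simp add: plan_def)

lemma plan_snoc: "h \<noteq> [] \<Longrightarrow> plan P (h @ [x]) = plan_step P (plan P h) x"
  by (cases h) (auto simp: plan_def)

lemma suffix_play_suffix_play [simp]: "suffix_play (suffix_play \<rho> m) n = suffix_play \<rho> (m + n)"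
  by (simp add: suffix_play_def add.assoc)

lemma suffix_play_0 [simp]: "suffix_play \<rho> 0 = \<rho>"
  by (simp add: suffix_play_def)

lemma consistent_suffix: "consistent G lam \<rho> \<Longrightarrow> consistent G lam (suffix_play \<rho> n)"
  unfolding consistent_def suffix_play_suffix_play by (simp add: suffix_play_def)

text \<open>A deviation from \<open>P w\<close> to \<open>w'\<close> gains at most
  \<open>f w - f w'\<close>, counting all moves since the start of \<open>P w\<close>. Along a
  history with several deviations these bounds telescope, so the total gain stays bounded however
  often the challenger deviates.\<close>

lemma nego_le_if_plans:
  assumes wf: "wf_game G" and v: "v \<in> R" "R \<subseteq> verts G" and i: "i = owner G v"
    and P: "\<And>w. w \<in> verts G \<Longrightarrow> is_play G (P w) \<and> P w 0 = w"
    and cons: "\<And>w. w \<in> R \<Longrightarrow> consistent G lam (P w)"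
    and mp: "\<And>w. w \<in> R \<Longrightarrow> mean_payoff G i (P w) \<le> ereal c"
    and closed: "\<And>w n w'. w \<in> R \<Longrightarrow> owner G (P w n) = i \<Longrightarrow> (P w n, w') \<in> edges G \<Longrightarrow> w' \<in> R"
    and pot: "\<And>w n w'. w \<in> R \<Longrightarrow> owner G (P w n) = i \<Longrightarrow> (P w n, w') \<in> edges G \<Longrightarrow>
      psum (\<lambda>e. rew G i e - c) (P w) n + (rew G i (P w n, w') - c) \<le> f w - f w'"
  shows "nego G lam v \<le> ereal c"
proof -
  let ?g = "\<lambda>e. rew G i e - c"
  \<comment> \<open>One strategy, read off the current plan, serves all players: updating component
    \<open>i\<close> by it leaves the profile unchanged, so it is also the witness for
    rationality.\<close>
  define s where "s = (\<lambda>h. plan P h 1)"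
  define \<sigma> :: profile where "\<sigma> = (\<lambda>j. s)"
  have vV: "v \<in> verts G" using v by blast
  have pl: "is_play G (plan P h) \<and> plan P h 0 = last h" if "is_history G h" for h
    using that
  proof (induction h rule: rev_induct)
    case (snoc x h)
    show ?case
    proof (cases "h = []")
      case True
      then show ?thesis using snoc P by simp
    next
      case False
      then have "is_history G h" "x \<in> verts G" using snoc.prems by (auto simp: is_history_snoc)
      then have "is_play G (plan P h) \<and> plan P h 0 = last h" using snoc by blast
      then show ?thesis using False P[OF \<open>x \<in> verts G\<close>]
        by (auto simp: plan_snoc plan_step_def is_play_suffix) (simp add: suffix_play_def)
    qed
  qed (simp add: is_history_def)
  have strat: "is_strategy G j s" for j
    unfolding is_strategy_def
  proof (intro allI impI)
    fix h assume "is_history G h \<and> owner G (last h) = j"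
    then have "is_play G (plan P h)" "plan P h 0 = last h" using pl by blast+
    then show "(last h, s h) \<in> edges G" by (simp add: s_def is_play_def) (metis One_nat_def)
  qed
  \<comment> \<open>\<open>w\<close> is the target of the latest deviation (initially
    \<open>v\<close>), and \<open>n\<close> counts the moves made along its plan since then.\<close>
  have inv: "\<exists>w\<in>R. \<exists>n. plan P h = suffix_play (P w) n \<and> wsum ?g h \<le> f v - f w + psum ?g (P w) n"
    if "history_from G v h" "compatible G i \<sigma> h" for h
    using that
  proof (induction h rule: rev_induct)
    case (snoc x h)
    show ?case
    proof (cases "h = []")
      case True
      then show ?thesis using snoc.prems v(1)
        by (auto intro!: bexI[of _ v] exI[of _ 0] simp: history_from_def)
    next
      case False
      have h: "history_from G v h" "compatible G i \<sigma> h" "(last h, x) \<in> edges G"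
        using snoc.prems False by (auto simp: history_from_def is_history_snoc compatible_snoc)
      then obtain w n where w: "w \<in> R" "plan P h = suffix_play (P w) n"
        "wsum ?g h \<le> f v - f w + psum ?g (P w) n" using snoc.IH by blast
      have lh: "last h = P w n" using pl[of h] h w(2) by (simp add: history_from_def suffix_play_def)
      show ?thesis
      proof (cases "x = plan P h 1")
        case True
        have "x = P w (Suc n)" using True w(2) by (simp add: suffix_play_def)
        then show ?thesis using True w False lh
          by (intro bexI[of _ w] exI[of _ "Suc n"]) (auto simp: plan_snoc plan_step_def wsum_snoc)
      next
        case 2: False
        have "owner G (last h) = i"
        proof (rule ccontr)
          assume "owner G (last h) \<noteq> i"
          then have "x = s h" using snoc.prems(2) False by (simp add: compatible_snoc \<sigma>_def)
          then show False using 2 by (simp add: s_def)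
        qed
        then have o: "owner G (P w n) = i" "(P w n, x) \<in> edges G" using lh h by auto
        have "x \<in> R" using closed[OF w(1) o] .
        moreover have "wsum ?g (h @ [x]) \<le> f v - f x"
          using pot[OF w(1) o] w(3) False lh by (simp add: wsum_snoc)
        ultimately show ?thesis using 2 False
          by (intro bexI[of _ x] exI[of _ 0]) (auto simp: plan_snoc plan_step_def)
      qed
    qed
  qed (simp add: history_from_def is_history_def)
  have sig: "\<sigma>(i := s) = \<sigma>" by (auto simp: \<sigma>_def)
  have outc: "outcome G \<sigma> h = plan P h" if h: "is_history G h" for h
  proof -
    have hn: "h \<noteq> []" using h by (simp add: is_history_def)
    have "plan P (out_hist G \<sigma> h k) = suffix_play (plan P h) k" for k
    proof (induction k)
      case (Suc k)
      show ?case using Suc hn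
        by (simp add: Let_def plan_snoc plan_step_def \<sigma>_def s_def)
    qed simp
    moreover have "is_history G (out_hist G \<sigma> h k)" for k
      using out_hist_history[OF wf _ h] strat by (simp add: \<sigma>_def)
    ultimately have "outcome G \<sigma> h k = plan P h k" for k
      using pl[of "out_hist G \<sigma> h k"] by (simp add: outcome_def suffix_play_def)
    then show ?thesis by blast
  qed
  have "\<sigma> \<in> lam_rat G lam v"
  proof -
    have "consistent G lam (outcome G (\<sigma>(i := s)) h)"
      if "history_from G v h" "compatible G i \<sigma> h" for h
      using inv[OF that] that(1) cons unfolding sig
      by (auto simp: outc history_from_def consistent_suffix)
    then show ?thesis using strat i by (auto simp: lam_rat_def Let_def \<sigma>_def)
  qed
  moreover have "mean_payoff G i (outcome G (\<sigma>(i := \<tau>)) [v]) \<le> ereal c" if tau: "is_strategy G i \<tau>" for \<tau>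
  proof -
    define \<rho> where "\<rho> = outcome G (\<sigma>(i := \<tau>)) [v]"
    define hs where "hs n = map \<rho> [0..<Suc n]" for n
    have st: "is_strategy G j ((\<sigma>(i := \<tau>)) j)" for j using strat tau by (simp add: \<sigma>_def)
    have pr: "is_play G \<rho>" unfolding \<rho>_def by (rule is_play_outcome[OF wf]) (use st vV in auto)
    have hs: "history_from G v (hs n)" "compatible G i \<sigma> (hs n)" for n
    proof -
      have "hs n = out_hist G (\<sigma>(i := \<tau>)) [v] n" by (simp only: hs_def \<rho>_def out_hist_single)
      then show "compatible G i \<sigma> (hs n)" using compatible_out_hist[of "[v]"] by simp
      have "hd (hs n) = v" using outcome_0[of G "\<sigma>(i := \<tau>)" "[v]"] by (simp add: hs_def hd_map \<rho>_def del: upt_Suc)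
      then show "history_from G v (hs n)"
        using is_history_play[OF wf pr, of n] by (simp add: history_from_def hs_def)
    qed
    have hsS: "hs (Suc n) = hs n @ [\<rho> (Suc n)]" "hs n \<noteq> []" for n by (simp_all add: hs_def)
    have whs: "wsum ?g (hs n) = psum ?g \<rho> n" for n unfolding hs_def by (rule wsum_map_play)
    \<comment> \<open>If deviations cease, the payoff is that of the last plan. Otherwise the sums
      right after the deviations are bounded, and infinitely many bounded sums suffice for a limit
      inferior.\<close>
    show ?thesis
    proof (cases "\<exists>N. \<forall>n\<ge>N. \<rho> (Suc n) = plan P (hs n) 1")
      case True
      then obtain N where N: "\<And>n. n \<ge> N \<Longrightarrow> \<rho> (Suc n) = plan P (hs n) 1" by blast
      have *: "plan P (hs (N + k)) = suffix_play (plan P (hs N)) k" for k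
      proof (induction k)
        case (Suc k)
        have "plan P (hs (N + Suc k)) = plan_step P (plan P (hs (N + k))) (\<rho> (Suc (N + k)))"
          by (simp add: hsS plan_snoc)
        then show ?case using N[of "N + k"] Suc by (simp add: plan_step_def)
      qed simp
      have "suffix_play \<rho> N k = plan P (hs N) k" for k
      proof -
        have "\<rho> (N + k) = last (hs (N + k))" by (simp add: hs_def)
        also have "\<dots> = plan P (hs (N + k)) 0" using pl hs(1)[of "N + k"] by (simp add: history_from_def)
        finally show ?thesis using * by (simp add: suffix_play_def)
      qed
      then have eq: "suffix_play \<rho> N = plan P (hs N)" by blast
      obtain w n where w: "w \<in> R" "plan P (hs N) = suffix_play (P w) n" using inv[OF hs[of N]] by blast
      have "mean_payoff G i \<rho> = mean_payoff G i (suffix_play (P w) n)"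
        using mean_payoff_suffix_play[OF wf pr, of i N] eq w(2) by simp
      also have "\<dots> = mean_payoff G i (P w)"
        using w(1) v(2) P by (intro mean_payoff_suffix_play[OF wf]) auto
      finally show ?thesis using mp[OF w(1)] by (simp add: \<rho>_def)
    next
      case False
      have fR: "finite R" using v(2) wf by (auto simp: wf_game_def intro: finite_subset)
      obtain B where B: "\<And>w. w \<in> R \<Longrightarrow> \<bar>f w\<bar> \<le> B" using finite_weight_bound[OF fR, of f] by blast
      have "mean_payoff G i \<rho> \<le> ereal c"
      proof (rule mean_payoff_le[where B = "f v + B"])
        fix N
        obtain n where n: "n \<ge> N" "\<rho> (Suc n) \<noteq> plan P (hs n) 1" using False by blast
        obtain w m where w: "w \<in> R" "plan P (hs n) = suffix_play (P w) m"
          "wsum ?g (hs n) \<le> f v - f w + psum ?g (P w) m" using inv[OF hs[of n]] by blast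
        have l: "last (hs n) = \<rho> n" by (simp add: hs_def)
        have lh: "\<rho> n = P w m" using pl[of "hs n"] hs(1)[of n] w(2) l
          by (simp add: history_from_def suffix_play_def)
        have "owner G (\<rho> n) = i"
        proof (rule ccontr)
          assume "owner G (\<rho> n) \<noteq> i"
          then have "\<rho> (Suc n) = s (hs n)" using hs(2)[of "Suc n"] hsS[of n] l
            by (simp add: compatible_snoc \<sigma>_def)
          then show False using n by (simp add: s_def)
        qed
        then have o: "owner G (P w m) = i" "(P w m, \<rho> (Suc n)) \<in> edges G"
          using lh pr by (auto simp: is_play_def) (metis lh)
        have "\<rho> (Suc n) \<in> R" using closed[OF w(1) o] .
        then have "- B \<le> f (\<rho> (Suc n))" using B[of "\<rho> (Suc n)"] by linarith
        then have "psum ?g \<rho> (Suc n) \<le> f v + B"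
          using pot[OF w(1) o] w(3) lh whs[of n] by simp
        then show "\<exists>n\<ge>N. psum ?g \<rho> n \<le> f v + B" using n(1) by (intro exI[of _ "Suc n"]) auto
      qed
      then show ?thesis by (simp add: \<rho>_def)
    qed
  qed
  ultimately show ?thesis
    unfolding nego_def Let_def i[symmetric] by (intro INF_lower2[of \<sigma>] SUP_least) auto
qed

text \<open>The strategy that witnesses the rationality of a profile already secures
  \<open>lam v\<close> against it, because its outcome is consistent at its first vertex. If there
  is no rational profile, the infimum is \<infinity>.\<close>

lemma nego_ge:
  assumes wf: "wf_game G" and v: "v \<in> verts G"
  shows "lam v \<le> nego G lam v"
proof -
  have "lam v \<le> (SUP \<tau>\<in>{\<tau>. is_strategy G (owner G v) \<tau>}. mean_payoff G (owner G v) (outcome G (\<sigma>(owner G v := \<tau>)) [v]))"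
    if "\<sigma> \<in> lam_rat G lam v" for \<sigma>
  proof -
    obtain \<tau> where t: "is_strategy G (owner G v) \<tau>"
      "\<And>h. history_from G v h \<and> compatible G (owner G v) \<sigma> h \<Longrightarrow> consistent G lam (outcome G (\<sigma>(owner G v := \<tau>)) h)"
      using \<open>\<sigma> \<in> lam_rat G lam v\<close> by (auto simp: lam_rat_def Let_def)
    have "consistent G lam (outcome G (\<sigma>(owner G v := \<tau>)) [v])"
      by (rule t(2)) (simp add: history_from_def v)
    then have "lam v \<le> mean_payoff G (owner G v) (outcome G (\<sigma>(owner G v := \<tau>)) [v])"
      using wf v unfolding consistent_def wf_game_def
      by (metis last_ConsL outcome_0 suffix_play_0)
    then show ?thesis using t(1) by (intro SUP_upper2[of \<tau>]) auto
  qed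
  then show ?thesis unfolding nego_def Let_def by (rule INF_greatest)
qed

section \<open>The histories compatible with a rational profile\<close>

lemma compatible_take: "compatible G i \<sigma> h \<Longrightarrow> compatible G i \<sigma> (take n h)"
  unfolding compatible_def by (auto simp: min_def)

text \<open>The shift by one drops \<open>q 0\<close>, which in the application is the last vertex
  of \<open>h\<close>.\<close>

lemma play_of_history:
  assumes h: "h \<noteq> []" and \<rho>: "\<rho> = (\<lambda>n. if n < length h then h ! n else q (n - length h + 1))"
  shows "map \<rho> [0..<length h + k] = h @ map q [1..<Suc k]"
proof (rule nth_equalityI)
  fix n assume "n < length (map \<rho> [0..<length h + k])"
  then show "map \<rho> [0..<length h + k] ! n = (h @ map q [1..<Suc k]) ! n"
    by (auto simp: \<rho> nth_append simp del: upt_Suc)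
qed simp

text \<open>A profile witnessing the strict inequality is replaced by its compatible histories
  \<open>Hs\<close> and the plays \<open>P\<close> proposed after them. The last clause says that
  deviating infinitely often does not help the challenger: a limit of compatible histories is itself
  an outcome against the profile.\<close>

lemma compatible_family:
  assumes wf: "wf_game G" and v: "v \<in> verts G" and i: "i = owner G v"
    and nego: "nego G lam v < ereal c"
  obtains Hs :: "history set" and P where "[v] \<in> Hs" "\<And>h. h \<in> Hs \<Longrightarrow> is_history G h"
    "\<And>h. h \<in> Hs \<Longrightarrow> is_play G (P h) \<and> P h 0 = last h \<and> consistent G lam (P h) \<and> mean_payoff G i (P h) < ereal c"
    "\<And>h n w'. h \<in> Hs \<Longrightarrow> owner G (P h n) = i \<Longrightarrow> (P h n, w') \<in> edges G \<Longrightarrow>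
        h @ map (P h) [1..<Suc n] @ [w'] \<in> Hs"
    "\<And>\<rho>. is_play G \<rho> \<Longrightarrow> \<forall>N. \<exists>n\<ge>N. map \<rho> [0..<Suc n] \<in> Hs \<Longrightarrow> mean_payoff G i \<rho> < ereal c"
proof -
  obtain \<sigma> where s: "\<sigma> \<in> lam_rat G lam v"
    and sup: "(SUP \<tau>\<in>{\<tau>. is_strategy G i \<tau>}. mean_payoff G i (outcome G (\<sigma>(i := \<tau>)) [v])) < ereal c"
    using nego unfolding nego_def Let_def i[symmetric] by (auto simp: INF_less_iff)
  from s obtain \<tau> where st: "\<And>j. j \<in> players G \<Longrightarrow> j \<noteq> i \<Longrightarrow> is_strategy G j (\<sigma> j)" and t: "is_strategy G i \<tau>"
    and cons: "\<And>h. history_from G v h \<Longrightarrow> compatible G i \<sigma> h \<Longrightarrow> consistent G lam (outcome G (\<sigma>(i := \<tau>)) h)"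
    by (auto simp: lam_rat_def Let_def i)
  define Hs where "Hs = {h. history_from G v h \<and> compatible G i \<sigma> h}"
  define P where "P h = outcome G (\<sigma>(i := \<tau>)) h" for h
  have st': "is_strategy G j ((\<sigma>(i := \<tau>)) j)" if "j \<in> players G" for j using st t that by simp
  have EV: "w' \<in> verts G" if "(u, w') \<in> edges G" for u w' using wf that by (auto simp: wf_game_def)
  have 1: "[v] \<in> Hs" using v by (simp add: Hs_def history_from_def)
  have 2: "is_history G h" if "h \<in> Hs" for h using that by (simp add: Hs_def history_from_def)
  have 5: "mean_payoff G i \<rho> < ereal c"
    if pl: "is_play G \<rho>" and ex: "\<forall>N. \<exists>n\<ge>N. map \<rho> [0..<Suc n] \<in> Hs" for \<rho>
  proof -
    have comp: "compatible G i \<sigma> (map \<rho> [0..<Suc k])" for k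
    proof -
      obtain n where n: "n \<ge> k" "map \<rho> [0..<Suc n] \<in> Hs" using ex by blast
      have "compatible G i \<sigma> (take (Suc k) (map \<rho> [0..<Suc n]))"
        using n(2) by (intro compatible_take) (simp add: Hs_def)
      moreover have "take (Suc k) (map \<rho> [0..<Suc n]) = map \<rho> [0..<Suc k]"
        using n(1) by (simp add: take_map take_upt del: upt_Suc)
      ultimately show ?thesis by simp
    qed
    have \<rho>0: "\<rho> 0 = v"
    proof -
      obtain n where "map \<rho> [0..<Suc n] \<in> Hs" using ex by blast
      then show ?thesis by (simp add: Hs_def history_from_def hd_map del: upt_Suc)
    qed
    \<comment> \<open>Follows \<open>\<rho>\<close> as long as the history is one of its prefixes;
      elsewhere any edge will do, as a strategy must be legal on all histories.\<close>
    define t' where "t' h = (if h = map \<rho> [0..<length h] then \<rho> (length h) else (SOME w. (last h, w) \<in> edges G))" for h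
    have t': "is_strategy G i t'"
      unfolding is_strategy_def
    proof (intro allI impI)
      fix h assume h: "is_history G h \<and> owner G (last h) = i"
      then have hn: "h \<noteq> []" and lv: "last h \<in> verts G" by (auto simp: is_history_def)
      show "(last h, t' h) \<in> edges G"
      proof (cases "h = map \<rho> [0..<length h]")
        case True
        obtain m where m: "length h = Suc m" using hn by (cases h) auto
        have "h = map \<rho> [0..<Suc m]" using True m by simp
        then have "last h = \<rho> m" by simp
        moreover have "t' h = \<rho> (Suc m)" using True m by (simp add: t'_def)
        ultimately show ?thesis using pl by (simp add: is_play_def)
      next
        case False
        then show ?thesis using wf lv by (auto simp: t'_def wf_game_def intro: someI_ex)
      qed
    qed
    have oh: "out_hist G (\<sigma>(i := t')) [v] k = map \<rho> [0..<Suc k]" for k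
    proof (induction k)
      case (Suc k)
      let ?h = "map \<rho> [0..<Suc k]"
      have l: "last ?h = \<rho> k" by simp
      have "(\<sigma>(i := t')) (owner G (\<rho> k)) ?h = \<rho> (Suc k)"
      proof (cases "owner G (\<rho> k) = i")
        case True
        have "?h = map \<rho> [0..<length ?h]" by simp
        then have "t' ?h = \<rho> (length ?h)" unfolding t'_def by (rule if_P)
        then show ?thesis using True by (simp del: upt_Suc)
      next
        case False
        have "compatible G i \<sigma> (?h @ [\<rho> (Suc k)])" using comp[of "Suc k"] by simp
        moreover have "?h \<noteq> []" by simp
        ultimately have "owner G (last ?h) \<noteq> i \<longrightarrow> \<rho> (Suc k) = \<sigma> (owner G (last ?h)) ?h"
          using compatible_snoc by blast
        then have "\<rho> (Suc k) = \<sigma> (owner G (\<rho> k)) ?h" using False unfolding l by blast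
        then show ?thesis using False l by simp
      qed
      then have "out_hist G (\<sigma>(i := t')) [v] (Suc k) = ?h @ [\<rho> (Suc k)]"
        unfolding out_hist.simps Let_def Suc l by simp
      moreover have "?h @ [\<rho> (Suc k)] = map \<rho> [0..<Suc (Suc k)]" by simp
      ultimately show ?case by (rule trans)
    qed (simp add: \<rho>0)
    have "outcome G (\<sigma>(i := t')) [v] = \<rho>"
    proof
      fix k
      have "outcome G (\<sigma>(i := t')) [v] k = last (map \<rho> [0..<Suc k])" by (simp only: outcome_def oh)
      then show "outcome G (\<sigma>(i := t')) [v] k = \<rho> k" by simp
    qed
    then have "mean_payoff G i \<rho> \<le> (SUP \<tau>\<in>{\<tau>. is_strategy G i \<tau>}. mean_payoff G i (outcome G (\<sigma>(i := \<tau>)) [v]))"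
      using t' by (intro SUP_upper2[of t']) auto
    then show ?thesis using sup by simp
  qed
  have plP: "is_play G (P h)" if "h \<in> Hs" for h
    unfolding P_def using is_play_outcome[OF wf st' 2[OF that]] .
  have oh: "out_hist G (\<sigma>(i := \<tau>)) h k = h @ map (P h) [1..<Suc k]" if "h \<in> Hs" for h k
    using out_hist_conv[of h] 2[OF that] unfolding P_def is_history_def by blast
  have ohH: "out_hist G (\<sigma>(i := \<tau>)) h k \<in> Hs" if "h \<in> Hs" for h k
  proof -
    have hn: "h \<noteq> []" using 2[OF that] by (simp add: is_history_def)
    have "is_history G (out_hist G (\<sigma>(i := \<tau>)) h k)" by (rule out_hist_history[OF wf st' 2[OF that]])
    moreover have "compatible G i \<sigma> (out_hist G (\<sigma>(i := \<tau>)) h k)"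
      using compatible_out_hist[OF hn] that by (simp add: Hs_def)
    moreover have "hd (out_hist G (\<sigma>(i := \<tau>)) h k) = v"
      using that hn oh[OF that, of k] by (simp add: Hs_def history_from_def)
    ultimately show ?thesis by (simp add: Hs_def history_from_def)
  qed
  have 3: "is_play G (P h) \<and> P h 0 = last h \<and> consistent G lam (P h) \<and> mean_payoff G i (P h) < ereal c"
    if h: "h \<in> Hs" for h
  proof -
    have hn: "h \<noteq> []" using 2[OF that] by (simp add: is_history_def)
    \<comment> \<open>The bound on payoffs concerns plays from \<open>v\<close>, so
      \<open>P h\<close> is prefixed with \<open>h\<close>, which does not change its
      payoff.\<close>
    define \<rho> where "\<rho> = (\<lambda>n. if n < length h then h ! n else P h (n - length h + 1))"
    have P0: "P h 0 = last h" by (simp add: P_def outcome_0)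
    have m: "map \<rho> [0..<length h + k] = out_hist G (\<sigma>(i := \<tau>)) h k" for k
      using play_of_history[OF hn \<rho>_def] oh[OF h] by simp
    have suf: "suffix_play \<rho> (length h - 1) = P h"
    proof
      fix k
      show "suffix_play \<rho> (length h - 1) k = P h k"
      proof (cases k)
        case 0
        then show ?thesis using hn by (simp add: suffix_play_def \<rho>_def P0 last_conv_nth)
      next
        case (Suc m)
        have "length h - 1 + k = length h + m" using Suc hn by (cases h) auto
        then show ?thesis using Suc by (simp add: suffix_play_def \<rho>_def)
      qed
    qed
    have plr: "is_play G \<rho>"
      unfolding is_play_def
    proof
      fix n
      have hist: "is_history G (map \<rho> [0..<length h + Suc n])" using ohH[OF h] 2 unfolding m by blast
      have "Suc n < length (map \<rho> [0..<length h + Suc n])" using hn by simp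
      with hist have "(map \<rho> [0..<length h + Suc n] ! n, map \<rho> [0..<length h + Suc n] ! Suc n) \<in> edges G"
        unfolding is_history_def by blast
      then show "(\<rho> n, \<rho> (Suc n)) \<in> edges G" using hn by (simp del: upt_Suc add: nth_append)
    qed
    have "mean_payoff G i \<rho> < ereal c"
    proof (rule 5[OF plr], rule allI)
      fix N
      have "length h + N = Suc (length h + N - 1)" using hn by simp
      then have "map \<rho> [0..<Suc (length h + N - 1)] \<in> Hs" using m[of N] ohH[OF h] by metis
      moreover have "length h + N - 1 \<ge> N" using hn by (cases h) auto
      ultimately show "\<exists>n\<ge>N. map \<rho> [0..<Suc n] \<in> Hs" by blast
    qed
    then have "mean_payoff G i (P h) < ereal c"
      using mean_payoff_suffix_play[OF wf plr, of i "length h - 1"] suf by simp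
    then show ?thesis using plP[OF h] P0 cons h by (simp add: P_def Hs_def)
  qed
  have 4: "h @ map (P h) [1..<Suc n] @ [w'] \<in> Hs"
    if h: "h \<in> Hs" and o: "owner G (P h n) = i" and e: "(P h n, w') \<in> edges G" for h n w'
  proof -
    let ?q = "out_hist G (\<sigma>(i := \<tau>)) h n"
    have hn: "h \<noteq> []" using 2[OF h] by (simp add: is_history_def)
    have q: "?q \<noteq> []" "?q \<in> Hs" using hn ohH[OF h] by auto
    have l: "last ?q = P h n" by (simp add: P_def outcome_def)
    have "?q @ [w'] \<in> Hs" using q l o e EV[OF e]
      by (auto simp: Hs_def history_from_def is_history_snoc compatible_snoc)
    then show ?thesis using oh[OF h, of n] by simp
  qed
  show ?thesis using that[of Hs P] 1 2 3 4 5 by blast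
qed

section \<open>Lassos inside plays\<close>

lemma is_history_take: "is_history G h \<Longrightarrow> is_history G (take (Suc k) h)"
  unfolding is_history_def using set_take_subset by fastforce

lemma wsum_bound:
  assumes "\<And>e. e \<in> edges G \<Longrightarrow> \<bar>g e\<bar> \<le> W" "W \<ge> 0" "is_history G h"
  shows "\<bar>wsum g h\<bar> \<le> real (length h) * W"
  using assms(3)
proof (induction h rule: rev_induct)
  case (snoc x h)
  show ?case
  proof (cases "h = []")
    case False
    then have "is_history G h" "\<bar>g (last h, x)\<bar> \<le> W" using snoc.prems assms(1) by (auto simp: is_history_snoc)
    then show ?thesis using snoc False by (simp add: wsum_snoc algebra_simps)
  qed (use assms(2) in simp)
qed simp

lemma length_distinct_history:
  assumes "wf_game G" "is_history G p" "distinct p"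
  shows "length p \<le> card (verts G)"
  using assms by (metis card_mono distinct_card is_history_def wf_game_def)

text \<open>Loop erasure: cycles are cut out of the play as they close. If all of them were
  positive, the remaining path, whose weight is bounded, would lie below the sums of the play, and
  the payoff would be at least \<open>c\<close>. So some nonpositive cycle closes, and the first one
  yields the lasso. Up to that moment the sums are bounded below, and each lasso vertex is visited
  by the play at a time whose sum is no smaller than the weight of the path to it.\<close>

lemma lasso_exists:
  assumes wf: "wf_game G" and pl: "is_play G \<rho>" and mp: "mean_payoff G i \<rho> < ereal c"
    and g: "g = (\<lambda>e. rew G i e - c)" and W: "W \<ge> 0" "\<And>e. e \<in> edges G \<Longrightarrow> \<bar>g e\<bar> \<le> W"
  obtains p k where "is_history G p" "distinct p" "hd p = \<rho> 0" "k < length p" "(last p, p ! k) \<in> edges G"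
    "wsum g (drop k p @ [p ! k]) \<le> 0"
    "\<And>m. m < length p \<Longrightarrow> \<exists>M. \<rho> M = p ! m \<and> wsum g (take (Suc m) p) \<le> psum g \<rho> M \<and>
        (\<forall>M'\<le>M. psum g \<rho> M' \<ge> - (real (card (verts G)) * W))"
proof (rule ccontr)
  let ?B = "real (card (verts G)) * W"
  assume "\<not> thesis"
  then have no: "\<And>p k. is_history G p \<Longrightarrow> distinct p \<Longrightarrow> hd p = \<rho> 0 \<Longrightarrow> k < length p \<Longrightarrow>
    (last p, p ! k) \<in> edges G \<Longrightarrow>
    (\<And>m. m < length p \<Longrightarrow> \<exists>M. \<rho> M = p ! m \<and> wsum g (take (Suc m) p) \<le> psum g \<rho> M \<and>
        (\<forall>M'\<le>M. psum g \<rho> M' \<ge> - ?B)) \<Longrightarrow> wsum g (drop k p @ [p ! k]) > 0"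
    using that by (meson not_le_imp_less)
  \<comment> \<open>The invariant of the loop erasure: \<open>q\<close> is what remains of the first
    \<open>n\<close> moves after cycles of positive weight have been cut out.\<close>
  define Q where "Q n q \<longleftrightarrow> distinct q \<and> is_history G q \<and> hd q = \<rho> 0 \<and> last q = \<rho> n \<and> wsum g q \<le> psum g \<rho> n \<and>
    (\<forall>m<length q. \<exists>M\<le>n. \<rho> M = q ! m \<and> wsum g (take (Suc m) q) \<le> psum g \<rho> M) \<and>
    (\<forall>M'\<le>n. psum g \<rho> M' \<ge> - ?B)" for n q
  have bound: "wsum g q \<ge> - ?B" if "is_history G q" "distinct q" for q
  proof -
    have "\<bar>wsum g q\<bar> \<le> real (length q) * W" using W(2,1) that(1) by (rule wsum_bound)
    also have "\<dots> \<le> ?B" using length_distinct_history[OF wf that] W(1) by (intro mult_right_mono) auto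
    finally show ?thesis by linarith
  qed
  have "\<exists>q. Q n q" for n
  proof (induction n)
    case 0
    have "Q 0 [\<rho> 0]" using is_play_verts[OF wf pl] W(1) by (simp add: Q_def)
    then show ?case by blast
  next
    case (Suc n)
    then obtain q where q: "Q n q" by blast
    let ?x = "\<rho> (Suc n)"
    have qd: "distinct q" "is_history G q" "q \<noteq> []" "hd q = \<rho> 0" "last q = \<rho> n" "wsum g q \<le> psum g \<rho> n"
      "\<And>m. m < length q \<Longrightarrow> \<exists>M\<le>n. \<rho> M = q ! m \<and> wsum g (take (Suc m) q) \<le> psum g \<rho> M"
      "\<And>M'. M' \<le> n \<Longrightarrow> psum g \<rho> M' \<ge> - ?B" using q by (auto simp: Q_def is_history_def)
    have e: "(last q, ?x) \<in> edges G" using pl qd(5) by (simp add: is_play_def)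
    have wx: "wsum g (q @ [?x]) \<le> psum g \<rho> (Suc n)" using qd by (simp add: wsum_snoc)
    show ?case
    proof (cases "?x \<in> set q")
      case False
      have h: "is_history G (q @ [?x])" "distinct (q @ [?x])"
        using qd e False is_play_verts[OF wf pl] by (auto simp: is_history_snoc)
      have "\<exists>M\<le>Suc n. \<rho> M = (q @ [?x]) ! m \<and> wsum g (take (Suc m) (q @ [?x])) \<le> psum g \<rho> M"
        if "m < length (q @ [?x])" for m
      proof (cases "m < length q")
        case True
        then show ?thesis using qd(7)[of m] by (auto simp: nth_append intro: le_SucI)
      next
        case False
        then have "m = length q" using that by simp
        then show ?thesis using wx by (intro exI[of _ "Suc n"]) auto
      qed
      moreover have "psum g \<rho> M' \<ge> - ?B" if "M' \<le> Suc n" for M'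
        using qd(8)[of M'] bound[OF h] wx that by (cases "M' = Suc n") auto
      ultimately have "Q (Suc n) (q @ [?x])" using h qd wx by (simp add: Q_def)
      then show ?thesis by blast
    next
      case True
      then obtain k where k: "k < length q" "q ! k = ?x" by (auto simp: in_set_conv_nth)
      \<comment> \<open>A nonpositive cycle here would complete a lasso of the excluded
        kind.\<close>
      have pos: "wsum g (drop k q @ [q ! k]) > 0"
        by (rule no) (use qd e k in \<open>auto, meson order_trans\<close>)
      let ?q = "take (Suc k) q"
      have "q @ [?x] = take k q @ q ! k # (drop (Suc k) q @ [?x])"
        using k id_take_nth_drop[of k q] by simp
      then have "wsum g (q @ [?x]) = wsum g (take k q @ [q ! k]) + wsum g (q ! k # (drop (Suc k) q @ [?x]))"
        using wsum_append by metis
      also have "take k q @ [q ! k] = ?q" using k by (simp add: take_Suc_conv_app_nth)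
      also have "q ! k # (drop (Suc k) q @ [?x]) = drop k q @ [q ! k]"
        using k by (metis Cons_nth_drop_Suc append_Cons)
      finally have wq: "wsum g ?q \<le> psum g \<rho> (Suc n)" using pos wx by linarith
      have h: "is_history G ?q" "distinct ?q" using qd is_history_take by auto
      have "last ?q = ?x" using k by (simp add: take_Suc_conv_app_nth)
      moreover have "hd ?q = \<rho> 0" using qd by (cases q) auto
      moreover have "\<exists>M\<le>Suc n. \<rho> M = ?q ! m \<and> wsum g (take (Suc m) ?q) \<le> psum g \<rho> M"
        if "m < length ?q" for m
      proof -
        have m: "m < length q" "m \<le> k" using that by auto
        then have "?q ! m = q ! m" "take (Suc m) ?q = take (Suc m) q" by (auto simp: min_def)
        then show ?thesis using qd(7)[OF m(1)] by (metis le_SucI)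
      qed
      moreover have "psum g \<rho> M' \<ge> - ?B" if "M' \<le> Suc n" for M'
        using qd(8)[of M'] bound[OF h] wq that by (cases "M' = Suc n") auto
      ultimately have "Q (Suc n) ?q" using h wq by (simp add: Q_def)
      then show ?thesis by blast
    qed
  qed
  then have "psum g \<rho> n \<ge> - ?B" for n unfolding Q_def by blast
  then have "mean_payoff G i \<rho> \<ge> ereal c" unfolding g by (rule mean_payoff_ge)
  then show False using mp by simp
qed

section \<open>The first-cycle game\<close>

text \<open>A stack records the deviations made so far, most recent first, with the weight gained by each;
  the challenger wins as soon as a deviation closes a cycle of positive weight.\<close>

inductive challenger_wins :: "(nat \<Rightarrow> 'o set) \<Rightarrow> ('o \<Rightarrow> (real \<times> nat) set) \<Rightarrow> (real \<times> nat) list \<Rightarrow> bool"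
  for opts mv where
  "(\<And>opt. opt \<in> opts (snd (hd s)) \<Longrightarrow> \<exists>x w. (x, w) \<in> mv opt \<and>
      ((\<exists>s1 y s2. s = s1 @ (y, w) # s2 \<and> x + sum_list (map fst s1) > 0) \<or>
       (w \<notin> snd ` set s \<and> challenger_wins opts mv ((x, w) # s)))) \<Longrightarrow> challenger_wins opts mv s"

lemma abs_stack_height_le:
  fixes s :: "(real \<times> nat) list"
  assumes "finite V" "distinct (map snd s)" "snd ` set s \<subseteq> V" "\<And>x. x \<in> fst ` set s \<Longrightarrow> \<bar>x\<bar> \<le> Z" "Z \<ge> 0"
  shows "\<bar>sum_list (map fst s)\<bar> \<le> real (card V) * Z"
proof -
  have "\<bar>sum_list (map fst s)\<bar> \<le> real (length s) * Z"
    using assms(4)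
  proof (induction s)
    case (Cons a s)
    have "\<bar>fst a\<bar> \<le> Z" "\<bar>sum_list (map fst s)\<bar> \<le> real (length s) * Z" using Cons by auto
    then show ?case by (simp add: algebra_simps)
  qed simp
  also have "length s = card (snd ` set s)" using assms(2) distinct_card[of "map snd s"] by simp
  then have "real (length s) * Z \<le> real (card V) * Z"
    using assms card_mono by (intro mult_right_mono) auto
  finally show ?thesis .
qed

text \<open>The potential of a vertex is the least negated height of a stack that ends there and that the
  challenger does not win: closing a cycle of nonpositive weight can only raise the height.\<close>

lemma potential_if_not_challenger_wins:
  fixes mv :: "'o \<Rightarrow> (real \<times> nat) set"
  assumes R: "finite V" "R \<subseteq> V" and Z: "finite Z" "Zm \<ge> 0"
    and mv: "\<And>w opt x w'. w \<in> R \<Longrightarrow> opt \<in> opts w \<Longrightarrow> (x, w') \<in> mv opt \<Longrightarrow> x \<in> Z \<and> \<bar>x\<bar> \<le> Zm \<and> w' \<in> R"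
    and nw: "\<And>w. w \<in> R \<Longrightarrow> \<not> challenger_wins opts mv [(0, w)]"
  obtains f where "\<And>w. w \<in> R \<Longrightarrow> \<bar>f w\<bar> \<le> real (card V) * Zm"
    "\<And>w. w \<in> R \<Longrightarrow> \<exists>opt\<in>opts w. \<forall>(x, w')\<in>mv opt. x + f w' \<le> f w"
proof -
  \<comment> \<open>The entry at the bottom of a stack carries weight 0.\<close>
  define A where "A = insert 0 {x \<in> Z. \<bar>x\<bar> \<le> Zm}"
  \<comment> \<open>Older stacks are suffixes of the list. Requiring that none of them is won keeps
    \<open>X\<close> closed under popping to an earlier visit.\<close>
  define X where "X = {s. s \<noteq> [] \<and> distinct (map snd s) \<and> set s \<subseteq> A \<times> R \<and>
    (\<forall>s1 s2. s = s1 @ s2 \<longrightarrow> s2 \<noteq> [] \<longrightarrow> \<not> challenger_wins opts mv s2)}"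
  define H where "H s = sum_list (map fst s)" for s :: "(real \<times> nat) list"
  define X' where "X' w = {s \<in> X. snd (hd s) = w}" for w
  have fR: "finite R" using R finite_subset by blast
  have "X \<subseteq> {s. set s \<subseteq> A \<times> R \<and> length s \<le> card R}"
  proof
    fix s assume "s \<in> X"
    then have s: "distinct (map snd s)" "set s \<subseteq> A \<times> R" by (auto simp: X_def)
    have "length s = card (snd ` set s)" using s(1) distinct_card[of "map snd s"] by simp
    also have "\<dots> \<le> card R" using s(2) fR by (intro card_mono) auto
    finally show "s \<in> {s. set s \<subseteq> A \<times> R \<and> length s \<le> card R}" using s by simp
  qed
  moreover have "finite {s. set s \<subseteq> A \<times> R \<and> length s \<le> card R}"
    using fR Z by (intro finite_lists_length_le) (auto simp: A_def)
  ultimately have "finite X" by (rule finite_subset)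
  then have fX: "finite (X' w)" for w by (simp add: X'_def)
  have X0: "[(0, w)] \<in> X' w" if "w \<in> R" for w
    using that nw by (auto simp: X'_def X_def A_def Cons_eq_append_conv)
  define f where "f w = Min ((\<lambda>s. - H s) ` X' w)" for w
  have att: "\<exists>s\<in>X' w. f w = - H s" if "w \<in> R" for w
  proof -
    have "f w \<in> (\<lambda>s. - H s) ` X' w" unfolding f_def using fX X0[OF that] by (intro Min_in) auto
    then show ?thesis by blast
  qed
  have le: "f (snd (hd s)) \<le> - H s" if "s \<in> X" for s
    unfolding f_def by (rule Min_le) (use fX that in \<open>auto simp: X'_def\<close>)
  show ?thesis
  proof
    fix w assume w: "w \<in> R"
    then obtain s where s: "s \<in> X" "snd (hd s) = w" "f w = - H s" using att by (auto simp: X'_def)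
    have "\<bar>H s\<bar> \<le> real (card V) * Zm" unfolding H_def
      using s(1) R Z by (intro abs_stack_height_le) (auto simp: X_def A_def)
    then show "\<bar>f w\<bar> \<le> real (card V) * Zm" using s(3) by simp
    have "\<not> challenger_wins opts mv s" using s(1) by (auto simp: X_def)
    then obtain opt where opt: "opt \<in> opts w"
      "\<And>x w'. (x, w') \<in> mv opt \<Longrightarrow> (\<forall>s1 y s2. s = s1 @ (y, w') # s2 \<longrightarrow> x + sum_list (map fst s1) \<le> 0) \<and>
        (w' \<notin> snd ` set s \<longrightarrow> \<not> challenger_wins opts mv ((x, w') # s))"
      using challenger_wins.intros[where s = s and opts = opts and mv = mv] s(2) by (meson not_le_imp_less)
    have "x + f w' \<le> f w" if m: "(x, w') \<in> mv opt" for x w'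
    proof (cases "w' \<in> snd ` set s")
      case True
      then obtain y where "(y, w') \<in> set s" by auto
      then obtain s1 s2 where s12: "s = s1 @ (y, w') # s2" by (meson split_list)
      have "(y, w') # s2 \<in> X" using s(1) unfolding X_def s12 by auto
      then have "f w' \<le> - H ((y, w') # s2)" using le by fastforce
      moreover have "x + sum_list (map fst s1) \<le> 0" using opt(2)[OF m] s12 by blast
      ultimately show ?thesis unfolding s(3) by (simp add: s12 H_def)
    next
      case False
      have "(x, w') # s \<in> X"
        using s(1) False opt(2)[OF m] mv[OF w opt(1) m]
        by (auto simp: X_def A_def Cons_eq_append_conv)
      then have "f w' \<le> - H ((x, w') # s)" using le by fastforce
      then show ?thesis unfolding s(3) by (simp add: H_def)
    qed
    then show "\<exists>opt\<in>opts w. \<forall>(x, w')\<in>mv opt. x + f w' \<le> f w" using opt(1) by blast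
  qed
qed

section \<open>From the first-cycle game back to infinite plays\<close>

lemma wsum_append_play:
  assumes "h \<noteq> []" "last h = \<rho> 0"
  shows "wsum g (h @ map \<rho> [1..<Suc n]) = wsum g h + psum g \<rho> n"
proof (induction n)
  case (Suc n)
  have l: "last (h @ map \<rho> [1..<Suc n]) = \<rho> n" using assms by (cases n) auto
  have "wsum g ((h @ map \<rho> [1..<Suc n]) @ [\<rho> (Suc n)]) = wsum g (h @ map \<rho> [1..<Suc n]) + g (\<rho> n, \<rho> (Suc n))"
    by (subst wsum_snoc) (use assms l in auto)
  then show ?case using Suc by simp
qed simp

lemma play_of_increasing_histories:
  fixes h :: "nat \<Rightarrow> nat list"
  assumes "h 0 \<noteq> []" "\<And>k. \<exists>t. t \<noteq> [] \<and> h (Suc k) = h k @ t"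
  obtains \<rho> where "\<And>k. h k = map \<rho> [0..<length (h k)]" "\<And>k. length (h k) > k"
proof -
  have len: "length (h k) > k" for k
  proof (induction k)
    case (Suc k)
    obtain t where "t \<noteq> []" "h (Suc k) = h k @ t" using assms(2) by blast
    then show ?case using Suc by (cases t) auto
  qed (use assms in simp)
  have nth: "h (k + m) ! n = h k ! n" if "n < length (h k)" for k m n
  proof (induction m)
    case (Suc m)
    obtain t where t: "h (Suc (k + m)) = h (k + m) @ t" using assms(2) by blast
    have "\<exists>t'. h (k + m) = h k @ t'" for m
    proof (induction m)
      case (Suc m)
      then show ?case using assms(2)[of "k + m"] by auto
    qed simp
    then have "n < length (h (k + m))" using that by (metis length_append trans_less_add1)
    then show ?case using t Suc by (simp add: nth_append)
  qed simp
  have "h k ! n = h n ! n" if "n < length (h k)" for k n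
  proof (cases "k \<le> n")
    case True
    then show ?thesis using nth[OF that, of "n - k"] by simp
  next
    case False
    then show ?thesis using nth[of n n "k - n"] len by simp
  qed
  then have "h k = map (\<lambda>n. h n ! n) [0..<length (h k)]" for k
    by (intro nth_equalityI) auto
  then show ?thesis using that len by blast
qed

text \<open>A winning challenger could play against the actual proposals \<open>P\<close>: each of
  them offers an option by \<open>sim\<close>, and the winning reply becomes a deviation from the
  proposed play. Popping each closed cycle of positive weight and playing on yields an infinite
  play. Its sums stay above the stack height, which is bounded, up to a constant; so its payoff is
  at least \<open>c\<close>, contradicting \<open>lim\<close>.\<close>

lemma not_challenger_wins:
  fixes opts :: "nat \<Rightarrow> 'o set"
  assumes wf: "wf_game G" and g: "g = (\<lambda>e. rew G i e - c)"
    and hist: "\<And>h. h \<in> Hs \<Longrightarrow> is_history G h"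
    and P0: "\<And>h. h \<in> Hs \<Longrightarrow> P h 0 = last h"
    and dev: "\<And>h n w'. h \<in> Hs \<Longrightarrow> owner G (P h n) = i \<Longrightarrow> (P h n, w') \<in> edges G \<Longrightarrow>
        h @ map (P h) [1..<Suc n] @ [w'] \<in> Hs"
    and lim: "\<And>\<rho>. is_play G \<rho> \<Longrightarrow> \<forall>N. \<exists>n\<ge>N. map \<rho> [0..<Suc n] \<in> Hs \<Longrightarrow> mean_payoff G i \<rho> < ereal c"
    and Z: "Z \<ge> 0" "\<And>h opt x w'. h \<in> Hs \<Longrightarrow> opt \<in> opts (last h) \<Longrightarrow> (x, w') \<in> mv opt \<Longrightarrow> \<bar>x\<bar> \<le> Z"
    and B: "B \<ge> 0"
    and sim: "\<And>h. h \<in> Hs \<Longrightarrow> \<exists>opt\<in>opts (last h). \<forall>(x, w')\<in>mv opt. \<exists>M. owner G (P h M) = i \<and>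
        (P h M, w') \<in> edges G \<and> x \<le> psum g (P h) M + g (P h M, w') \<and> (\<forall>M'\<le>M. psum g (P h) M' \<ge> - B)"
    and h0: "h0 \<in> Hs"
  shows "\<not> challenger_wins opts mv [(0, last h0)]"
proof
  assume cw: "challenger_wins opts mv [(0, last h0)]"
  let ?V = "verts G"
  define H where "H s = sum_list (map fst s)" for s :: "(real \<times> nat) list"
  have fV: "finite ?V" using wf by (simp add: wf_game_def)
  have hn: "h \<noteq> []" if "h \<in> Hs" for h using hist[OF that] by (simp add: is_history_def)
  obtain B0 where B0: "\<And>m. m \<in> {0..length h0} \<Longrightarrow> \<bar>wsum g (take m h0)\<bar> \<le> B0"
    using finite_weight_bound[of "{0..length h0}" "\<lambda>m. wsum g (take m h0)"] by auto
  \<comment> \<open>Room for the initial history, for the height of the stack, and for how far the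
    sums may sink along a proposal before a deviation.\<close>
  define C where "C = \<bar>B0\<bar> + real (card ?V) * Z + B"
  \<comment> \<open>The true history \<open>h\<close> runs along with the virtual stack
    \<open>s\<close>. Popped cycles have positive weight, so the stack never overstates the weight
    gained since \<open>h0\<close>; all older stacks are kept won so that play can resume after
    popping.\<close>
  define I where "I = (\<lambda>(h, s). h \<in> Hs \<and> s \<noteq> [] \<and> last h = snd (hd s) \<and> distinct (map snd s) \<and>
     set s \<subseteq> {x. \<bar>x\<bar> \<le> Z} \<times> ?V \<and> (\<forall>s1 s2. s = s1 @ s2 \<longrightarrow> s2 \<noteq> [] \<longrightarrow> challenger_wins opts mv s2) \<and>
     wsum g h \<ge> H s + wsum g h0 \<and> (\<forall>m\<le>length h. wsum g (take m h) \<ge> - C))"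
  have w0: "\<bar>wsum g h0\<bar> \<le> \<bar>B0\<bar>" using B0[of "length h0"] by simp
  have Hb: "\<bar>H s\<bar> \<le> real (card ?V) * Z" if "I (h, s)" for h s
    unfolding H_def using that fV Z(1) by (intro abs_stack_height_le) (auto simp: I_def)
  have I0: "I (h0, [(0, last h0)])"
  proof -
    have "last h0 \<in> ?V" using hist[OF h0] by (auto simp: is_history_def)
    moreover have "wsum g (take m h0) \<ge> - C" if "m \<le> length h0" for m
    proof -
      have "0 \<le> real (card ?V) * Z" using Z by simp
      then show ?thesis using B0[of m] that B unfolding C_def by auto
    qed
    ultimately show ?thesis using h0 cw Z(1) by (auto simp: I_def H_def Cons_eq_append_conv)
  qed
  have step: "\<exists>y. I y \<and> (\<exists>t. t \<noteq> [] \<and> fst y = fst x @ t)" if "I x" for x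
  proof -
    obtain h s where x: "x = (h, s)" by (cases x)
    have I: "I (h, s)" using that x by simp
    then have hH: "h \<in> Hs" and sn: "s \<noteq> []" and lh: "last h = snd (hd s)" and ds: "distinct (map snd s)"
      and ss: "set s \<subseteq> {x. \<bar>x\<bar> \<le> Z} \<times> ?V"
      and cws: "\<And>s1 s2. s = s1 @ s2 \<Longrightarrow> s2 \<noteq> [] \<Longrightarrow> challenger_wins opts mv s2"
      and wh: "wsum g h \<ge> H s + wsum g h0" and pre: "\<And>m. m \<le> length h \<Longrightarrow> wsum g (take m h) \<ge> - C"
      by (auto simp: I_def)
    obtain opt where opt: "opt \<in> opts (last h)" and simo: "\<And>x w'. (x, w') \<in> mv opt \<Longrightarrow> \<exists>M. owner G (P h M) = i \<and>
        (P h M, w') \<in> edges G \<and> x \<le> psum g (P h) M + g (P h M, w') \<and> (\<forall>M'\<le>M. psum g (P h) M' \<ge> - B)"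
      using sim[OF hH] by fast
    have "challenger_wins opts mv s" using cws[of "[]" s] sn by simp
    then obtain z w where zw: "(z, w) \<in> mv opt" and alt: "(\<exists>s1 y s2. s = s1 @ (y, w) # s2 \<and> z + sum_list (map fst s1) > 0) \<or>
       (w \<notin> snd ` set s \<and> challenger_wins opts mv ((z, w) # s))"
    proof (cases rule: challenger_wins.cases)
      case 1
      then show ?thesis using that opt unfolding lh by blast
    qed
    obtain M where M: "owner G (P h M) = i" "(P h M, w) \<in> edges G" "z \<le> psum g (P h) M + g (P h M, w)"
      "\<And>M'. M' \<le> M \<Longrightarrow> psum g (P h) M' \<ge> - B" using simo[OF zw] by blast
    define h' where "h' = h @ map (P h) [1..<Suc M] @ [w]"
    have h'H: "h' \<in> Hs" unfolding h'_def by (rule dev[OF hH M(1,2)])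
    have wV: "w \<in> ?V" using M(2) wf by (auto simp: wf_game_def)
    have zZ: "\<bar>z\<bar> \<le> Z" using Z(2)[OF hH opt zw] .
    have wM: "wsum g (h @ map (P h) [1..<Suc M']) = wsum g h + psum g (P h) M'" for M'
      using wsum_append_play[of h "P h"] hn[OF hH] P0[OF hH] by simp
    have lM: "last (h @ map (P h) [1..<Suc M]) = P h M" using P0[OF hH] by (cases M) auto
    have "wsum g h' = wsum g ((h @ map (P h) [1..<Suc M]) @ [w])" by (simp add: h'_def)
    also have "\<dots> = wsum g (h @ map (P h) [1..<Suc M]) + g (P h M, w)"
      using lM hn[OF hH] by (subst wsum_snoc) auto
    finally have wh': "wsum g h' \<ge> H s + z + wsum g h0" using wM[of M] M(3) wh by simp
    obtain s' where s': "s' \<noteq> []" "w = snd (hd s')" "distinct (map snd s')" "set s' \<subseteq> {x. \<bar>x\<bar> \<le> Z} \<times> ?V"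
      "\<And>s1 s2. s' = s1 @ s2 \<Longrightarrow> s2 \<noteq> [] \<Longrightarrow> challenger_wins opts mv s2" "H s' \<le> H s + z"
    proof (cases "w \<in> snd ` set s")
      case True
      then obtain s1 y s2 where s12: "s = s1 @ (y, w) # s2" "z + sum_list (map fst s1) > 0" using alt by blast
      show ?thesis
      proof (rule that[of "(y, w) # s2"])
        show "challenger_wins opts mv t2" if "(y, w) # s2 = t1 @ t2" "t2 \<noteq> []" for t1 t2
          by (rule cws[of "s1 @ t1"]) (use that s12 in auto)
      qed (use s12 ds ss in \<open>auto simp: H_def\<close>)
    next
      case False
      then have "challenger_wins opts mv ((z, w) # s)" using alt by (metis in_set_conv_decomp image_eqI snd_conv)
      then show ?thesis using False ds ss zZ wV cws
        by (intro that[of "(z, w) # s"]) (auto simp: H_def Cons_eq_append_conv)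
    qed
    have Hs': "H s' \<ge> - (real (card ?V) * Z)"
    proof -
      have "\<bar>H s'\<bar> \<le> real (card ?V) * Z"
        unfolding H_def using s' fV Z(1) by (intro abs_stack_height_le) auto
      then show ?thesis by linarith
    qed
    have "wsum g (take m h') \<ge> - C" if "m \<le> length h'" for m
    proof -
      have "length h' = length h + M + 1" "m \<le> length h'" using that by (auto simp: h'_def)
      then consider "m \<le> length h" | "m = length h + (m - length h)" "m - length h \<le> M" | "m = length h'"
        by linarith
      then show ?thesis
      proof cases
        case 1
        then show ?thesis using pre by (simp add: h'_def)
      next
        case 2
        have "take m h' = h @ map (P h) [1..<Suc (m - length h)]"
          using 2 by (simp add: h'_def take_map take_upt del: upt_Suc)
        then have "wsum g (take m h') \<ge> H s + wsum g h0 - B" using wM[of "m - length h"] wh M(4)[OF 2(2)] by simp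
        then show ?thesis using Hb[OF I] w0 unfolding C_def by linarith
      next
        case 3
        have "wsum g h' \<ge> - (real (card ?V) * Z) + wsum g h0" using wh' s'(6) Hs' by linarith
        then show ?thesis using 3 w0 B unfolding C_def by simp
      qed
    qed
    then have "I (h', s')" using h'H s' wh' by (auto simp: I_def h'_def)
    then show ?thesis by (intro exI[of _ "(h', s')"]) (auto simp: x h'_def)
  qed
  obtain F where F: "F 0 = (h0, [(0, last h0)])" "\<And>n. I (F n)" "\<And>n. \<exists>t. t \<noteq> [] \<and> fst (F (Suc n)) = fst (F n) @ t"
  proof -
    have "\<exists>F. \<forall>n. (I (F n) \<and> (n = 0 \<longrightarrow> F n = (h0, [(0, last h0)]))) \<and> (\<exists>t. t \<noteq> [] \<and> fst (F (Suc n)) = fst (F n) @ t)"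
      using I0 step by (intro dependent_nat_choice) auto
    then show ?thesis using that by blast
  qed
  have FH: "fst (F n) \<in> Hs" for n using F(2)[of n] by (auto simp: I_def)
  obtain \<rho> where \<rho>: "\<And>k. fst (F k) = map \<rho> [0..<length (fst (F k))]" "\<And>k. length (fst (F k)) > k"
    using play_of_increasing_histories[of "\<lambda>k. fst (F k)"] F(3) hn[OF FH] by blast
  have pl: "is_play G \<rho>"
    unfolding is_play_def
  proof
    fix n
    let ?h = "fst (F (Suc n))"
    have l: "Suc n < length ?h" using \<rho>(2) by blast
    then have "(?h ! n, ?h ! Suc n) \<in> edges G" using hist[OF FH] by (auto simp: is_history_def)
    moreover have "?h ! n = \<rho> n" "?h ! Suc n = \<rho> (Suc n)" using l \<rho>(1)[of "Suc n"]
      by (metis Suc_lessD add_0 nth_map_upt diff_zero)+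
    ultimately show "(\<rho> n, \<rho> (Suc n)) \<in> edges G" by simp
  qed
  have "mean_payoff G i \<rho> < ereal c"
  proof (rule lim[OF pl], rule allI)
    fix N
    have "length (fst (F N)) = Suc (length (fst (F N)) - 1)" using \<rho>(2)[of N] by simp
    then have "map \<rho> [0..<Suc (length (fst (F N)) - 1)] \<in> Hs" using \<rho>(1)[of N] FH[of N] by metis
    then show "\<exists>n\<ge>N. map \<rho> [0..<Suc n] \<in> Hs" using \<rho>(2)[of N] by (intro exI[of _ "length (fst (F N)) - 1"]) auto
  qed
  moreover have "mean_payoff G i \<rho> \<ge> ereal c"
  proof (rule mean_payoff_ge[where B = C])
    fix n
    have "wsum g (take (Suc n) (fst (F n))) \<ge> - C" using F(2)[of n] \<rho>(2)[of n] by (auto simp: I_def)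
    moreover have "take (Suc n) (fst (F n)) = map \<rho> [0..<Suc n]"
      using \<rho>(2)[of n] by (subst \<rho>(1)) (simp add: take_map take_upt del: upt_Suc)
    ultimately show "- C \<le> psum (\<lambda>e. rew G i e - c) \<rho> n" using wsum_map_play[of g \<rho> n] by (simp add: g)
  qed
  ultimately show False by simp
qed

section \<open>Circulations\<close>

definition inner_edges :: "mpgame \<Rightarrow> nat set \<Rightarrow> (nat \<times> nat) set" where
  "inner_edges G K = edges G \<inter> K \<times> K"

text \<open>A singleton without a loop qualifies, but it carries no circulation, whose total mass
  has to be 1.\<close>

definition strongly_connected :: "mpgame \<Rightarrow> nat set \<Rightarrow> bool" where
  "strongly_connected G K \<longleftrightarrow> K \<noteq> {} \<and> (\<forall>a\<in>K. \<forall>b\<in>K. (a, b) \<in> (inner_edges G K)\<^sup>*)"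

definition circulation :: "mpgame \<Rightarrow> nat set \<Rightarrow> (nat \<times> nat \<Rightarrow> real) \<Rightarrow> bool" where
  "circulation G K x \<longleftrightarrow> (\<forall>e\<in>inner_edges G K. 0 \<le> x e) \<and> (\<Sum>e\<in>inner_edges G K. x e) = 1 \<and>
     (\<forall>u\<in>K. (\<Sum>e\<in>{e \<in> inner_edges G K. fst e = u}. x e) = (\<Sum>e\<in>{e \<in> inner_edges G K. snd e = u}. x e))"

definition flow_value :: "mpgame \<Rightarrow> nat set \<Rightarrow> (nat \<times> nat \<Rightarrow> real) \<Rightarrow> nat \<Rightarrow> real" where
  "flow_value G K x j = (\<Sum>e\<in>inner_edges G K. x e * rew G j e)"

lemma finite_inner_edges: "wf_game G \<Longrightarrow> finite (inner_edges G K)"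
  by (simp add: inner_edges_def finite_edges)

text \<open>Bolzano-Weierstrass, applied to one coordinate after another.\<close>

lemma finite_common_subseq:
  fixes x :: "nat \<Rightarrow> 'a \<Rightarrow> real"
  assumes "finite A" "\<And>a n. a \<in> A \<Longrightarrow> \<bar>x n a\<bar> \<le> B"
  obtains \<phi> :: "nat \<Rightarrow> nat" and l where "strict_mono \<phi>" "\<And>a. a \<in> A \<Longrightarrow> (\<lambda>n. x (\<phi> n) a) \<longlonglongrightarrow> l a"
proof -
  have "\<exists>\<phi>::nat\<Rightarrow>nat. \<exists>l. strict_mono \<phi> \<and> (\<forall>a\<in>A. (\<lambda>n. x (\<phi> n) a) \<longlonglongrightarrow> l a)"
    using assms
  proof (induction A rule: finite_induct)
    case empty
    show ?case by (intro exI[of _ id]) (auto simp: strict_mono_def)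
  next
    case (insert a A)
    have "\<exists>\<phi>::nat\<Rightarrow>nat. \<exists>l. strict_mono \<phi> \<and> (\<forall>a\<in>A. (\<lambda>n. x (\<phi> n) a) \<longlonglongrightarrow> l a)"
      by (rule insert.IH) (rule insert.prems, blast)
    then obtain \<phi> :: "nat \<Rightarrow> nat" and l where p: "strict_mono \<phi>" "\<And>b. b \<in> A \<Longrightarrow> (\<lambda>n. x (\<phi> n) b) \<longlonglongrightarrow> l b"
      by blast
    have "\<forall>n. x (\<phi> n) a \<in> {-B..B}"
    proof
      show "x (\<phi> n) a \<in> {-B..B}" for n using insert.prems[of a "\<phi> n"] by (simp add: abs_le_iff)
    qed
    then obtain m and \<psi> :: "nat \<Rightarrow> nat" where q: "strict_mono \<psi>" "((\<lambda>n. x (\<phi> n) a) \<circ> \<psi>) \<longlonglongrightarrow> m"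
      by (rule seq_compactE[OF compact_imp_seq_compact[OF compact_Icc]])
    have "(\<lambda>n. x (\<phi> (\<psi> n)) b) \<longlonglongrightarrow> (l(a := m)) b" if "b \<in> insert a A" for b
    proof (cases "b = a")
      case True
      then show ?thesis using q(2) by (simp add: o_def)
    next
      case False
      then show ?thesis using LIMSEQ_subseq_LIMSEQ[OF p(2) q(1), of b] that by (simp add: o_def)
    qed
    then show ?case using p(1) q(1)
      by (intro exI[of _ "\<phi> \<circ> \<psi>"] exI[of _ "l(a := m)"]) (auto simp: strict_mono_def)
  qed
  then show ?thesis using that by blast
qed

text \<open>Double counting: a sum over edges weighted by multiplicity becomes a sum over
  time.\<close>

lemma sum_edge_counts:
  fixes g :: "'e \<Rightarrow> real"
  assumes "finite I" "\<And>k. k \<in> N \<Longrightarrow> ed k \<in> I"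
  shows "(\<Sum>e\<in>{e \<in> I. Q e}. (\<Sum>k\<in>N. of_bool (ed k = e)) * g e) = (\<Sum>k\<in>N. if Q (ed k) then g (ed k) else 0)"
proof -
  have "(\<Sum>e\<in>{e \<in> I. Q e}. (\<Sum>k\<in>N. of_bool (ed k = e)) * g e) = (\<Sum>k\<in>N. \<Sum>e\<in>{e \<in> I. Q e}. of_bool (ed k = e) * g e)"
    unfolding sum_distrib_right by (rule sum.swap)
  also have "\<dots> = (\<Sum>k\<in>N. if Q (ed k) then g (ed k) else 0)"
  proof (rule sum.cong[OF refl])
    fix k assume "k \<in> N"
    have "(\<Sum>e\<in>{e \<in> I. Q e}. of_bool (ed k = e) * g e) = (\<Sum>e\<in>{e \<in> I. Q e}. if e = ed k then g e else 0)"
      by (rule sum.cong) auto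
    then show "(\<Sum>e\<in>{e \<in> I. Q e}. of_bool (ed k = e) * g e) = (if Q (ed k) then g (ed k) else 0)"
      using assms(1) assms(2)[OF \<open>k \<in> N\<close>] by simp
  qed
  finally show ?thesis .
qed

text \<open>\<open>x\<close> is a limit of empirical edge frequencies along times that realise the
  limit inferior for player \<open>i\<close>, whence the equality for \<open>i\<close>. For other
  players the passage to a subsequence can only raise the limit inferior, whence the
  inequality.\<close>

lemma circulation_of_trapped_play:
  assumes wf: "wf_game G" and pl: "is_play G \<rho>" and K: "\<And>n. \<rho> n \<in> K"
  obtains x where "circulation G K x" "mean_payoff G i \<rho> = ereal (flow_value G K x i)"
    "\<And>j. mean_payoff G j \<rho> \<le> ereal (flow_value G K x j)"
proof -
  let ?I = "inner_edges G K"
  have fI: "finite ?I" using finite_inner_edges[OF wf] .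
  define ed where "ed k = (\<rho> k, \<rho> (Suc k))" for k
  have edI: "ed k \<in> ?I" for k using pl K by (simp add: ed_def inner_edges_def is_play_def)
  define cnt where "cnt n e = (\<Sum>k<n. of_bool (ed k = e) :: real)" for n e
  have sumcnt: "(\<Sum>e\<in>{e \<in> ?I. Q e}. cnt n e * g e) = (\<Sum>k<n. if Q (ed k) then g (ed k) else 0)" for n Q and g :: "nat \<times> nat \<Rightarrow> real"
    unfolding cnt_def using fI edI by (intro sum_edge_counts) auto
  have sumcnt': "(\<Sum>e\<in>?I. cnt n e * g e) = psum g \<rho> n" for n and g :: "nat \<times> nat \<Rightarrow> real"
    using sumcnt[where Q = "\<lambda>_. True"] by (simp add: psum_def ed_def)
  obtain z \<phi> where \<phi>: "mean_payoff G i \<rho> = ereal z" "strict_mono \<phi>"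
    "(\<lambda>n. psum (rew G i) \<rho> (\<phi> n) / real (\<phi> n)) \<longlonglongrightarrow> z" using mean_payoff_subseq[OF wf pl] .
  have cb: "\<bar>cnt n e / real n\<bar> \<le> 1" for n e
  proof -
    have "0 \<le> cnt n e" "cnt n e \<le> (\<Sum>k<n. 1)" unfolding cnt_def by (intro sum_nonneg, simp) (intro sum_mono, simp)
    then show ?thesis by (cases "n = 0") (auto simp: divide_le_eq_1)
  qed
  obtain \<psi> :: "nat \<Rightarrow> nat" and x where \<psi>: "strict_mono \<psi>" "\<And>e. e \<in> ?I \<Longrightarrow> (\<lambda>n. cnt (\<phi> (\<psi> n)) e / real (\<phi> (\<psi> n))) \<longlonglongrightarrow> x e"
    using finite_common_subseq[OF fI, of "\<lambda>n e. cnt (\<phi> n) e / real (\<phi> n)" 1] cb by blast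
  define \<theta> where "\<theta> = \<phi> \<circ> \<psi>"
  have th: "strict_mono \<theta>" unfolding \<theta>_def using \<phi>(2) \<psi>(1) by (rule strict_mono_o)
  have x: "(\<lambda>n. cnt (\<theta> n) e / real (\<theta> n)) \<longlonglongrightarrow> x e" if "e \<in> ?I" for e using \<psi>(2)[OF that] by (simp add: \<theta>_def)
  have thpos: "\<forall>\<^sub>F n in sequentially. \<theta> n \<ge> 1"
    using seq_suble[OF th] by (intro eventually_sequentiallyI[of 1]) (meson order_trans)
  have thinf: "filterlim \<theta> sequentially sequentially" using th filterlim_subseq by blast
  have lim: "(\<lambda>n. (\<Sum>e\<in>{e \<in> ?I. Q e}. cnt (\<theta> n) e * g e) / real (\<theta> n)) \<longlonglongrightarrow> (\<Sum>e\<in>{e \<in> ?I. Q e}. x e * g e)" for Q and g :: "nat \<times> nat \<Rightarrow> real"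
  proof -
    have "(\<lambda>n. \<Sum>e\<in>{e \<in> ?I. Q e}. cnt (\<theta> n) e / real (\<theta> n) * g e) \<longlonglongrightarrow> (\<Sum>e\<in>{e \<in> ?I. Q e}. x e * g e)"
      using x by (intro tendsto_sum tendsto_mult tendsto_const) auto
    then show ?thesis by (simp add: sum_divide_distrib)
  qed
  have limp: "(\<lambda>n. psum g \<rho> (\<theta> n) / real (\<theta> n)) \<longlonglongrightarrow> (\<Sum>e\<in>?I. x e * g e)" for g :: "nat \<times> nat \<Rightarrow> real"
    using lim[where Q = "\<lambda>_. True" and g = g] by (simp add: sumcnt')
  have nonneg: "0 \<le> x e" if "e \<in> ?I" for e
    by (rule LIMSEQ_le_const[OF x[OF that]]) (auto simp: cnt_def sum_nonneg)
  have one: "(\<Sum>e\<in>?I. x e) = 1"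
  proof -
    have "(\<lambda>n. psum (\<lambda>_. 1) \<rho> (\<theta> n) / real (\<theta> n)) \<longlonglongrightarrow> 1"
      by (rule tendsto_eventually, rule eventually_mono[OF thpos]) (simp add: psum_def)
    then show ?thesis using LIMSEQ_unique[OF limp[of "\<lambda>_. 1"]] by simp
  qed
  have conserv: "(\<Sum>e\<in>{e \<in> ?I. fst e = u}. x e) = (\<Sum>e\<in>{e \<in> ?I. snd e = u}. x e)" for u
  proof -
    let ?f = "\<lambda>n. \<Sum>e\<in>{e \<in> ?I. fst e = u}. cnt n e * 1"
    let ?s = "\<lambda>n. \<Sum>e\<in>{e \<in> ?I. snd e = u}. cnt n e * 1"
    \<comment> \<open>Departures from \<open>u\<close> and arrivals at \<open>u\<close> alternate,
      so the two counts differ by at most one.\<close>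
    have d: "?f n - ?s n = of_bool (\<rho> 0 = u) - of_bool (\<rho> n = u)" for n
      unfolding sumcnt by (induction n) (auto simp: ed_def)
    have "(\<lambda>n. ?f (\<theta> n) / real (\<theta> n) - ?s (\<theta> n) / real (\<theta> n)) \<longlonglongrightarrow>
        (\<Sum>e\<in>{e \<in> ?I. fst e = u}. x e * 1) - (\<Sum>e\<in>{e \<in> ?I. snd e = u}. x e * 1)"
      by (intro tendsto_diff lim)
    moreover have "(\<lambda>n. ?f (\<theta> n) / real (\<theta> n) - ?s (\<theta> n) / real (\<theta> n)) \<longlonglongrightarrow> 0"
    proof (rule Lim_null_comparison)
      show "(\<lambda>n. 1 / real (\<theta> n)) \<longlonglongrightarrow> 0"
        using filterlim_compose[OF lim_const_over_n[of "1::real"] thinf] .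
      have "norm (?f (\<theta> n) / real (\<theta> n) - ?s (\<theta> n) / real (\<theta> n)) \<le> 1 / real (\<theta> n)" for n
        unfolding diff_divide_distrib[symmetric] d by (simp add: divide_right_mono)
      then show "\<forall>\<^sub>F n in sequentially. norm (?f (\<theta> n) / real (\<theta> n) - ?s (\<theta> n) / real (\<theta> n)) \<le> 1 / real (\<theta> n)"
        by simp
    qed
    ultimately show ?thesis using LIMSEQ_unique by fastforce
  qed
  have "z = flow_value G K x i"
  proof -
    have "(\<lambda>n. psum (rew G i) \<rho> (\<theta> n) / real (\<theta> n)) \<longlonglongrightarrow> z"
      using LIMSEQ_subseq_LIMSEQ[OF \<phi>(3) \<psi>(1)] by (simp add: o_def \<theta>_def)
    then show ?thesis using LIMSEQ_unique[OF limp] unfolding flow_value_def by blast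
  qed
  moreover have "mean_payoff G j \<rho> \<le> ereal (flow_value G K x j)" for j
  proof -
    have "liminf (\<lambda>n. ereal (psum (rew G j) \<rho> n / real n)) \<le> liminf ((\<lambda>n. ereal (psum (rew G j) \<rho> n / real n)) \<circ> \<theta>)"
      using th by (rule liminf_subseq_mono)
    also have "\<dots> = ereal (flow_value G K x j)"
      using limp[of "rew G j"] by (intro lim_imp_Liminf) (auto simp: o_def flow_value_def)
    finally show ?thesis by (simp add: mean_payoff_psum)
  qed
  ultimately show ?thesis using that[of x] nonneg one conserv \<phi>(1) by (simp add: circulation_def)
qed

lemma play_segment_rtrancl:
  assumes "\<And>n. n \<ge> m \<Longrightarrow> (\<rho> n, \<rho> (Suc n)) \<in> r"
  shows "(\<rho> m, \<rho> (m + k)) \<in> r\<^sup>*"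
proof (induction k)
  case (Suc k)
  then show ?case using assms[of "m + k"] by (simp add: rtrancl.rtrancl_into_rtrancl)
qed simp

text \<open>\<open>K\<close> consists of the vertices visited infinitely often: from some time on
  the play is trapped in \<open>K\<close>, and it still leads from any vertex of \<open>K\<close> to
  any other.\<close>

lemma circulation_of_play:
  assumes wf: "wf_game G" and pl: "is_play G \<rho>"
  obtains K x where "K \<subseteq> range \<rho>" "strongly_connected G K"
    "\<And>m. \<exists>b\<in>K. (\<rho> m, b) \<in> (inner_edges G (range \<rho>))\<^sup>*"
    "circulation G K x" "mean_payoff G i \<rho> = ereal (flow_value G K x i)"
    "\<And>j. mean_payoff G j \<rho> \<le> ereal (flow_value G K x j)"
proof -
  define K where "K = {u. infinite {n. \<rho> n = u}}"
  have KR: "K \<subseteq> range \<rho>" using not_finite_existsD by (fastforce simp: K_def)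
  have "finite (range \<rho>)" using wf is_play_verts[OF wf pl] by (auto simp: wf_game_def intro: finite_subset)
  then have "finite (\<Union>u\<in>range \<rho> - K. {n. \<rho> n = u})" by (auto simp: K_def)
  then obtain N where N: "\<And>n. n \<in> (\<Union>u\<in>range \<rho> - K. {n. \<rho> n = u}) \<Longrightarrow> n < N"
    using finite_nat_bounded by (metis lessThan_iff subsetD)
  have NK: "\<rho> n \<in> K" if "n \<ge> N" for n using N[of n] that by auto
  have ex: "\<exists>n\<ge>m. \<rho> n = b" if "b \<in> K" for b m
    using that infinite_nat_iff_unbounded_le[of "{n. \<rho> n = b}"] by (auto simp: K_def)
  have "(a, b) \<in> (inner_edges G K)\<^sup>*" if a: "a \<in> K" and b: "b \<in> K" for a b
  proof -
    obtain m where m: "m \<ge> N" "\<rho> m = a" using ex[OF a] by blast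
    obtain n where n: "n \<ge> m" "\<rho> n = b" using ex[OF b] by blast
    have "(\<rho> m, \<rho> (m + (n - m))) \<in> (inner_edges G K)\<^sup>*"
      using m(1) NK pl by (intro play_segment_rtrancl) (auto simp: inner_edges_def is_play_def)
    then show ?thesis using m n by simp
  qed
  then have sc: "strongly_connected G K" using NK[of N] by (auto simp: strongly_connected_def)
  have reach: "\<exists>b\<in>K. (\<rho> m, b) \<in> (inner_edges G (range \<rho>))\<^sup>*" for m
  proof
    show "\<rho> (m + N) \<in> K" by (rule NK) simp
    show "(\<rho> m, \<rho> (m + N)) \<in> (inner_edges G (range \<rho>))\<^sup>*"
      using pl by (intro play_segment_rtrancl) (auto simp: inner_edges_def is_play_def)
  qed
  obtain x where "circulation G K x" "mean_payoff G i (suffix_play \<rho> N) = ereal (flow_value G K x i)"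
    "\<And>j. mean_payoff G j (suffix_play \<rho> N) \<le> ereal (flow_value G K x j)"
    using circulation_of_trapped_play[OF wf is_play_suffix[OF pl], of N K i] NK by (auto simp: suffix_play_def)
  then show ?thesis using that[OF KR sc reach] by (simp add: mean_payoff_suffix_play[OF wf pl])
qed

section \<open>Walks\<close>

text \<open>The list holds all vertices but the endpoint, so that composing walks is appending
  lists; weights are taken after the endpoint has been appended.\<close>

inductive walk :: "(nat \<times> nat) set \<Rightarrow> nat \<Rightarrow> nat list \<Rightarrow> nat \<Rightarrow> bool" for r where
  walk_Nil: "walk r a [] a"
| walk_Cons: "(a, b) \<in> r \<Longrightarrow> walk r b L c \<Longrightarrow> walk r a (a # L) c"

lemma walk_append: "walk r a L b \<Longrightarrow> walk r b L' c \<Longrightarrow> walk r a (L @ L') c"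
  by (induction rule: walk.induct) (auto intro: walk.intros)

lemma walk_of_rtrancl: "(a, b) \<in> r\<^sup>* \<Longrightarrow> \<exists>L. walk r a L b"
  by (induction rule: converse_rtrancl_induct) (blast intro: walk.intros)+

lemma walk_hd: "walk r a L c \<Longrightarrow> \<exists>ys. L @ [c] = a # ys"
  by (auto elim: walk.cases)

lemma walk_replicate: "walk r b L b \<Longrightarrow> walk r b (concat (replicate n L)) b"
  by (induction n) (auto intro: walk.intros walk_append)

lemma walk_nth: "walk r a L c \<Longrightarrow> n < length L \<Longrightarrow> ((L @ [c]) ! n, (L @ [c]) ! Suc n) \<in> r"
proof (induction arbitrary: n rule: walk.induct)
  case (walk_Cons a b L c)
  then show ?case using walk_hd[OF walk_Cons(2)] by (cases n) auto
qed simp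

lemma walk_play:
  assumes "\<And>n. i \<le> n \<Longrightarrow> n < j \<Longrightarrow> (\<rho> n, \<rho> (Suc n)) \<in> r" "i \<le> j"
  shows "walk r (\<rho> i) (map \<rho> [i..<j]) (\<rho> j)"
  using assms
proof (induction "j - i" arbitrary: i)
  case 0
  then show ?case by (simp add: walk_Nil)
next
  case (Suc k)
  then have "i < j" by simp
  then have "map \<rho> [i..<j] = \<rho> i # map \<rho> [Suc i..<j]" by (simp add: upt_conv_Cons)
  moreover have "walk r (\<rho> (Suc i)) (map \<rho> [Suc i..<j]) (\<rho> j)" using Suc \<open>i < j\<close> by (intro Suc.hyps(1)) auto
  moreover have "(\<rho> i, \<rho> (Suc i)) \<in> r" using Suc \<open>i < j\<close> by auto
  ultimately show ?case by (simp add: walk_Cons)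
qed

lemma wsum_walk_append:
  assumes "walk r b L' c"
  shows "wsum g ((L @ L') @ [c]) = wsum g (L @ [b]) + wsum g (L' @ [c])"
proof -
  obtain ys where "L' @ [c] = b # ys" using walk_hd[OF assms] by blast
  then show ?thesis using wsum_append[of g L b ys] by simp
qed

lemma wsum_replicate:
  assumes "walk r b L b"
  shows "wsum g (concat (replicate n L) @ [b]) = real n * wsum g (L @ [b])"
proof (induction n)
  case (Suc n)
  have "wsum g ((L @ concat (replicate n L)) @ [b]) = wsum g (L @ [b]) + wsum g (concat (replicate n L) @ [b])"
    using walk_replicate[OF assms] by (rule wsum_walk_append)
  then show ?case using Suc by (simp add: algebra_simps)
qed simp

lemma wsum_const: "wsum (\<lambda>_. c) (L @ [b]) = real (length L) * c"
proof (induction L arbitrary: b rule: rev_induct)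
  case (snoc x L)
  have "wsum (\<lambda>_. c) ((L @ [x]) @ [b]) = wsum (\<lambda>_. c) (L @ [x]) + c" by (subst wsum_snoc) auto
  then show ?case using snoc[of x] by (simp add: algebra_simps)
qed simp

lemma wsum_diff: "wsum (\<lambda>e. g e - h e) L = wsum g L - wsum h L"
  by (induction g L rule: wsum.induct) auto

lemma wsum_segment: "i \<le> j \<Longrightarrow> wsum g (map \<rho> [i..<j] @ [\<rho> j]) = (\<Sum>n=i..<j. g (\<rho> n, \<rho> (Suc n)))"
proof (induction j)
  case (Suc j)
  show ?case
  proof (cases "i = Suc j")
    case False
    then have "i \<le> j" using Suc by simp
    then have "wsum g ((map \<rho> [i..<j] @ [\<rho> j]) @ [\<rho> (Suc j)]) = (\<Sum>n=i..<j. g (\<rho> n, \<rho> (Suc n))) + g (\<rho> j, \<rho> (Suc j))"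
      using Suc by (subst wsum_snoc) auto
    then show ?thesis using \<open>i \<le> j\<close> by simp
  qed simp
qed simp

section \<open>Plays with prescribed edge frequencies\<close>

text \<open>By conservation, edges of positive flow can be followed forever, so they contain a
  closed walk; subtracting the largest admissible multiple of it empties an edge and shrinks the
  support. Stating the decomposition for all weights \<open>g\<close> covers the rewards of all
  players and, with \<open>g = 1\<close>, the lengths.\<close>

lemma circulation_decomposition:
  fixes x :: "nat \<times> nat \<Rightarrow> real"
  assumes "finite I" "\<And>e. e \<in> I \<Longrightarrow> 0 \<le> x e"
    "\<And>u. (\<Sum>e\<in>{e \<in> I. fst e = u}. x e) = (\<Sum>e\<in>{e \<in> I. snd e = u}. x e)"
  shows "\<exists>cs. (\<forall>(\<alpha>, b, L)\<in>set cs. 0 \<le> \<alpha> \<and> L \<noteq> [] \<and> walk I b L b) \<and>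
    (\<forall>g. (\<Sum>e\<in>I. x e * g e) = (\<Sum>(\<alpha>, b, L)\<leftarrow>cs. \<alpha> * wsum g (L @ [b])))"
  using assms(2,3)
proof (induction "card {e \<in> I. x e \<noteq> 0}" arbitrary: x rule: less_induct)
  case less
  show ?case
  proof (cases "{e \<in> I. x e \<noteq> 0} = {}")
    case True
    then have "(\<Sum>e\<in>I. x e * g e) = 0" for g :: "nat \<times> nat \<Rightarrow> real" by (intro sum.neutral) auto
    then show ?thesis by (intro exI[of _ "[]"]) simp
  next
    case False
    then obtain e0 where e0: "e0 \<in> I" "x e0 > 0" using less.prems(1) by (metis (mono_tags, lifting) Collect_empty_eq order_le_less)
    have nxt: "\<exists>e'. (e' \<in> I \<and> x e' > 0) \<and> fst e' = snd e" if e: "e \<in> I \<and> x e > 0" for e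
    proof (rule ccontr)
      assume "\<not> ?thesis"
      then have "(\<Sum>e'\<in>{e' \<in> I. fst e' = snd e}. x e') \<le> 0" by (intro sum_nonpos) (auto simp: not_less)
      moreover have "x e \<le> (\<Sum>e'\<in>{e' \<in> I. snd e' = snd e}. x e')"
        using e assms(1) less.prems(1) by (intro member_le_sum) auto
      ultimately show False using e less.prems(2)[of "snd e"] by linarith
    qed
    obtain es where es: "\<And>n. es n \<in> I \<and> x (es n) > 0" "\<And>n. fst (es (Suc n)) = snd (es n)"
      using dependent_nat_choice[of "\<lambda>_ e. e \<in> I \<and> x e > 0" "\<lambda>_ e e'. fst e' = snd e"] e0 nxt by blast
    define \<rho> where "\<rho> n = fst (es n)" for n
    have ed: "es n = (\<rho> n, \<rho> (Suc n))" for n using es(2)[of n] by (simp add: \<rho>_def prod_eq_iff)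
    have "finite (range \<rho>)" using assms(1) es(1) by (intro finite_subset[of "range \<rho>" "fst ` I"]) (auto simp: \<rho>_def)
    then have "\<not> inj \<rho>" using finite_imageD by blast
    then obtain i j where ij: "i < j" "\<rho> i = \<rho> j" unfolding inj_def by (metis linorder_neqE_nat)
    \<comment> \<open>Multiplicities are needed, as the closed segment may use an edge more than
      once.\<close>
    define ct :: "nat \<times> nat \<Rightarrow> real" where "ct e = (\<Sum>n\<in>{i..<j}. of_bool (es n = e))" for e
    have sc: "(\<Sum>e\<in>{e \<in> I. Q e}. ct e * g e) = (\<Sum>n\<in>{i..<j}. if Q (es n) then g (es n) else 0)" for Q and g :: "nat \<times> nat \<Rightarrow> real"
      unfolding ct_def using assms(1) es(1) by (intro sum_edge_counts) auto
    define A where "A = es ` {i..<j}"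
    have A: "finite A" "A \<noteq> {}" using ij by (auto simp: A_def)
    have chiA: "ct e \<ge> 1" if eA: "e \<in> A" for e
    proof -
      obtain n where n: "n \<in> {i..<j}" "e = es n" using eA by (auto simp: A_def)
      have "(of_bool (es n = e) :: real) \<le> ct e" unfolding ct_def using n(1) by (intro member_le_sum) auto
      then show ?thesis using n by simp
    qed
    have chi0: "ct e = 0" if "e \<notin> A" for e
      unfolding ct_def using that by (intro sum.neutral) (auto simp: A_def)
    \<comment> \<open>The largest multiple that keeps the flow nonnegative; the edge attaining the
      minimum leaves the support.\<close>
    define \<alpha> where "\<alpha> = Min ((\<lambda>e. x e / ct e) ` A)"
    have "\<alpha> \<in> (\<lambda>e. x e / ct e) ` A" unfolding \<alpha>_def using A by (intro Min_in) auto
    then obtain e1 where e1: "e1 \<in> A" "\<alpha> = x e1 / ct e1" by blast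
    have al: "\<alpha> * ct e \<le> x e" if "e \<in> A" for e
    proof -
      have "\<alpha> \<le> x e / ct e" unfolding \<alpha>_def using A that by (intro Min_le) auto
      then show ?thesis using chiA[OF that] by (simp add: field_simps)
    qed
    have AI: "e \<in> I \<and> x e > 0" if "e \<in> A" for e using that es(1) by (auto simp: A_def)
    have al0: "\<alpha> \<ge> 0" using e1 AI[OF e1(1)] chiA[OF e1(1)] by simp
    define x' where "x' e = x e - \<alpha> * ct e" for e
    have x'0: "0 \<le> x' e" if "e \<in> I" for e
      using al[of e] chi0[of e] less.prems(1)[OF that] by (cases "e \<in> A") (auto simp: x'_def)
    have sx': "(\<Sum>e\<in>{e \<in> I. Q e}. x' e * g e) = (\<Sum>e\<in>{e \<in> I. Q e}. x e * g e) - \<alpha> * (\<Sum>n\<in>{i..<j}. if Q (es n) then g (es n) else 0)" for Q and g :: "nat \<times> nat \<Rightarrow> real"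
      unfolding x'_def sc[symmetric] by (simp add: sum_subtractf sum_distrib_left algebra_simps)
    have cons': "(\<Sum>e\<in>{e \<in> I. fst e = u}. x' e) = (\<Sum>e\<in>{e \<in> I. snd e = u}. x' e)" for u
    proof -
      let ?f = "\<lambda>n. of_bool (\<rho> n = u) :: real"
      have "(\<Sum>n\<in>{i..<j}. ?f (Suc n) - ?f n) = ?f j - ?f i" using ij by (intro sum_Suc_diff') auto
      then have "(\<Sum>n\<in>{i..<j}. ?f (Suc n)) = (\<Sum>n\<in>{i..<j}. ?f n)" using ij by (simp add: sum_subtractf)
      then show ?thesis using sx'[where g = "\<lambda>_. 1" and Q = "\<lambda>e. fst e = u"]
          sx'[where g = "\<lambda>_. 1" and Q = "\<lambda>e. snd e = u"] less.prems(2)[of u]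
        by (simp add: ed of_bool_def)
    qed
    have "{e \<in> I. x' e \<noteq> 0} \<subset> {e \<in> I. x e \<noteq> 0}"
    proof
      show "{e \<in> I. x' e \<noteq> 0} \<subseteq> {e \<in> I. x e \<noteq> 0}"
        using AI chi0 by (force simp: x'_def)
      have "x' e1 = 0" using e1 chiA[OF e1(1)] by (simp add: x'_def)
      then show "{e \<in> I. x' e \<noteq> 0} \<noteq> {e \<in> I. x e \<noteq> 0}" using AI[OF e1(1)] by force
    qed
    then have "card {e \<in> I. x' e \<noteq> 0} < card {e \<in> I. x e \<noteq> 0}" using assms(1) by (intro psubset_card_mono) auto
    from less.hyps[OF this x'0 cons'] obtain cs where cs: "\<forall>(\<alpha>, b, L)\<in>set cs. 0 \<le> \<alpha> \<and> L \<noteq> [] \<and> walk I b L b"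
      "\<And>g. (\<Sum>e\<in>I. x' e * g e) = (\<Sum>(\<alpha>, b, L)\<leftarrow>cs. \<alpha> * wsum g (L @ [b]))" by blast
    let ?c = "(\<alpha>, \<rho> i, map \<rho> [i..<j])"
    have "walk I (\<rho> i) (map \<rho> [i..<j]) (\<rho> j)" using ij es(1) ed by (intro walk_play) (metis, simp)
    then have w: "walk I (\<rho> i) (map \<rho> [i..<j]) (\<rho> i)" by (simp add: ij)
    have "(\<Sum>e\<in>I. x e * g e) = (\<Sum>(\<alpha>, b, L)\<leftarrow>?c # cs. \<alpha> * wsum g (L @ [b]))" for g
    proof -
      have "wsum g (map \<rho> [i..<j] @ [\<rho> i]) = (\<Sum>n\<in>{i..<j}. g (es n))"
        using wsum_segment[of i j g \<rho>] ij by (simp add: ed)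
      then show ?thesis using sx'[where g = g and Q = "\<lambda>_. True"] cs(2)[of g] by simp
    qed
    then show ?thesis using cs(1) w al0 ij by (intro exI[of _ "?c # cs"]) auto
  qed
qed

lemma sum_list_triangle_bound:
  fixes f g :: "'a \<Rightarrow> real"
  assumes "\<And>c. c \<in> set cs \<Longrightarrow> \<bar>f c\<bar> \<le> g c"
  shows "\<bar>\<Sum>c\<leftarrow>cs. f c\<bar> \<le> (\<Sum>c\<leftarrow>cs. g c)"
  using assms by (induction cs) (auto intro: order_trans[OF abs_triangle_ineq] add_mono)

text \<open>Phases of linearly growing length make time quadratic in the number of phases, while the
  accumulated error is linear in it; hence the square root.\<close>

lemma sqrt_growth_over_n: "(\<lambda>n. A * (2 + sqrt (2 * real n)) / real n) \<longlonglongrightarrow> 0"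
proof -
  have "(\<lambda>n. inverse (sqrt (real n))) \<longlonglongrightarrow> 0"
    using tendsto_inverse_0_at_top[OF filterlim_compose[OF sqrt_at_top filterlim_real_sequentially]] .
  then have "(\<lambda>n. 2 * A / real n + A * sqrt 2 * inverse (sqrt (real n))) \<longlonglongrightarrow> 0 + A * sqrt 2 * 0"
    by (intro tendsto_intros lim_const_over_n)
  moreover have "A * (2 + sqrt (2 * real n)) / real n = 2 * A / real n + A * sqrt 2 * inverse (sqrt (real n))" for n
    by (cases "n = 0") (auto simp: real_sqrt_mult field_simps)
  ultimately show ?thesis by simp
qed

text \<open>Phase \<open>m\<close> repeats each cycle of the decomposition about \<open>m\<close> times its weight; as the error per phase
  is bounded while its length grows linearly, the averages converge.\<close>

lemma play_of_circulation:
  assumes wf: "wf_game G" and sc: "strongly_connected G K" and circ: "circulation G K x" and b0: "b0 \<in> K"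
  obtains \<rho> where "is_play G \<rho>" "\<rho> 0 = b0" "range \<rho> \<subseteq> K"
    "\<And>j. (\<lambda>n. psum (rew G j) \<rho> n / real n) \<longlonglongrightarrow> flow_value G K x j"
proof -
  let ?I = "inner_edges G K"
  have fI: "finite ?I" using finite_inner_edges[OF wf] .
  have "(\<Sum>e\<in>{e \<in> ?I. fst e = u}. x e) = (\<Sum>e\<in>{e \<in> ?I. snd e = u}. x e)" for u
  proof (cases "u \<in> K")
    case False
    then have "{e \<in> ?I. fst e = u} = {}" "{e \<in> ?I. snd e = u} = {}" by (auto simp: inner_edges_def)
    then show ?thesis by (simp only:)
  qed (use circ in \<open>simp add: circulation_def\<close>)
  then obtain cs where cs: "\<And>\<alpha> b L. (\<alpha>, b, L) \<in> set cs \<Longrightarrow> 0 \<le> \<alpha> \<and> L \<noteq> [] \<and> walk ?I b L b"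
    "\<And>g. (\<Sum>e\<in>?I. x e * g e) = (\<Sum>(\<alpha>, b, L)\<leftarrow>cs. \<alpha> * wsum g (L @ [b]))"
    using circulation_decomposition[OF fI, of x] circ unfolding circulation_def by blast
  have csK: "b \<in> K" if "(\<alpha>, b, L) \<in> set cs" for \<alpha> b L
    using cs(1)[OF that] by (auto elim!: walk.cases simp: inner_edges_def)
  have "\<forall>b\<in>K. \<exists>L. walk ?I b0 L b" "\<forall>b\<in>K. \<exists>L. walk ?I b L b0"
    using sc b0 walk_of_rtrancl unfolding strongly_connected_def by blast+
  then obtain to fro where to: "\<And>b. b \<in> K \<Longrightarrow> walk ?I b0 (to b) b" and fro: "\<And>b. b \<in> K \<Longrightarrow> walk ?I b (fro b) b0"
    by metis
  \<comment> \<open>Adding 1 after rounding down makes phase \<open>m\<close> at least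
    \<open>m\<close> long and keeps even phase 0 nonempty.\<close>
  define reps where "reps m \<alpha> = nat \<lfloor>\<alpha> * real m\<rfloor> + 1" for m :: nat and \<alpha> :: real
  define piece where "piece m = (\<lambda>(\<alpha>, b, L). to b @ concat (replicate (reps m \<alpha>) L) @ fro b)" for m
  define blk where "blk m = concat (map (piece m) cs)" for m
  have piece: "walk ?I b0 (piece m c) b0" if "c \<in> set cs" for m c
  proof -
    obtain \<alpha> b L where c: "c = (\<alpha>, b, L)" by (cases c)
    have "(\<alpha>, b, L) \<in> set cs" using that c by simp
    then have "walk ?I b L b" "walk ?I b0 (to b) b" "walk ?I b (fro b) b0" using cs(1) csK to fro by blast+
    then show ?thesis unfolding c piece_def prod.case using walk_append walk_replicate by meson
  qed
  have piece_ws: "wsum g (piece m (\<alpha>, b, L) @ [b0]) = wsum g (to b @ [b]) + real (reps m \<alpha>) * wsum g (L @ [b]) + wsum g (fro b @ [b0])"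
    if "(\<alpha>, b, L) \<in> set cs" for m \<alpha> b L g
  proof -
    have w: "walk ?I b (concat (replicate (reps m \<alpha>) L)) b" "walk ?I b L b" "walk ?I b (fro b) b0"
      using walk_replicate cs(1)[OF that] fro[OF csK[OF that]] by auto
    show ?thesis
      unfolding piece_def prod.case wsum_walk_append[OF walk_append[OF w(1,3)]] wsum_walk_append[OF w(3)] wsum_replicate[OF w(2)]
      by simp
  qed
  have blk_aux: "walk ?I b0 (concat (map (piece m) cs')) b0 \<and>
    wsum g (concat (map (piece m) cs') @ [b0]) = (\<Sum>c\<leftarrow>cs'. wsum g (piece m c @ [b0]))" if "set cs' \<subseteq> set cs" for cs' m g
    using that
  proof (induction cs')
    case (Cons c cs')
    then have IH: "walk ?I b0 (concat (map (piece m) cs')) b0"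
      "wsum g (concat (map (piece m) cs') @ [b0]) = (\<Sum>c\<leftarrow>cs'. wsum g (piece m c @ [b0]))" by auto
    then show ?case using walk_append[OF piece[of c m] IH(1)] wsum_walk_append[OF IH(1), of g "piece m c"] Cons.prems by simp
  qed (simp add: walk_Nil)
  have blk: "walk ?I b0 (blk m) b0" "wsum g (blk m @ [b0]) = (\<Sum>c\<leftarrow>cs. wsum g (piece m c @ [b0]))" for m g
    using blk_aux[of cs] by (auto simp: blk_def)
  have reps: "\<alpha> * real m \<le> real (reps m \<alpha>)" "\<bar>real (reps m \<alpha>) - real m * \<alpha>\<bar> \<le> 1" if "0 \<le> \<alpha>" for m \<alpha>
  proof -
    have "0 \<le> \<alpha> * real m" using that by simp
    then have "real (reps m \<alpha>) = of_int \<lfloor>\<alpha> * real m\<rfloor> + 1" by (simp add: reps_def)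
    then show "\<alpha> * real m \<le> real (reps m \<alpha>)" "\<bar>real (reps m \<alpha>) - real m * \<alpha>\<bar> \<le> 1"
      by (simp_all add: mult.commute abs_le_iff)
  qed
  have blk_err: "\<exists>\<kappa>. \<forall>m. \<bar>wsum g (blk m @ [b0]) - real m * (\<Sum>e\<in>?I. x e * g e)\<bar> \<le> \<kappa>" for g
  proof (intro exI allI)
    fix m
    let ?k = "\<lambda>(\<alpha>::real, b, L). \<bar>wsum g (to b @ [b])\<bar> + \<bar>wsum g (L @ [b])\<bar> + \<bar>wsum g (fro b @ [b0])\<bar>"
    have "wsum g (blk m @ [b0]) - real m * (\<Sum>e\<in>?I. x e * g e) =
      (\<Sum>c\<leftarrow>cs. wsum g (piece m c @ [b0]) - real m * (case c of (\<alpha>, b, L) \<Rightarrow> \<alpha> * wsum g (L @ [b])))"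
      unfolding blk(2) cs(2) by (simp add: sum_list_subtractf sum_list_const_mult)
    also have "\<bar>\<dots>\<bar> \<le> (\<Sum>c\<leftarrow>cs. ?k c)"
    proof (rule sum_list_triangle_bound)
      fix c assume c: "c \<in> set cs"
      obtain \<alpha> b L where c': "c = (\<alpha>, b, L)" by (cases c)
      have "\<bar>(real (reps m \<alpha>) - real m * \<alpha>) * wsum g (L @ [b])\<bar> \<le> 1 * \<bar>wsum g (L @ [b])\<bar>"
        unfolding abs_mult using reps(2)[of \<alpha> m] cs(1) c c' by (intro mult_right_mono) auto
      then show "\<bar>wsum g (piece m c @ [b0]) - real m * (case c of (\<alpha>, b, L) \<Rightarrow> \<alpha> * wsum g (L @ [b]))\<bar> \<le> ?k c"
        using c piece_ws[of \<alpha> b L g m] by (simp add: c' algebra_simps)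
    qed
    finally show "\<bar>wsum g (blk m @ [b0]) - real m * (\<Sum>e\<in>?I. x e * g e)\<bar> \<le> (\<Sum>c\<leftarrow>cs. ?k c)" .
  qed
  have x1: "(\<Sum>e\<in>?I. x e * 1) = 1" using circ by (simp add: circulation_def)
  have len_ge: "length (blk m) \<ge> m" for m
  proof -
    have "real m = real m * (\<Sum>e\<in>?I. x e * 1)" using x1 by simp
    also have "\<dots> = (\<Sum>c\<leftarrow>cs. real m * (case c of (\<alpha>, b, L) \<Rightarrow> \<alpha> * wsum (\<lambda>_. 1) (L @ [b])))"
      unfolding cs(2) by (simp add: sum_list_const_mult)
    also have "\<dots> \<le> (\<Sum>c\<leftarrow>cs. wsum (\<lambda>_. 1) (piece m c @ [b0]))"
    proof (rule sum_list_mono)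
      fix c assume c: "c \<in> set cs"
      obtain \<alpha> b L where c': "c = (\<alpha>, b, L)" by (cases c)
      have "\<alpha> * real m * real (length L) \<le> real (reps m \<alpha>) * real (length L)"
        using reps(1)[of \<alpha> m] cs(1) c c' by (intro mult_right_mono) auto
      then show "real m * (case c of (\<alpha>, b, L) \<Rightarrow> \<alpha> * wsum (\<lambda>_. 1) (L @ [b])) \<le> wsum (\<lambda>_. 1) (piece m c @ [b0])"
        using c piece_ws[of \<alpha> b L "\<lambda>_. 1" m] by (simp add: c' wsum_const algebra_simps)
    qed
    also have "\<dots> = real (length (blk m))" using blk(2)[of "\<lambda>_. 1" m] by (simp add: wsum_const)
    finally show ?thesis by simp
  qed
  have blk_ne: "blk m \<noteq> []" for m
  proof -
    have "cs \<noteq> []" using cs(2)[of "\<lambda>_. 1"] x1 by auto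
    then obtain \<alpha> b L where c: "(\<alpha>, b, L) \<in> set cs" by (metis list.set_intros(1) neq_Nil_conv prod_cases3)
    then have "piece m (\<alpha>, b, L) \<noteq> []" using cs(1)[OF c] by (simp add: piece_def reps_def)
    then show ?thesis using c by (auto simp: blk_def)
  qed
  define pre where "pre m = concat (map blk [0..<m])" for m
  have preS: "pre (Suc m) = pre m @ blk m" for m by (simp add: pre_def)
  have walk_pre: "walk ?I b0 (pre m) b0" for m
    by (induction m) (auto simp: preS intro: walk_append blk walk_Nil, simp add: pre_def walk_Nil)
  obtain \<rho> where \<rho>': "\<And>k. pre (Suc k) = map \<rho> [0..<length (pre (Suc k))]" "\<And>k. length (pre (Suc k)) > k"
    using play_of_increasing_histories[of "\<lambda>k. pre (Suc k)"] preS blk_ne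
    by (metis (no_types, lifting) append_is_Nil_conv)
  have \<rho>: "pre m @ [b0] = map \<rho> [0..<Suc (length (pre m))]" for m
  proof -
    obtain ys where ys: "blk m = b0 # ys" using walk_hd[OF blk(1)[of m]] blk_ne[of m] by (cases "blk m") auto
    have "pre m @ [b0] = take (Suc (length (pre m))) (pre (Suc m))" by (simp add: preS ys)
    also have "\<dots> = take (Suc (length (pre m))) (map \<rho> [0..<length (pre (Suc m))])" using \<rho>'(1)[of m] by simp
    also have "\<dots> = map \<rho> [0..<Suc (length (pre m))]"
      by (simp add: take_map take_upt preS ys del: upt_Suc)
    finally show ?thesis .
  qed
  have inI: "(\<rho> n, \<rho> (Suc n)) \<in> ?I" for n
  proof -
    have "n < length (pre (Suc n))" using \<rho>'(2) .
    then show ?thesis using walk_nth[OF walk_pre[of "Suc n"], of n] unfolding \<rho> by (simp del: upt_Suc)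
  qed
  have pl: "is_play G \<rho>" using inI by (simp add: is_play_def inner_edges_def)
  have r0: "\<rho> 0 = b0" using \<rho>[of 0] by (simp add: pre_def)
  have rK: "range \<rho> \<subseteq> K" using inI by (auto simp: inner_edges_def)
  have "(\<lambda>n. psum (rew G j) \<rho> n / real n) \<longlonglongrightarrow> flow_value G K x j" for j
  proof -
    define z where "z = flow_value G K x j"
    \<comment> \<open>Once the target value is subtracted, the weight of a phase is bounded
      independently of its length.\<close>
    define g where "g = (\<lambda>e. rew G j e - z)"
    have g0: "(\<Sum>e\<in>?I. x e * g e) = 0"
      using x1 by (simp add: g_def z_def flow_value_def right_diff_distrib sum_subtractf flip: sum_distrib_right)
    obtain \<kappa> where k: "\<And>m. \<bar>wsum g (blk m @ [b0])\<bar> \<le> \<kappa>" using blk_err[of g] unfolding g0 by auto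
    obtain \<kappa>1 where k1: "\<And>m. \<bar>real (length (blk m)) - real m\<bar> \<le> \<kappa>1"
      using blk_err[of "\<lambda>_. 1"] unfolding x1 wsum_const by auto
    obtain W where W: "W \<ge> 0" "\<And>e. e \<in> ?I \<Longrightarrow> \<bar>g e\<bar> \<le> W" using finite_weight_bound[OF fI, of g] by blast
    have k0: "\<kappa> \<ge> 0" "\<kappa>1 \<ge> 0" using k[of 0] k1[of 0] by linarith+
    have pp: "psum g \<rho> (length (pre m)) = wsum g (pre m @ [b0])" for m
      unfolding \<rho> by (simp only: wsum_map_play)
    have pm: "\<bar>psum g \<rho> (length (pre m))\<bar> \<le> \<kappa> * real m" for m
    proof (induction m)
      case (Suc m)
      have "psum g \<rho> (length (pre (Suc m))) = psum g \<rho> (length (pre m)) + wsum g (blk m @ [b0])"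
        unfolding pp unfolding preS using blk(1) by (rule wsum_walk_append)
      then show ?case using Suc k[of m] by (simp add: algebra_simps)
    qed (simp add: pre_def)
    \<comment> \<open>Phase \<open>m\<close> is at least \<open>m\<close> long, so the first
      \<open>m\<close> phases take at least \<open>m * (m - 1) / 2\<close> moves.\<close>
    have off: "length (pre m) * 2 + m \<ge> m * m" for m
    proof (induction m)
      case (Suc m)
      then show ?case using len_ge[of m] by (simp add: preS)
    qed simp
    \<comment> \<open>Combines the error of the completed phases with the weight of the unfinished
      one; both are at most linear in the number of phases.\<close>
    define A where "A = \<kappa> + W * (1 + \<kappa>1)"
    have A0: "A \<ge> 0" using k0 W by (simp add: A_def)
    have bound: "\<bar>psum g \<rho> n\<bar> \<le> A * (2 + sqrt (2 * real n))" for n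
    proof -
      have "\<exists>m. length (pre m) \<le> n \<and> n < length (pre (Suc m))"
      proof -
        have "length (pre 0) \<le> n" by (simp add: pre_def)
        moreover have "length (pre m) \<le> n \<Longrightarrow> m \<le> n" for m
          using \<rho>'(2)[of "m - 1"] by (cases m) auto
        ultimately obtain m where m: "length (pre m) \<le> n" "\<And>m'. length (pre m') \<le> n \<Longrightarrow> m' \<le> m"
          using Greatest_le_nat[of "\<lambda>m. length (pre m) \<le> n" _ n] GreatestI_nat[of "\<lambda>m. length (pre m) \<le> n" _ n] by blast
        then show ?thesis by (metis Suc_n_not_le_n not_le)
      qed
      then obtain m where m: "length (pre m) \<le> n" "n < length (pre (Suc m))" by blast
      let ?o = "length (pre m)"
      have seg: "\<bar>psum g \<rho> (?o + d) - psum g \<rho> ?o\<bar> \<le> real d * W" for d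
      proof (induction d)
        case (Suc d)
        then show ?case using W(2)[OF inI[of "?o + d"]] by (simp add: algebra_simps)
      qed simp
      have "real (n - ?o) \<le> real (length (blk m))" using m by (simp add: preS)
      also have "\<dots> \<le> real m + \<kappa>1" using k1[of m] by linarith
      finally have "real (n - ?o) * W \<le> (real m + \<kappa>1) * W" using W(1) by (rule mult_right_mono)
      then have "\<bar>psum g \<rho> n\<bar> \<le> \<kappa> * real m + (real m + \<kappa>1) * W" using seg[of "n - ?o"] pm[of m] m(1) by simp
      also have "\<dots> \<le> A * (real m + 1)"
        unfolding A_def using k0 W(1) by (simp add: algebra_simps)
      also have "\<dots> \<le> A * (2 + sqrt (2 * real n))"
      proof -
        have "m * m \<le> n * 2 + m" using off[of m] m(1) by linarith
        then have "real m * real m \<le> real n * 2 + real m" by (metis of_nat_add of_nat_le_iff of_nat_mult of_nat_numeral)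
        then have sq: "real m \<ge> 1 \<Longrightarrow> (real m - 1)\<^sup>2 \<le> 2 * real n"
          unfolding power2_eq_square by (simp add: algebra_simps)
        have "real m - 1 \<le> sqrt (2 * real n)"
        proof (cases "m = 0")
          case True
          have "0 \<le> sqrt (2 * real n)" by simp
          then show ?thesis using True by linarith
        qed (use sq real_le_rsqrt in auto)
        then show ?thesis using A0 by (intro mult_left_mono) auto
      qed
      finally show ?thesis .
    qed
    have "(\<lambda>n. psum g \<rho> n / real n) \<longlonglongrightarrow> 0"
    proof (rule Lim_null_comparison[OF _ sqrt_growth_over_n[of A]])
      show "\<forall>\<^sub>F n in sequentially. norm (psum g \<rho> n / real n) \<le> A * (2 + sqrt (2 * real n)) / real n"
        using bound by (simp add: divide_right_mono)
    qed
    then have "(\<lambda>n. psum g \<rho> n / real n + z) \<longlonglongrightarrow> 0 + z" by (intro tendsto_intros)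
    moreover have "\<forall>\<^sub>F n in sequentially. psum g \<rho> n / real n + z = psum (rew G j) \<rho> n / real n"
      by (rule eventually_sequentiallyI[of 1]) (simp add: g_def psum_shift field_simps)
    ultimately show ?thesis unfolding z_def[symmetric] using tendsto_cong by force
  qed
  then show ?thesis using that pl r0 rK by blast
qed

section \<open>Certificates for upper bounds on the negotiation function\<close>

text \<open>A proposal \<open>(p, k, T, K)\<close> made at \<open>w\<close> stands for all plays inside \<open>T\<close> that follow the lasso \<open>p\<close> (which
  closes at position \<open>k\<close>), repeat its cycle many times and finally settle in \<open>K\<close>.\<close>

type_synonym proposal = "nat list \<times> nat \<times> nat set \<times> nat set"

text \<open>\<open>R\<close> has to contain the targets of deviations from all of \<open>T\<close>:
  the way to \<open>K\<close> and the settling phase may visit any vertex there, not only those of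
  the lasso.\<close>

definition proposal_ok :: "mpgame \<Rightarrow> nat \<Rightarrow> nat set \<Rightarrow> nat \<Rightarrow> proposal \<Rightarrow> bool" where
  "proposal_ok G i R w = (\<lambda>(p, k, T, K). is_history G p \<and> distinct p \<and> hd p = w \<and> k < length p \<and>
     (last p, p ! k) \<in> edges G \<and> set p \<subseteq> T \<and> T \<subseteq> verts G \<and> K \<subseteq> T \<and> strongly_connected G K \<and>
     (\<exists>b\<in>K. (p ! k, b) \<in> (inner_edges G T)\<^sup>*) \<and>
     (\<forall>t\<in>T. owner G t = i \<longrightarrow> (\<forall>w'. (t, w') \<in> edges G \<longrightarrow> w' \<in> R)))"

definition cycle_ok :: "mpgame \<Rightarrow> nat \<Rightarrow> real \<Rightarrow> proposal \<Rightarrow> bool" where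
  "cycle_ok G i c = (\<lambda>(p, k, T, K). wsum (\<lambda>e. rew G i e - c) (drop k p @ [p ! k]) \<le> 0)"

text \<open>Payoffs are prefix-independent and hence determined by the flow alone; the requirements
  of all vertices of \<open>T\<close>, visited early or late, bear on it.\<close>

definition flow_ok :: "mpgame \<Rightarrow> nat \<Rightarrow> requirement \<Rightarrow> real \<Rightarrow> (nat \<times> nat \<Rightarrow> real) \<Rightarrow> proposal \<Rightarrow> bool" where
  "flow_ok G i lam c x = (\<lambda>(p, k, T, K). circulation G K x \<and>
     (\<forall>t\<in>T. lam t \<le> ereal (flow_value G K x (owner G t))) \<and> flow_value G K x i \<le> c)"

text \<open>Only the first lap is constrained. Further laps cannot raise the gain of a deviation,
  and deviations in the settling phase are made harmless by the number of laps.\<close>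

definition pot_ok :: "mpgame \<Rightarrow> nat \<Rightarrow> real \<Rightarrow> (nat \<Rightarrow> real) \<Rightarrow> nat \<Rightarrow> proposal \<Rightarrow> bool" where
  "pot_ok G i c f w = (\<lambda>(p, k, T, K). \<forall>m<length p. owner G (p ! m) = i \<longrightarrow> (\<forall>w'. (p ! m, w') \<in> edges G \<longrightarrow>
     wsum (\<lambda>e. rew G i e - c) (take (Suc m) p @ [w']) + f w' \<le> f w))"

definition certificate :: "mpgame \<Rightarrow> nat \<Rightarrow> requirement \<Rightarrow> real \<Rightarrow> nat set \<Rightarrow> (nat \<Rightarrow> proposal) \<Rightarrow>
    (nat \<Rightarrow> real) \<Rightarrow> (nat \<Rightarrow> nat \<times> nat \<Rightarrow> real) \<Rightarrow> bool" where
  "certificate G i lam c R pr f x \<longleftrightarrow> R \<subseteq> verts G \<and>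
     (\<forall>w\<in>R. proposal_ok G i R w (pr w) \<and> cycle_ok G i c (pr w) \<and> flow_ok G i lam c (x w) (pr w) \<and>
       pot_ok G i c f w (pr w))"

section \<open>Realising a proposal by a play\<close>

definition prepend :: "nat list \<Rightarrow> play \<Rightarrow> play" where
  "prepend L \<rho> = (\<lambda>n. if n < length L then L ! n else \<rho> (n - length L))"

lemma suffix_play_prepend [simp]: "suffix_play (prepend L \<rho>) (length L) = \<rho>"
  by (simp add: suffix_play_def prepend_def)

lemma prepend_nth: "n \<le> length L \<Longrightarrow> prepend L \<rho> n = (L @ [\<rho> 0]) ! n"
  by (auto simp: prepend_def nth_append)

lemma map_prepend: "n \<le> length L \<Longrightarrow> map (prepend L \<rho>) [0..<Suc n] = take (Suc n) (L @ [\<rho> 0])"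
  by (intro nth_equalityI) (auto simp del: upt_Suc take_append simp: prepend_nth)

lemma prepend_0: "walk r a L (\<rho> 0) \<Longrightarrow> prepend L \<rho> 0 = a"
  using walk_hd[of r a L "\<rho> 0"] by (auto simp: prepend_nth)

lemma prepend_step:
  assumes "walk r a L (\<rho> 0)" "\<And>n. (\<rho> n, \<rho> (Suc n)) \<in> r"
  shows "(prepend L \<rho> n, prepend L \<rho> (Suc n)) \<in> r"
proof (cases "n < length L")
  case True
  then show ?thesis using walk_nth[OF assms(1) True] by (simp add: prepend_nth)
next
  case False
  then show ?thesis using assms(2)[of "n - length L"] by (simp add: prepend_def Suc_diff_le)
qed

lemma psum_prepend_le: "n \<le> length L \<Longrightarrow> psum g (prepend L \<rho>) n = wsum g (take (Suc n) (L @ [\<rho> 0]))"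
  using wsum_map_play[of g "prepend L \<rho>" n] map_prepend[of n L \<rho>] by simp

lemma psum_prepend: "psum g (prepend L \<rho>) (length L + n) = wsum g (L @ [\<rho> 0]) + psum g \<rho> n"
  using psum_suffix[of g "prepend L \<rho>" "length L" n] psum_prepend_le[of "length L" L g \<rho>] by simp

lemma psum_bounded_above:
  assumes "(\<lambda>n. psum (rew G i) \<rho> n / real n) \<longlonglongrightarrow> z" "z < c"
  obtains B where "\<And>n. psum (\<lambda>e. rew G i e - c) \<rho> n \<le> B"
proof -
  obtain N where N: "\<And>n. n \<ge> N \<Longrightarrow> psum (rew G i) \<rho> n / real n < c"
    using order_tendstoD(2)[OF assms] by (auto simp: eventually_sequentially)
  obtain B where B: "B \<ge> 0" "\<And>n. n \<in> {..N + 1} \<Longrightarrow> \<bar>psum (\<lambda>e. rew G i e - c) \<rho> n\<bar> \<le> B"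
    using finite_weight_bound[of "{..N + 1}" "psum (\<lambda>e. rew G i e - c) \<rho>"] by blast
  have "psum (\<lambda>e. rew G i e - c) \<rho> n \<le> B" for n
  proof (cases "n \<le> N + 1")
    case True
    then have "\<bar>psum (\<lambda>e. rew G i e - c) \<rho> n\<bar> \<le> B" by (intro B(2)) simp
    then show ?thesis by linarith
  next
    case False
    then have "psum (rew G i) \<rho> n / real n < c" "n > 0" using N[of n] by auto
    then have "psum (\<lambda>e. rew G i e - c) \<rho> n \<le> 0" by (simp add: psum_shift field_simps)
    then show ?thesis using B(1) by linarith
  qed
  then show ?thesis using that by blast
qed

lemma play_exists:
  assumes wf: "wf_game G" and w: "w \<in> verts G"
  obtains \<rho> where "is_play G \<rho>" "\<rho> 0 = w"
proof -
  have "\<exists>\<rho>. \<forall>n. (\<rho> n \<in> verts G \<and> (n = 0 \<longrightarrow> \<rho> n = w)) \<and> (\<rho> n, \<rho> (Suc n)) \<in> edges G"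
  proof (intro dependent_nat_choice)
    fix u and n :: nat assume "u \<in> verts G \<and> (n = 0 \<longrightarrow> u = w)"
    then obtain y where "(u, y) \<in> edges G" "y \<in> verts G" using wf unfolding wf_game_def by blast
    then show "\<exists>y. (y \<in> verts G \<and> (Suc n = 0 \<longrightarrow> y = w)) \<and> (u, y) \<in> edges G" by blast
  qed (use w in blast)
  then show ?thesis using that by (auto simp: is_play_def)
qed

lemma wsum_mono: "(\<And>e. g e \<le> h e) \<Longrightarrow> wsum g L \<le> wsum h L"
  by (induction g L rule: wsum.induct) (auto intro: add_mono)

lemma walk_of_history:
  assumes "is_history G h" "set h \<subseteq> T" "(last h, b) \<in> edges G" "b \<in> T"
  shows "walk (inner_edges G T) (hd h) h b"
  using assms
proof (induction h arbitrary: b rule: rev_induct)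
  case (snoc x h)
  have x: "walk (inner_edges G T) x [x] b" using snoc.prems
    by (auto intro!: walk.intros simp: inner_edges_def)
  show ?case
  proof (cases "h = []")
    case False
    then have "is_history G h" "(last h, x) \<in> edges G" using snoc.prems by (auto simp: is_history_snoc)
    then have w: "walk (inner_edges G T) (hd h) h x" using snoc.prems by (intro snoc.IH) auto
    show ?thesis using walk_append[OF w x] False by simp
  qed (use x in simp)
qed (simp add: is_history_def)

lemma concat_replicate_Suc_right: "concat (replicate (Suc n) xs) = concat (replicate n xs) @ xs"
  by (induction n) auto

text \<open>Additional laps have nonpositive weight, so a prefix ending in a later lap weighs at
  most as much as the prefix of \<open>p\<close> that ends at the same vertex.\<close>

lemma pumped_prefix_le:
  assumes g: "wsum g (drop k p @ [p ! k]) \<le> 0" and k: "k < length p" and r: "walk r (p ! k) (drop k p) (p ! k)"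
    and n: "n < length (take k p @ concat (replicate M (drop k p)))"
  shows "\<exists>m<length p. (take k p @ concat (replicate M (drop k p))) ! n = p ! m \<and>
    wsum g (take (Suc n) (take k p @ concat (replicate M (drop k p)))) \<le> wsum g (take (Suc m) p)"
  using n
proof (induction M)
  case 0
  then show ?case using k by (intro exI[of _ n]) (auto simp: min_def)
next
  case (Suc M)
  let ?a = "p ! k"
  let ?C = "drop k p"
  let ?L = "take k p @ concat (replicate M ?C)"
  have L: "take k p @ concat (replicate (Suc M) ?C) = ?L @ ?C"
    by (simp only: concat_replicate_Suc_right append_assoc)
  show ?case
  proof (cases "n < length ?L")
    case True
    then have "take (Suc n) (?L @ ?C) = take (Suc n) ?L" "(?L @ ?C) ! n = ?L ! n"
      by (auto simp: nth_append)
    then show ?thesis unfolding L using Suc.IH True by simp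
  next
    case False
    then obtain d where d: "n = length ?L + d" using le_Suc_ex not_less by blast
    have dC: "d < length ?C" using Suc.prems unfolding L d by simp
    have C: "?C = ?a # drop (Suc k) p" using k by (simp add: Cons_nth_drop_Suc)
    define t where "t = take d (drop (Suc k) p)"
    have tC: "take (Suc d) ?C = ?a # t" using C by (simp add: t_def)
    have "take (length xs + m) (xs @ ys) = xs @ take m ys" for xs ys :: "nat list" and m by simp
    from this[of ?L "Suc d" ?C] have "take (Suc n) (?L @ ?C) = ?L @ ?a # t" unfolding tC d by (simp only: add_Suc_right)
    then have "wsum g (take (Suc n) (?L @ ?C)) = wsum g (?L @ [?a]) + wsum g (?a # t)"
      using wsum_append by metis
    also have "wsum g (?L @ [?a]) = wsum g (take k p @ [?a]) + real M * wsum g (?C @ [?a])"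
      using wsum_walk_append[OF walk_replicate[OF r], of g "take k p" M] wsum_replicate[OF r, of g M] by simp
    also have "wsum g (take k p @ [?a]) + real M * wsum g (?C @ [?a]) + wsum g (?a # t) \<le> wsum g (take k p @ [?a]) + wsum g (?a # t)"
      using g by (simp add: mult_nonneg_nonpos)
    also have "\<dots> = wsum g (take k p @ ?a # t)" using wsum_append by metis
    also have "take k p @ ?a # t = take (Suc (k + d)) p"
      using tC k take_add[of k "Suc d" p] by simp
    finally have "wsum g (take (Suc n) (?L @ ?C)) \<le> wsum g (take (Suc (k + d)) p)" .
    moreover have "(?L @ ?C) ! n = p ! (k + d)" using dC by (simp add: d nth_append)
    ultimately show ?thesis unfolding L using dC by (intro exI[of _ "k + d"]) auto
  qed
qed

text \<open>The slack \<open>d\<close> serves twice: every lap weighs at most \<open>- d\<close>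
  relative to \<open>c + d\<close>, and the settling play, whose average for player \<open>i\<close>
  tends to at most \<open>c\<close>, has sums bounded above. Enough laps therefore outweigh anything
  that a deviation in the settling phase can gain.\<close>

lemma play_of_proposal:
  assumes wf: "wf_game G" and pr: "proposal_ok G i R w (p, k, T, K)" and cyc: "cycle_ok G i c (p, k, T, K)"
    and flow: "flow_ok G i lam c x (p, k, T, K)" and pot: "pot_ok G i c f w (p, k, T, K)"
    and d: "d > 0" and Fb: "\<And>u. u \<in> insert w R \<Longrightarrow> \<bar>f u\<bar> \<le> Fb"
  obtains \<rho> where "is_play G \<rho>" "\<rho> 0 = w" "range \<rho> \<subseteq> T" "\<And>j. mean_payoff G j \<rho> = ereal (flow_value G K x j)"
    "\<And>n w'. owner G (\<rho> n) = i \<Longrightarrow> (\<rho> n, w') \<in> edges G \<Longrightarrow>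
      psum (\<lambda>e. rew G i e - (c + d)) \<rho> n + (rew G i (\<rho> n, w') - (c + d)) \<le> f w - f w'"
proof -
  let ?g = "\<lambda>e. rew G i e - c"
  let ?h = "\<lambda>e. rew G i e - (c + d)"
  let ?I = "inner_edges G T"
  let ?a = "p ! k"
  let ?C = "drop k p"
  have hp: "is_history G p" and hdp: "hd p = w" and k: "k < length p" and ep: "(last p, ?a) \<in> edges G"
    and pT: "set p \<subseteq> T" and KT: "K \<subseteq> T" and sc: "strongly_connected G K"
    and TR: "\<And>t w'. t \<in> T \<Longrightarrow> owner G t = i \<Longrightarrow> (t, w') \<in> edges G \<Longrightarrow> w' \<in> R"
    using pr by (auto simp: proposal_ok_def)
  obtain b where b: "b \<in> K" "(?a, b) \<in> ?I\<^sup>*" using pr by (auto simp: proposal_ok_def)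
  have circ: "circulation G K x" and fi: "flow_value G K x i \<le> c" using flow by (auto simp: flow_ok_def)
  obtain \<rho>K where rK: "is_play G \<rho>K" "\<rho>K 0 = b" "range \<rho>K \<subseteq> K"
    "\<And>j. (\<lambda>n. psum (rew G j) \<rho>K n / real n) \<longlonglongrightarrow> flow_value G K x j"
    using play_of_circulation[OF wf sc circ b(1)] by blast
  have rKI: "(\<rho>K n, \<rho>K (Suc n)) \<in> ?I" for n using rK(1,3) KT by (auto simp: is_play_def inner_edges_def)
  obtain L where L: "walk ?I ?a L b" using walk_of_rtrancl[OF b(2)] by blast
  define \<rho>1 where "\<rho>1 = prepend L \<rho>K"
  have r1: "\<rho>1 0 = ?a" "\<And>n. (\<rho>1 n, \<rho>1 (Suc n)) \<in> ?I"
    unfolding \<rho>1_def using prepend_0[of ?I ?a L \<rho>K] prepend_step[of ?I ?a L \<rho>K] L rK(2) rKI by auto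
  have aT: "?a \<in> T" using pT k by auto
  have wp: "walk ?I w p ?a" using walk_of_history[OF hp pT ep aT] hdp by simp
  have wC: "walk ?I ?a ?C ?a"
  proof -
    have "walk r w' p' c' \<Longrightarrow> k' < length p' \<Longrightarrow> walk r (p' ! k') (drop k' p') c'" for r w' p' c' k'
      by (induction arbitrary: k' rule: walk.induct) (auto simp: nth_Cons' drop_Cons' intro: walk.intros)
    then show ?thesis using wp k by blast
  qed
  have wq: "walk ?I w (take k p) ?a"
  proof -
    have "walk r w' p' c' \<Longrightarrow> k' < length p' \<Longrightarrow> walk r w' (take k' p') (p' ! k')" for r w' p' c' k'
    proof (induction arbitrary: k' rule: walk.induct)
      case (walk_Cons a b L c)
      show ?case
      proof (cases k')
        case (Suc m)
        then show ?thesis using walk_Cons by (auto intro: walk.intros)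
      qed (auto intro: walk.intros)
    qed simp
    then show ?thesis using wp k by blast
  qed
  obtain B1 where B1: "\<And>n. psum ?h \<rho>K n \<le> B1"
    using psum_bounded_above[OF rK(4)[of i], of "c + d"] fi d by (smt (verit))
  obtain B2 where B2: "B2 \<ge> 0" "\<And>n. n \<in> {..length L} \<Longrightarrow> \<bar>psum ?h \<rho>1 n\<bar> \<le> B2"
    using finite_weight_bound[of "{..length L}" "psum ?h \<rho>1"] by blast
  have B3: "psum ?h \<rho>1 n \<le> 2 * B2 + \<bar>B1\<bar>" for n
  proof (cases "n \<le> length L")
    case True
    then have "\<bar>psum ?h \<rho>1 n\<bar> \<le> B2" by (intro B2(2)) simp
    then show ?thesis using B2(1) by linarith
  next
    case False
    then obtain m where m: "n = length L + m" using le_Suc_ex nat_le_linear by blast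
    have "psum ?h \<rho>1 (length L + 0) = wsum ?h (L @ [\<rho>K 0]) + 0" unfolding \<rho>1_def psum_prepend by simp
    moreover have "\<bar>psum ?h \<rho>1 (length L)\<bar> \<le> B2" by (intro B2(2)) simp
    ultimately have "wsum ?h (L @ [\<rho>K 0]) \<le> B2" by simp
    then show ?thesis using B1[of m] B2(1) unfolding m \<rho>1_def psum_prepend by linarith
  qed
  obtain W where W: "W \<ge> 0" "\<And>e. e \<in> edges G \<Longrightarrow> \<bar>?h e\<bar> \<le> W"
    using finite_weight_bound[OF finite_edges[OF wf], of ?h] by blast
  \<comment> \<open>Everything that a late deviation may gain apart from the laps: the approach to
    the cycle, the settling play, the deviating edge, and a difference of potentials.\<close>
  define Q where "Q = wsum ?h (take k p @ [?a]) + (2 * B2 + \<bar>B1\<bar>) + W + 2 * Fb"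
  obtain M :: nat where M: "real M > Q / d" using reals_Archimedean2 by blast
  then have MQ: "Q \<le> real M * d" using d by (simp add: field_simps)
  define Lp where "Lp = take k p @ concat (replicate M ?C)"
  define \<rho> where "\<rho> = prepend Lp \<rho>1"
  have wLp: "walk ?I w Lp ?a" unfolding Lp_def by (rule walk_append[OF wq walk_replicate[OF wC]])
  have rI: "(\<rho> n, \<rho> (Suc n)) \<in> ?I" for n
    unfolding \<rho>_def using prepend_step[of ?I w Lp \<rho>1] wLp r1 by simp
  have pl: "is_play G \<rho>" using rI by (simp add: is_play_def inner_edges_def)
  have rT: "range \<rho> \<subseteq> T" using rI by (auto simp: inner_edges_def)
  have r0: "\<rho> 0 = w" unfolding \<rho>_def using prepend_0[of ?I w Lp \<rho>1] wLp r1 by simp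
  have mp: "mean_payoff G j \<rho> = ereal (flow_value G K x j)" for j
  proof -
    have pl1: "is_play G \<rho>1" using r1 by (simp add: is_play_def inner_edges_def)
    have "mean_payoff G j \<rho> = mean_payoff G j \<rho>1"
      using mean_payoff_suffix_play[OF wf pl, of j "length Lp"] by (simp add: \<rho>_def)
    also have "\<dots> = mean_payoff G j \<rho>K"
      using mean_payoff_suffix_play[OF wf pl1, of j "length L"] by (simp add: \<rho>1_def)
    finally show ?thesis using mean_payoff_lim[OF rK(4)] by simp
  qed
  have cg: "wsum ?g (?C @ [?a]) \<le> 0" using cyc by (simp add: cycle_ok_def)
  have ch: "wsum ?h (?C @ [?a]) \<le> - d"
  proof -
    have "wsum ?h (?C @ [?a]) = wsum ?g (?C @ [?a]) - real (length ?C) * d"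
    proof -
      have "?h = (\<lambda>e. ?g e - d)" by (rule ext) simp
      then show ?thesis using wsum_diff[of ?g "\<lambda>_. d" "?C @ [?a]"] wsum_const[of d ?C ?a] by simp
    qed
    moreover have "1 * d \<le> real (length ?C) * d" using k d by (intro mult_right_mono) auto
    ultimately show ?thesis using cg by linarith
  qed
  have "psum ?h \<rho> n + ?h (\<rho> n, w') \<le> f w - f w'"
    if o: "owner G (\<rho> n) = i" and e: "(\<rho> n, w') \<in> edges G" for n w'
  proof (cases "n < length Lp")
    case True
    obtain m where m: "m < length p" "Lp ! n = p ! m" "wsum ?g (take (Suc n) Lp) \<le> wsum ?g (take (Suc m) p)"
      using pumped_prefix_le[OF cg k wC True[unfolded Lp_def]] unfolding Lp_def by blast
    have rn: "\<rho> n = p ! m" using True m(2) by (simp add: \<rho>_def prepend_def)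
    have "psum ?h \<rho> n = wsum ?h (take (Suc n) Lp)"
      using True psum_prepend_le[of n Lp ?h \<rho>1] by (simp add: \<rho>_def)
    also have "\<dots> \<le> wsum ?g (take (Suc n) Lp)" using d by (intro wsum_mono) simp
    also have "\<dots> \<le> wsum ?g (take (Suc m) p)" by (rule m(3))
    finally have 1: "psum ?h \<rho> n \<le> wsum ?g (take (Suc m) p)" .
    have "wsum ?g (take (Suc m) p @ [w']) + f w' \<le> f w"
      using pot m(1) o e unfolding rn pot_ok_def by blast
    moreover have "wsum ?g (take (Suc m) p @ [w']) = wsum ?g (take (Suc m) p) + ?g (p ! m, w')"
      using m(1) k by (subst wsum_snoc) (auto simp: take_Suc_conv_app_nth)
    ultimately show ?thesis using 1 d unfolding rn by linarith
  next
    case False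
    then obtain m where m: "n = length Lp + m" using le_Suc_ex not_less by blast
    have "wsum ?h (Lp @ [?a]) = wsum ?h (take k p @ [?a]) + real M * wsum ?h (?C @ [?a])"
      unfolding Lp_def using wsum_walk_append[OF walk_replicate[OF wC], of ?h "take k p" M] wsum_replicate[OF wC, of ?h M] by simp
    moreover have "real M * wsum ?h (?C @ [?a]) \<le> real M * (- d)" using ch by (intro mult_left_mono) auto
    moreover have "psum ?h \<rho> n = wsum ?h (Lp @ [?a]) + psum ?h \<rho>1 m"
      unfolding m \<rho>_def psum_prepend r1(1) ..
    ultimately have 1: "psum ?h \<rho> n \<le> wsum ?h (take k p @ [?a]) - real M * d + (2 * B2 + \<bar>B1\<bar>)"
      using B3[of m] by linarith
    have "\<rho> n \<in> T" using rT by blast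
    then have "w' \<in> R" using TR o e by blast
    then have 2: "\<bar>f w\<bar> \<le> Fb" "\<bar>f w'\<bar> \<le> Fb" using Fb by auto
    have "\<bar>?h (\<rho> n, w')\<bar> \<le> W" using W(2) e by blast
    then show ?thesis using 1 2 MQ unfolding Q_def by linarith
  qed
  then show ?thesis using that[of \<rho>] pl r0 rT mp by blast
qed

text \<open>Each \<open>d > 0\<close> yields a profile of its own, and \<open>c\<close> is obtained
  only as the limit of their bounds.\<close>

lemma nego_le_if_certificate:
  assumes wf: "wf_game G" and cert: "certificate G (owner G v) lam c R pr f x" and v: "v \<in> R"
  shows "nego G lam v \<le> ereal c"
proof (rule ereal_le_epsilon2)
  fix d :: real assume d: "0 < d"
  let ?i = "owner G v"
  have RV: "R \<subseteq> verts G" using cert by (simp add: certificate_def)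
  have fR: "finite R" using RV wf by (auto simp: wf_game_def intro: finite_subset)
  obtain Fb where Fb: "\<And>w. w \<in> R \<Longrightarrow> \<bar>f w\<bar> \<le> Fb" using finite_weight_bound[OF fR, of f] by blast
  \<comment> \<open>Vertices outside \<open>R\<close> receive an arbitrary play, since strategies
    must be legal also on histories that never arise.\<close>
  have "\<exists>\<rho>. (is_play G \<rho> \<and> \<rho> 0 = w) \<and> (w \<in> R \<longrightarrow> consistent G lam \<rho> \<and> mean_payoff G ?i \<rho> \<le> ereal (c + d) \<and>
      (\<forall>n w'. owner G (\<rho> n) = ?i \<longrightarrow> (\<rho> n, w') \<in> edges G \<longrightarrow> w' \<in> R \<and>
        psum (\<lambda>e. rew G ?i e - (c + d)) \<rho> n + (rew G ?i (\<rho> n, w') - (c + d)) \<le> f w - f w'))"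
    if w: "w \<in> verts G" for w
  proof (cases "w \<in> R")
    case False
    then show ?thesis using play_exists[OF wf w] by metis
  next
    case True
    obtain p k T K where pw: "pr w = (p, k, T, K)" by (cases "pr w")
    have ok: "proposal_ok G ?i R w (p, k, T, K)" "cycle_ok G ?i c (p, k, T, K)" "flow_ok G ?i lam c (x w) (p, k, T, K)"
      "pot_ok G ?i c f w (p, k, T, K)" using cert True by (auto simp: certificate_def simp flip: pw)
    have Fb': "\<bar>f u\<bar> \<le> Fb" if "u \<in> insert w R" for u using that Fb True by blast
    obtain \<rho> where \<rho>: "is_play G \<rho>" "\<rho> 0 = w" "range \<rho> \<subseteq> T" "\<And>j. mean_payoff G j \<rho> = ereal (flow_value G K (x w) j)"
      "\<And>n w'. owner G (\<rho> n) = ?i \<Longrightarrow> (\<rho> n, w') \<in> edges G \<Longrightarrow>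
        psum (\<lambda>e. rew G ?i e - (c + d)) \<rho> n + (rew G ?i (\<rho> n, w') - (c + d)) \<le> f w - f w'"
      by (rule play_of_proposal[OF wf ok d Fb'], simp, rule that)
    have "consistent G lam \<rho>"
      unfolding consistent_def mean_payoff_suffix_play[OF wf \<rho>(1)] \<rho>(4)
      using ok(3) \<rho>(3) by (auto simp: flow_ok_def)
    moreover have "mean_payoff G ?i \<rho> \<le> ereal (c + d)" using ok(3) d by (simp add: \<rho>(4) flow_ok_def)
    moreover have "w' \<in> R" if "owner G (\<rho> n) = ?i" "(\<rho> n, w') \<in> edges G" for n w'
    proof -
      have "\<rho> n \<in> T" using \<rho>(3) by blast
      then show ?thesis using ok(1) that unfolding proposal_ok_def by blast
    qed
    ultimately show ?thesis using \<rho>(1,2,5) by blast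
  qed
  then obtain P where P: "\<And>w. w \<in> verts G \<Longrightarrow> (is_play G (P w) \<and> P w 0 = w) \<and> (w \<in> R \<longrightarrow> consistent G lam (P w) \<and>
      mean_payoff G ?i (P w) \<le> ereal (c + d) \<and>
      (\<forall>n w'. owner G (P w n) = ?i \<longrightarrow> (P w n, w') \<in> edges G \<longrightarrow> w' \<in> R \<and>
        psum (\<lambda>e. rew G ?i e - (c + d)) (P w) n + (rew G ?i (P w n, w') - (c + d)) \<le> f w - f w'))"
    by metis
  have "nego G lam v \<le> ereal (c + d)"
    by (rule nego_le_if_plans[OF wf v RV refl, of P _ "c + d" f]) (use P RV in blast)+
  then show "nego G lam v \<le> ereal c + ereal d" by simp
qed

section \<open>Extracting certificates from rational profiles\<close>

definition proposal_moves :: "mpgame \<Rightarrow> nat \<Rightarrow> real \<Rightarrow> proposal \<Rightarrow> (real \<times> nat) set" where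
  "proposal_moves G i c = (\<lambda>(p, k, T, K). {(wsum (\<lambda>e. rew G i e - c) (take (Suc m) p @ [w']), w') | m w'.
     m < length p \<and> owner G (p ! m) = i \<and> (p ! m, w') \<in> edges G})"

lemma proposal_moves_history:
  assumes wf: "wf_game G" and ok: "proposal_ok G i R w pr" and mv: "(z, w') \<in> proposal_moves G i c pr"
  shows "w' \<in> R" "\<exists>L. is_history G L \<and> length L \<le> card (verts G) + 1 \<and> z = wsum (\<lambda>e. rew G i e - c) L"
proof -
  obtain p k T K where pr: "pr = (p, k, T, K)" by (cases pr)
  obtain m where m: "m < length p" "owner G (p ! m) = i" "(p ! m, w') \<in> edges G"
    "z = wsum (\<lambda>e. rew G i e - c) (take (Suc m) p @ [w'])" using mv by (auto simp: pr proposal_moves_def)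
  have ok': "is_history G p" "distinct p" "set p \<subseteq> T"
    "\<And>t w'. t \<in> T \<Longrightarrow> owner G t = i \<Longrightarrow> (t, w') \<in> edges G \<Longrightarrow> w' \<in> R"
    using ok unfolding pr proposal_ok_def by blast+
  have "p ! m \<in> T" using m(1) ok'(3) by auto
  then show "w' \<in> R" using ok'(4) m by blast
  have "is_history G (take (Suc m) p @ [w'])"
    using is_history_take[OF ok'(1), of m] m wf by (subst is_history_snoc) (auto simp: take_Suc_conv_app_nth wf_game_def)
  moreover have "length (take (Suc m) p @ [w']) \<le> card (verts G) + 1"
    using length_distinct_history[OF wf ok'(1,2)] m(1) by simp
  ultimately show "\<exists>L. is_history G L \<and> length L \<le> card (verts G) + 1 \<and> z = wsum (\<lambda>e. rew G i e - c) L"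
    using m(4) by blast
qed

text \<open>\<open>R\<close> consists of the last vertices of compatible histories. Histories ending
  at the same vertex may propose different plays; the first-cycle game over all valid proposals
  selects one proposal per vertex. The bound on \<open>f\<close> is uniform for thresholds with a
  common \<open>W\<close>, which is what a later limit of thresholds needs.\<close>

lemma certificate_if_nego_less:
  assumes wf: "wf_game G" and v: "v \<in> verts G" and i: "i = owner G v" and nego: "nego G lam v < ereal c"
    and W: "W \<ge> 0" "\<And>e. e \<in> edges G \<Longrightarrow> \<bar>rew G i e - c\<bar> \<le> W"
  obtains R pr f x where "v \<in> R" "certificate G i lam c R pr f x"
    "\<And>w. w \<in> R \<Longrightarrow> \<bar>f w\<bar> \<le> real (card (verts G)) * (real (card (verts G) + 1) * W)"
proof -
  let ?V = "verts G"
  define g where "g = (\<lambda>e. rew G i e - c)"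
  have Wg: "\<And>e. e \<in> edges G \<Longrightarrow> \<bar>g e\<bar> \<le> W" using W(2) by (simp add: g_def)
  obtain Hs :: "history set" and P where Hs: "[v] \<in> Hs" "\<And>h. h \<in> Hs \<Longrightarrow> is_history G h"
    and P: "\<And>h. h \<in> Hs \<Longrightarrow> is_play G (P h) \<and> P h 0 = last h \<and> consistent G lam (P h) \<and> mean_payoff G i (P h) < ereal c"
    and dev: "\<And>h n w'. h \<in> Hs \<Longrightarrow> owner G (P h n) = i \<Longrightarrow> (P h n, w') \<in> edges G \<Longrightarrow>
        h @ map (P h) [1..<Suc n] @ [w'] \<in> Hs"
    and lim: "\<And>\<rho>. is_play G \<rho> \<Longrightarrow> \<forall>N. \<exists>n\<ge>N. map \<rho> [0..<Suc n] \<in> Hs \<Longrightarrow> mean_payoff G i \<rho> < ereal c"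
    by (rule compatible_family[OF wf v i nego], rule that)
  define R where "R = last ` Hs"
  define opts where "opts w = {pr. proposal_ok G i R w pr \<and> cycle_ok G i c pr \<and> (\<exists>x. flow_ok G i lam c x pr)}" for w
  let ?mv = "proposal_moves G i c"
  define Zm where "Zm = real (card ?V + 1) * W"
  \<comment> \<open>A deviating walk is a simple path followed by one more vertex, so only finitely
    many weights occur; this makes the set of relevant stacks finite.\<close>
  define Z where "Z = wsum g ` {L. set L \<subseteq> ?V \<and> length L \<le> card ?V + 1}"
  have fV: "finite ?V" using wf by (simp add: wf_game_def)
  have RV: "R \<subseteq> ?V"
  proof
    fix w assume "w \<in> R"
    then obtain h where "h \<in> Hs" "w = last h" by (auto simp: R_def)
    then show "w \<in> ?V" using Hs(2)[of h] last_in_set[of h] by (auto simp: is_history_def)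
  qed
  have fZ: "finite Z" unfolding Z_def using fV by (intro finite_imageI finite_lists_length_le)
  have Zm0: "Zm \<ge> 0" using W(1) by (simp add: Zm_def)
  have mvZ: "z \<in> Z \<and> \<bar>z\<bar> \<le> Zm \<and> w' \<in> R" if po: "pr \<in> opts w" and zm: "(z, w') \<in> ?mv pr" for w pr z w'
  proof -
    have ok: "proposal_ok G i R w pr" using po by (simp add: opts_def)
    obtain L where L: "is_history G L" "length L \<le> card ?V + 1" "z = wsum g L"
      using proposal_moves_history(2)[OF wf ok zm] by (auto simp: g_def)
    have "z \<in> Z" unfolding Z_def L(3) using L(1,2) by (intro imageI) (auto simp: is_history_def)
    moreover have "\<bar>z\<bar> \<le> real (length L) * W" unfolding L(3) using Wg W(1) L(1) by (rule wsum_bound)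
    moreover have "real (length L) * W \<le> Zm" unfolding Zm_def using L(2) W(1) by (intro mult_right_mono) auto
    ultimately show ?thesis using proposal_moves_history(1)[OF wf ok zm] by auto
  qed
  define B where "B = real (card ?V) * W"
  have sim: "\<exists>pr\<in>opts (last h). \<forall>(z, w')\<in>?mv pr. \<exists>M. owner G (P h M) = i \<and>
        (P h M, w') \<in> edges G \<and> z \<le> psum g (P h) M + g (P h M, w') \<and> (\<forall>M'\<le>M. psum g (P h) M' \<ge> - B)"
    if h: "h \<in> Hs" for h
  proof -
    let ?\<rho> = "P h"
    let ?T = "range ?\<rho>"
    have pl: "is_play G ?\<rho>" "?\<rho> 0 = last h" "consistent G lam ?\<rho>" "mean_payoff G i ?\<rho> < ereal c" using P[OF h] by auto
    obtain p k where pk: "is_history G p" "distinct p" "hd p = ?\<rho> 0" "k < length p" "(last p, p ! k) \<in> edges G"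
      "wsum g (drop k p @ [p ! k]) \<le> 0"
      and sim: "\<And>m. m < length p \<Longrightarrow> \<exists>M. ?\<rho> M = p ! m \<and> wsum g (take (Suc m) p) \<le> psum g ?\<rho> M \<and>
        (\<forall>M'\<le>M. psum g ?\<rho> M' \<ge> - (real (card ?V) * W))"
      by (rule lasso_exists[OF wf pl(1,4) g_def W(1) Wg], simp, rule that)
    note sim = sim[folded B_def]
    obtain K x where K: "K \<subseteq> ?T" "strongly_connected G K" "\<And>m. \<exists>b\<in>K. (?\<rho> m, b) \<in> (inner_edges G ?T)\<^sup>*"
      and x: "circulation G K x" "mean_payoff G i ?\<rho> = ereal (flow_value G K x i)"
        "\<And>j. mean_payoff G j ?\<rho> \<le> ereal (flow_value G K x j)"
      by (rule circulation_of_play[OF wf pl(1)], rule that)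
    let ?pr = "(p, k, ?T, K)"
    have pT: "p ! m \<in> ?T" if "m < length p" for m using sim[OF that] by (metis rangeI)
    have "set p \<subseteq> ?T" using pT by (auto simp: in_set_conv_nth)
    moreover have "\<exists>b\<in>K. (p ! k, b) \<in> (inner_edges G ?T)\<^sup>*" using K(3) sim[OF pk(4)] by metis
    moreover have "w' \<in> R" if "t \<in> ?T" "owner G t = i" "(t, w') \<in> edges G" for t w'
    proof -
      obtain n where "t = ?\<rho> n" using \<open>t \<in> ?T\<close> by blast
      then have "h @ map ?\<rho> [1..<Suc n] @ [w'] \<in> Hs" using dev[OF h] that by blast
      then have "last (h @ map ?\<rho> [1..<Suc n] @ [w']) \<in> R" unfolding R_def by (rule imageI)
      then show ?thesis by simp
    qed
    moreover have "?T \<subseteq> ?V" using is_play_verts[OF wf pl(1)] by blast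
    ultimately have 1: "proposal_ok G i R (last h) ?pr"
      using pk K(1,2) pl(2) unfolding proposal_ok_def prod.case by metis
    have "lam t \<le> ereal (flow_value G K x (owner G t))" if "t \<in> ?T" for t
    proof -
      obtain n where n: "t = ?\<rho> n" using \<open>t \<in> ?T\<close> by blast
      have "owner G (?\<rho> n) \<in> players G" using is_play_verts[OF wf pl(1)] wf by (simp add: wf_game_def)
      then have "lam t \<le> mean_payoff G (owner G t) (suffix_play ?\<rho> n)" using pl(3) n by (simp add: consistent_def)
      then show ?thesis using x(3)[of "owner G t"] mean_payoff_suffix_play[OF wf pl(1)] by (metis order_trans)
    qed
    then have 2: "flow_ok G i lam c x ?pr" using x pl(4) by (simp add: flow_ok_def)
    have 3: "cycle_ok G i c ?pr" using pk(6) by (simp add: cycle_ok_def g_def)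
    have "?pr \<in> opts (last h)" using 1 2 3 by (auto simp: opts_def)
    moreover have "\<exists>M. owner G (P h M) = i \<and> (P h M, w') \<in> edges G \<and> z \<le> psum g (P h) M + g (P h M, w') \<and>
        (\<forall>M'\<le>M. psum g (P h) M' \<ge> - B)" if mv: "(z, w') \<in> ?mv ?pr" for z w'
    proof -
      obtain m where m: "m < length p" "owner G (p ! m) = i" "(p ! m, w') \<in> edges G" "z = wsum g (take (Suc m) p @ [w'])"
        using mv by (auto simp: proposal_moves_def g_def)
      obtain M where M: "?\<rho> M = p ! m" "wsum g (take (Suc m) p) \<le> psum g ?\<rho> M" "\<forall>M'\<le>M. psum g ?\<rho> M' \<ge> - B"
        using sim[OF m(1)] by blast
      have "z = wsum g (take (Suc m) p) + g (p ! m, w')"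
        unfolding m(4) using m(1) pk(4) by (subst wsum_snoc) (auto simp: take_Suc_conv_app_nth)
      then show ?thesis using m M by (intro exI[of _ M]) auto
    qed
    ultimately show ?thesis by blast
  qed
  have nw: "\<not> challenger_wins opts ?mv [(0, w)]" if "w \<in> R" for w
  proof -
    obtain h0 where h0: "h0 \<in> Hs" "w = last h0" using \<open>w \<in> R\<close> by (auto simp: R_def)
    have B0: "B \<ge> 0" using W(1) by (simp add: B_def)
    have Zb: "\<bar>z\<bar> \<le> Zm" if "h \<in> Hs" "opt \<in> opts (last h)" "(z, w') \<in> ?mv opt" for h opt z w'
      using mvZ that by blast
    show ?thesis unfolding h0(2)
      by (rule not_challenger_wins[where P = P and Hs = Hs, OF wf g_def Hs(2) _ dev lim Zm0 Zb B0 sim h0(1)])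
        (use P in auto)
  qed
  obtain f where f: "\<And>w. w \<in> R \<Longrightarrow> \<bar>f w\<bar> \<le> real (card ?V) * Zm"
    "\<And>w. w \<in> R \<Longrightarrow> \<exists>pr\<in>opts w. \<forall>(z, w')\<in>?mv pr. z + f w' \<le> f w"
    using potential_if_not_challenger_wins[where opts = opts and mv = ?mv, OF fV RV fZ Zm0 _ nw] mvZ by metis
  have "\<forall>w\<in>R. \<exists>pr x. proposal_ok G i R w pr \<and> cycle_ok G i c pr \<and> flow_ok G i lam c x pr \<and> pot_ok G i c f w pr"
  proof
    fix w assume "w \<in> R"
    then obtain pr where pr: "pr \<in> opts w" "\<And>z w'. (z, w') \<in> ?mv pr \<Longrightarrow> z + f w' \<le> f w" using f(2) by blast
    obtain p k T K where pr4: "pr = (p, k, T, K)" by (cases pr)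
    have "pot_ok G i c f w pr" using pr(2) unfolding pot_ok_def pr4 proposal_moves_def by auto
    then show "\<exists>pr x. proposal_ok G i R w pr \<and> cycle_ok G i c pr \<and> flow_ok G i lam c x pr \<and> pot_ok G i c f w pr"
      using pr(1) unfolding opts_def by blast
  qed
  then obtain pr x where "\<forall>w\<in>R. proposal_ok G i R w (pr w) \<and> cycle_ok G i c (pr w) \<and> flow_ok G i lam c (x w) (pr w) \<and> pot_ok G i c f w (pr w)"
    by metis
  then have "certificate G i lam c R pr f x" using RV by (simp add: certificate_def)
  moreover have "v \<in> R" unfolding R_def using Hs(1) by force
  ultimately show ?thesis using that f(1) unfolding Zm_def by blast
qed

text \<open>Finiteness makes some combinatorial part of the certificates recur infinitely often
  while the thresholds vary.\<close>

lemma finite_proposals: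
  assumes wf: "wf_game G"
  shows "finite {pr. \<exists>w R. proposal_ok G i R w pr}"
proof (rule finite_subset)
  let ?V = "verts G"
  show "{pr. \<exists>w R. proposal_ok G i R w pr} \<subseteq>
    {L. set L \<subseteq> ?V \<and> length L \<le> card ?V} \<times> {..card ?V} \<times> Pow ?V \<times> Pow ?V"
  proof
    fix pr assume "pr \<in> {pr. \<exists>w R. proposal_ok G i R w pr}"
    moreover obtain p k T K where pr4: "pr = (p, k, T, K)" by (cases pr)
    ultimately have "is_history G p" "distinct p" "k < length p" "T \<subseteq> ?V" "K \<subseteq> T" by (auto simp: proposal_ok_def)
    then show "pr \<in> {L. set L \<subseteq> ?V \<and> length L \<le> card ?V} \<times> {..card ?V} \<times> Pow ?V \<times> Pow ?V"
      using length_distinct_history[OF wf, of p] by (auto simp: pr4 is_history_def)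
  qed
  show "finite ({L. set L \<subseteq> ?V \<and> length L \<le> card ?V} \<times> {..card ?V} \<times> Pow ?V \<times> Pow ?V)"
    using wf by (intro finite_cartesian_product finite_lists_length_le) (auto simp: wf_game_def)
qed

text \<open>The infimum in \<^const>\<open>nego\<close> need not be attained a priori, so certificates for thresholds
  tending to \<open>c\<close> are combined by compactness.\<close>

lemma certificate_if_nego_le:
  assumes wf: "wf_game G" and v: "v \<in> verts G" and i: "i = owner G v" and nego: "nego G lam v \<le> ereal c"
  obtains R pr f x where "v \<in> R" "certificate G i lam c R pr f x"
proof -
  let ?V = "verts G"
  define cs where "cs n = c + 1 / real (Suc n)" for n
  have cs: "c < cs n" "cs n \<le> c + 1" for n by (auto simp: cs_def)
  have cslim: "cs \<longlonglongrightarrow> c"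
  proof -
    have "(\<lambda>n. c + 1 / real (Suc n)) \<longlonglongrightarrow> c + 0" by (intro tendsto_intros LIMSEQ_Suc[OF lim_const_over_n])
    then show ?thesis by (simp add: cs_def[abs_def])
  qed
  obtain W0 where W0: "W0 \<ge> 0" "\<And>e. e \<in> edges G \<Longrightarrow> \<bar>rew G i e\<bar> \<le> W0"
    using finite_weight_bound[OF finite_edges[OF wf], of "rew G i"] by blast
  define W where "W = W0 + \<bar>c\<bar> + 1"
  have W: "W \<ge> 0" "\<bar>rew G i e - cs n\<bar> \<le> W" if "e \<in> edges G" for e n
    using W0(1) W0(2)[OF that] cs[of n] unfolding W_def by linarith+
  have W': "W \<ge> 0" using W0(1) unfolding W_def by linarith
  define Fb where "Fb = real (card ?V) * (real (card ?V + 1) * W)"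
  \<comment> \<open>Fixes the choice outside the region, so that there are only finitely many pairs
    of a region and a choice of proposals.\<close>
  define d0 :: proposal where "d0 = ([], 0, {}, {})"
  have "\<exists>R pr f x. v \<in> R \<and> certificate G i lam (cs n) R pr f x \<and> (\<forall>w\<in>R. \<bar>f w\<bar> \<le> Fb) \<and> (\<forall>w. w \<notin> R \<longrightarrow> pr w = d0)" for n
  proof -
    have less: "nego G lam v < ereal (cs n)" using nego cs(1)[of n] by (meson ereal_less_eq(3) less_ereal.simps(1) order_le_less_trans)
    obtain R pr f x where a: "v \<in> R" "certificate G i lam (cs n) R pr f x" "\<And>w. w \<in> R \<Longrightarrow> \<bar>f w\<bar> \<le> real (card ?V) * (real (card ?V + 1) * W)"
      by (rule certificate_if_nego_less[OF wf v i less W' W(2)], simp, rule that)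
    have "certificate G i lam (cs n) R (\<lambda>w. if w \<in> R then pr w else d0) f x" using a(2) by (simp add: certificate_def)
    then show ?thesis using a unfolding Fb_def by (intro exI[of _ R] exI[of _ "\<lambda>w. if w \<in> R then pr w else d0"] exI[of _ f] exI[of _ x]) simp
  qed
  then obtain Rs prs fs xs where s: "\<And>n. v \<in> Rs n" "\<And>n. certificate G i lam (cs n) (Rs n) (prs n) (fs n) (xs n)"
    "\<And>n w. w \<in> Rs n \<Longrightarrow> \<bar>fs n w\<bar> \<le> Fb" "\<And>n w. w \<notin> Rs n \<Longrightarrow> prs n w = d0" by metis
  have RsV: "Rs n \<subseteq> ?V" for n using s(2)[of n] by (simp add: certificate_def)
  have fV: "finite ?V" using wf by (simp add: wf_game_def)
  define PR where "PR = insert d0 {pr. \<exists>w R. proposal_ok G i R w pr}"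
  let ?FS = "{h. \<forall>w. (w \<in> ?V \<longrightarrow> h w \<in> PR) \<and> (w \<notin> ?V \<longrightarrow> h w = d0)}"
  have fFS: "finite ?FS" using fV finite_proposals[OF wf] by (intro finite_set_of_finite_funs) (auto simp: PR_def)
  have rng: "range (\<lambda>n. (Rs n, prs n)) \<subseteq> Pow ?V \<times> ?FS"
  proof -
    have "prs n w \<in> PR" for n w using s(2)[of n] s(4)[of w n] unfolding certificate_def PR_def by (cases "w \<in> Rs n") auto
    then show ?thesis using RsV s(4) by fastforce
  qed
  have "finite (range (\<lambda>n. (Rs n, prs n)))" by (rule finite_subset[OF rng]) (use fV fFS in simp)
  then obtain n0 where inf: "infinite {n. (Rs n, prs n) = (Rs n0, prs n0)}"
    using pigeonhole_infinite[of UNIV "\<lambda>n. (Rs n, prs n)"] by auto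
  define R where "R = Rs n0"
  define pr where "pr = prs n0"
  obtain r :: "nat \<Rightarrow> nat" where r: "strict_mono r" "\<And>n. Rs (r n) = R \<and> prs (r n) = pr"
    using infinite_enumerate[OF inf] unfolding R_def pr_def by auto
  have cert: "certificate G i lam (cs (r n)) R pr (fs (r n)) (xs (r n))" for n using s(2)[of "r n"] r(2)[of n] by simp
  have fR: "finite R" using RsV fV finite_subset unfolding R_def by blast
  define Kof where "Kof w = snd (snd (snd (pr w)))" for w
  have circ: "circulation G (Kof w) (xs (r n) w)" if "w \<in> R" for n w
  proof -
    obtain p k T K where "pr w = (p, k, T, K)" by (cases "pr w")
    then show ?thesis using cert[of n] that by (auto simp: certificate_def flow_ok_def Kof_def)
  qed
  \<comment> \<open>All potentials and flows form one finite family, so that a single subsequence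
    makes all of them converge.\<close>
  define A where "A = Inl ` R \<union> Inr ` (SIGMA w:R. inner_edges G (Kof w))"
  define y where "y n a = (case a of Inl w \<Rightarrow> fs (r n) w | Inr (w, e) \<Rightarrow> xs (r n) w e)" for n and a :: "nat + nat \<times> nat \<times> nat"
  have fA: "finite A" unfolding A_def using fR finite_inner_edges[OF wf] by auto
  have yb: "\<bar>y n a\<bar> \<le> Fb + 1" if "a \<in> A" for a n
  proof -
    have Fb0: "Fb \<ge> 0" using W' by (simp add: Fb_def)
    consider w where "w \<in> R" "a = Inl w" | w e where "w \<in> R" "e \<in> inner_edges G (Kof w)" "a = Inr (w, e)"
      using \<open>a \<in> A\<close> by (auto simp: A_def)
    then show ?thesis
    proof cases
      case 1
      then show ?thesis using s(3)[of w "r n"] r(2)[of n] by (simp add: y_def)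
    next
      case 2
      have c: "\<forall>e\<in>inner_edges G (Kof w). 0 \<le> xs (r n) w e" "(\<Sum>e\<in>inner_edges G (Kof w). xs (r n) w e) = 1"
        using circ[OF 2(1)] by (auto simp: circulation_def)
      have "xs (r n) w e \<le> (\<Sum>e\<in>inner_edges G (Kof w). xs (r n) w e)"
        using 2(2) c(1) finite_inner_edges[OF wf] by (intro member_le_sum) auto
      then show ?thesis using c 2 Fb0 by (simp add: y_def)
    qed
  qed
  obtain \<phi> :: "nat \<Rightarrow> nat" and l where l: "strict_mono \<phi>" "\<And>a. a \<in> A \<Longrightarrow> (\<lambda>n. y (\<phi> n) a) \<longlonglongrightarrow> l a"
    using finite_common_subseq[OF fA, of y "Fb + 1"] yb by blast
  define q where "q = r \<circ> \<phi>"
  define f where "f w = l (Inl w)" for w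
  define x where "x w e = l (Inr (w, e))" for w e
  have flim: "(\<lambda>n. fs (q n) w) \<longlonglongrightarrow> f w" if "w \<in> R" for w
    using l(2)[of "Inl w"] that by (simp add: A_def y_def q_def f_def)
  have xlim: "(\<lambda>n. xs (q n) w e) \<longlonglongrightarrow> x w e" if "w \<in> R" "e \<in> inner_edges G (Kof w)" for w e
    using l(2)[of "Inr (w, e)"] that by (simp add: A_def y_def q_def x_def)
  have clim: "(\<lambda>n. cs (q n)) \<longlonglongrightarrow> c"
    using LIMSEQ_subseq_LIMSEQ[OF cslim, of q] r(1) l(1) strict_mono_o[of r \<phi>] by (simp add: q_def o_def)
  have certq: "certificate G i lam (cs (q n)) R pr (fs (q n)) (xs (q n))" for n using cert by (simp add: q_def)
  have wlim: "(\<lambda>n. wsum (\<lambda>e. rew G i e - cs (q n)) (L @ [b])) \<longlonglongrightarrow> wsum (\<lambda>e. rew G i e - c) (L @ [b])" for L b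
    unfolding wsum_diff wsum_const by (intro tendsto_intros clim)
  have flowlim: "(\<lambda>n. flow_value G (Kof w) (xs (q n) w) j) \<longlonglongrightarrow> flow_value G (Kof w) (x w) j" if "w \<in> R" for w j
    unfolding flow_value_def using xlim[OF that] by (intro tendsto_intros)
  have "proposal_ok G i R w (pr w) \<and> cycle_ok G i c (pr w) \<and> flow_ok G i lam c (x w) (pr w) \<and> pot_ok G i c f w (pr w)"
    if w: "w \<in> R" for w
  proof -
    obtain p k T K where p4: "pr w = (p, k, T, K)" by (cases "pr w")
    have K: "Kof w = K" by (simp add: Kof_def p4)
    have n: "proposal_ok G i R w (pr w)" "cycle_ok G i (cs (q n)) (pr w)" "flow_ok G i lam (cs (q n)) (xs (q n) w) (pr w)"
      "pot_ok G i (cs (q n)) (fs (q n)) w (pr w)" for n using certq[of n] w by (auto simp: certificate_def)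
    have "cycle_ok G i c (pr w)"
      unfolding cycle_ok_def p4 prod.case
      by (rule LIMSEQ_le_const2[OF wlim]) (use n(2) in \<open>auto simp: cycle_ok_def p4\<close>)
    moreover have "pot_ok G i c f w (pr w)"
      unfolding pot_ok_def p4 prod.case
    proof (intro allI impI)
      fix m w' assume m: "m < length p" "owner G (p ! m) = i" "(p ! m, w') \<in> edges G"
      have "p ! m \<in> T" using n(1) m(1) by (auto simp: proposal_ok_def p4)
      then have "w' \<in> R" using n(1) m unfolding proposal_ok_def p4 by blast
      have "(\<lambda>n. wsum (\<lambda>e. rew G i e - cs (q n)) (take (Suc m) p @ [w']) + fs (q n) w') \<longlonglongrightarrow>
         wsum (\<lambda>e. rew G i e - c) (take (Suc m) p @ [w']) + f w'"
        by (intro tendsto_add wlim flim \<open>w' \<in> R\<close>)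
      then show "wsum (\<lambda>e. rew G i e - c) (take (Suc m) p @ [w']) + f w' \<le> f w"
        using flim[OF w] by (rule LIMSEQ_le) (use n(4) m in \<open>auto simp: pot_ok_def p4\<close>)
    qed
    moreover have "flow_ok G i lam c (x w) (pr w)"
    proof -
      have nf: "circulation G K (xs (q n) w)" "\<And>t. t \<in> T \<Longrightarrow> lam t \<le> ereal (flow_value G K (xs (q n) w) (owner G t))"
        "flow_value G K (xs (q n) w) i \<le> cs (q n)" for n using n(3)[of n] by (auto simp: flow_ok_def p4)
      note xl = xlim[OF w, unfolded K]
      have "0 \<le> x w e" if "e \<in> inner_edges G K" for e
        by (rule LIMSEQ_le_const[OF xl[OF that]]) (use nf(1) that in \<open>auto simp: circulation_def\<close>)
      moreover have "(\<Sum>e\<in>inner_edges G K. x w e) = 1"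
      proof -
        have "(\<lambda>n. \<Sum>e\<in>inner_edges G K. xs (q n) w e) \<longlonglongrightarrow> (\<Sum>e\<in>inner_edges G K. x w e)" using xl by (intro tendsto_intros)
        moreover have "(\<Sum>e\<in>inner_edges G K. xs (q n) w e) = 1" for n using nf(1) by (simp add: circulation_def)
        ultimately have "(\<lambda>n. 1) \<longlonglongrightarrow> (\<Sum>e\<in>inner_edges G K. x w e)" by simp
        then show ?thesis by (metis LIMSEQ_const_iff)
      qed
      moreover have "(\<Sum>e\<in>{e \<in> inner_edges G K. fst e = u}. x w e) = (\<Sum>e\<in>{e \<in> inner_edges G K. snd e = u}. x w e)" if "u \<in> K" for u
      proof -
        have lim: "(\<lambda>n. \<Sum>e\<in>{e \<in> inner_edges G K. Q e}. xs (q n) w e) \<longlonglongrightarrow> (\<Sum>e\<in>{e \<in> inner_edges G K. Q e}. x w e)" for Q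
          by (rule tendsto_sum) (use xl in simp)
        have "(\<Sum>e\<in>{e \<in> inner_edges G K. fst e = u}. xs (q n) w e) = (\<Sum>e\<in>{e \<in> inner_edges G K. snd e = u}. xs (q n) w e)" for n
          using nf(1)[of n] that unfolding circulation_def by blast
        then show ?thesis using LIMSEQ_unique[OF lim[of "\<lambda>e. fst e = u"]] lim[of "\<lambda>e. snd e = u"] by simp
      qed
      moreover have "lam t \<le> ereal (flow_value G K (x w) (owner G t))" if "t \<in> T" for t
      proof (rule LIMSEQ_le_const)
        show "(\<lambda>n. ereal (flow_value G K (xs (q n) w) (owner G t))) \<longlonglongrightarrow> ereal (flow_value G K (x w) (owner G t))"
          using flowlim[OF w] unfolding K by simp
      qed (use nf(2)[OF that] in auto)
      moreover have "flow_value G K (x w) i \<le> c"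
        using flowlim[OF w] clim unfolding K by (rule LIMSEQ_le) (use nf(3) in auto)
      ultimately show ?thesis by (simp add: flow_ok_def p4 circulation_def)
    qed
    ultimately show ?thesis using n(1) by blast
  qed
  then have "certificate G i lam c R pr f x" using RsV[of n0] by (simp add: certificate_def R_def)
  then show ?thesis using that[of R] s(1)[of n0] by (simp add: R_def)
qed

section \<open>Coordinates determined by a linear system\<close>

lemma sum_fun_apply: "(\<Sum>i\<in>I. f i) x = (\<Sum>i\<in>I. f i x :: 'a :: comm_monoid_add)"
  by (induction I rule: infinite_finite_induct) auto

lemma card_PiE_const: "finite I \<Longrightarrow> card (I \<rightarrow>\<^sub>E X) = card X ^ card I"
  by (simp add: card_PiE)

text \<open>By the pigeonhole principle there is a small integer relation between a unit vector and a basis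
  that extends one of the row space; this replaces Cramer's rule.\<close>

lemma determined_coordinate_small:
  fixes I :: "'i set" and rows :: "('i \<Rightarrow> real) set" and y :: "'i \<Rightarrow> real" and M :: nat
  assumes fI: "finite I" and k: "k \<in> I" and M: "M \<ge> 1"
    and rowI: "\<And>r i. r \<in> rows \<Longrightarrow> i \<notin> I \<Longrightarrow> r i = 0"
    and rowM: "\<And>r i. r \<in> rows \<Longrightarrow> \<exists>a::int. r i = of_int a \<and> \<bar>a\<bar> \<le> int M"
    and rowy: "\<And>r. r \<in> rows \<Longrightarrow> \<exists>b::int. \<bar>b\<bar> \<le> int M \<and> (\<Sum>i\<in>I. r i * y i) = of_int b"
    and det: "\<And>z. (\<And>r. r \<in> rows \<Longrightarrow> (\<Sum>i\<in>I. r i * z i) = 0) \<Longrightarrow> z k = 0"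
  shows "\<exists>p q::int. q \<noteq> 0 \<and> \<bar>q\<bar> \<le> int ((2 * (card I + 1) * M) ^ card I) \<and>
    \<bar>p\<bar> \<le> int (card I * (2 * (card I + 1) * M) ^ card I * M) \<and> y k = of_int p / of_int q"
proof -
  define N where "N = card I"
  \<comment> \<open>A coordinate of a combination with coefficients in \<open>0..Q\<close> takes at
    most \<open>D * (Q + 1)\<close> values. With \<open>Q = D ^ N\<close>, the
    \<open>(Q + 1) ^ (N + 1)\<close> combinations outnumber the at most
    \<open>(D * (Q + 1)) ^ N = Q * (Q + 1) ^ N\<close> results.\<close>
  define D where "D = 2 * (N + 1) * M"
  define Q where "Q = D ^ N"
  interpret fv: vector_space "\<lambda>r (f :: 'i \<Rightarrow> real). (\<lambda>i. r * f i)"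
    by unfold_locales (auto simp: fun_eq_iff algebra_simps)
  define u :: "'i \<Rightarrow> 'i \<Rightarrow> real" where "u j i = of_bool (i = j)" for j i
  have usum: "(\<Sum>i\<in>I. c i * u i j) = (if j \<in> I then c j else 0)" for c j
    using fI by (simp add: u_def if_distrib cong: if_cong)
  have usum': "(\<Sum>i\<in>I. (\<lambda>j. c i * u i j)) = (\<lambda>j. if j \<in> I then c j else 0)" for c
    by (rule ext) (simp add: sum_fun_apply usum)
  have inj_u: "inj_on u I" by (auto simp: inj_on_def u_def fun_eq_iff)
  have card_u: "card (u ` I) = N" using card_image[OF inj_u] by (simp add: N_def)
  obtain B0 where B0: "B0 \<subseteq> rows" "fv.independent B0" "rows \<subseteq> fv.span B0"
    using fv.maximal_independent_subset by blast
  have supp_span: "w \<in> fv.span (u ` I)" if "\<And>i. i \<notin> I \<Longrightarrow> w i = 0" for w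
  proof -
    have "w = (\<Sum>i\<in>I. (\<lambda>j. w i * u i j))" unfolding usum' using that by auto
    also have "\<dots> \<in> fv.span (u ` I)" by (intro fv.span_sum fv.span_scale fv.span_base) auto
    finally show ?thesis .
  qed
  \<comment> \<open>Otherwise \<open>B0\<close> together with \<open>u k\<close> extends to a basis,
    and the coordinate along \<open>u k\<close> is a functional that vanishes on all rows but not on
    \<open>u k\<close>, contradicting \<open>det\<close>.\<close>
  have ukB0: "u k \<in> fv.span B0"
  proof (rule ccontr)
    assume nk: "u k \<notin> fv.span B0"
    then have ind: "fv.independent (insert (u k) B0)" using B0(2) by (intro fv.independent_insertI)
    define B where "B = fv.extend_basis (insert (u k) B0)"
    have B: "insert (u k) B0 \<subseteq> B" "fv.independent B" "fv.span B = UNIV"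
      unfolding B_def using ind fv.extend_basis_superset fv.independent_extend_basis fv.span_extend_basis by blast+
    define z where "z i = fv.representation B (u i) (u k)" for i
    have rep: "fv.representation B w (u k) = (\<Sum>i\<in>I. w i * z i)" if "\<And>i. i \<notin> I \<Longrightarrow> w i = 0" for w
    proof -
      have "w = (\<Sum>i\<in>I. (\<lambda>j. w i * u i j))" unfolding usum' using that by auto
      then have "fv.representation B w (u k) = fv.representation B (\<Sum>i\<in>I. (\<lambda>j. w i * u i j)) (u k)" by simp
      also have "\<dots> = (\<Sum>i\<in>I. w i * z i)"
        using B(2,3) by (simp add: fv.representation_sum fv.representation_scale z_def)
      finally show ?thesis .
    qed
    have "z k = 0"
    proof (rule det)
      fix r assume r: "r \<in> rows"
      have "fv.representation B r = fv.representation B0 r"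
        using B B0 r by (intro fv.representation_extend) auto
      moreover have "fv.representation B0 r (u k) = 0"
        using fv.representation_ne_zero[of B0 r "u k"] nk fv.span_base by blast
      ultimately show "(\<Sum>i\<in>I. r i * z i) = 0" using rep[of r] rowI[OF r] by simp
    qed
    moreover have "z k = 1" using B by (simp add: z_def fv.representation_basis)
    ultimately show False by simp
  qed
  \<comment> \<open>The basis of the row space is completed by unit vectors, so all entries remain
    integers bounded by \<open>M\<close>.\<close>
  obtain B where B: "B0 \<subseteq> B" "B \<subseteq> B0 \<union> u ` I" "fv.independent B" "B0 \<union> u ` I \<subseteq> fv.span B"
    using fv.maximal_independent_subset_extend[of B0 "B0 \<union> u ` I"] B0(2) by blast
  have BI: "b i = 0" if "b \<in> B" "i \<notin> I" for b i
  proof -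
    have "b \<in> rows \<or> b \<in> u ` I" using that(1) B(2) B0(1) by blast
    then show ?thesis using rowI that(2) by (auto simp: u_def)
  qed
  have "B \<subseteq> fv.span (u ` I)" using supp_span BI by blast
  then have fB: "finite B" and cB1: "card B \<le> N"
    using fv.independent_span_bound[OF _ B(3), of "u ` I"] fI card_u by auto
  have "fv.independent (u ` I)"
  proof -
    have "c v = 0" if s: "(\<Sum>v\<in>u ` I. (\<lambda>i. c v * v i)) = 0" and v: "v \<in> u ` I" for c v
    proof -
      have "(\<Sum>i\<in>I. (\<lambda>j. c (u i) * u i j)) = 0" using s inj_u by (simp add: sum.reindex)
      then have z: "(\<lambda>j. if j \<in> I then c (u j) else 0) = 0" unfolding usum' .
      obtain j where "v = u j" "j \<in> I" using v by blast
      then show ?thesis using fun_cong[OF z, of j] by simp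
    qed
    then show ?thesis using fI fv.dependent_finite[of "u ` I"] by auto
  qed
  then have cB: "card B = N"
    using fv.independent_span_bound[OF fB, of "u ` I"] B(4) card_u cB1 by auto
  have bM: "\<exists>a::int. b i = of_int a \<and> \<bar>a\<bar> \<le> int M" if bB: "b \<in> insert (u k) B" for b i
  proof (cases "b \<in> rows")
    case False
    then obtain j where "b = u j" using bB B(2) B0(1) by blast
    then show ?thesis using M by (intro exI[of _ "of_bool (i = j)"]) (auto simp: u_def)
  qed (use rowM in blast)
  \<comment> \<open>\<open>None\<close> indexes \<open>u k\<close>, which may itself lie in
    \<open>B\<close>; keeping the two apart always gives \<open>N + 1\<close> vectors.\<close>
  define vec where "vec o' = (case o' of None \<Rightarrow> u k | Some b \<Rightarrow> b)" for o' :: "('i \<Rightarrow> real) option"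
  define J where "J = insert None (Some ` B)"
  have fJ: "finite J" and cJ: "card J = N + 1"
    using fB cB by (auto simp: J_def card_image)
  have vecM: "\<exists>a::int. vec j i = of_int a \<and> \<bar>a\<bar> \<le> int M" if "j \<in> J" for j i
    using that bM by (auto simp: J_def vec_def)
  define comb where "comb c = (\<lambda>i\<in>I. \<Sum>j\<in>J. of_int (c j) * vec j i)" for c :: "('i \<Rightarrow> real) option \<Rightarrow> int"
  let ?dom = "J \<rightarrow>\<^sub>E {0..int Q}"
  let ?R = "int ((N + 1) * M * Q)"
  let ?cod = "I \<rightarrow>\<^sub>E (real_of_int ` {- ?R..?R})"
  have "comb ` ?dom \<subseteq> ?cod"
  proof
    fix f assume "f \<in> comb ` ?dom"
    then obtain c where c: "c \<in> ?dom" "f = comb c" by blast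
    obtain a where a: "\<And>j i. j \<in> J \<Longrightarrow> vec j i = of_int (a j i) \<and> \<bar>a j i\<bar> \<le> int M" using vecM by metis
    have "f i \<in> real_of_int ` {- ?R..?R}" if "i \<in> I" for i
    proof
      show "f i = real_of_int (\<Sum>j\<in>J. c j * a j i)" using that a by (simp add: c(2) comb_def)
      have "\<bar>\<Sum>j\<in>J. c j * a j i\<bar> \<le> (\<Sum>j\<in>J. \<bar>c j * a j i\<bar>)" by (rule sum_abs)
      also have "\<dots> \<le> (\<Sum>j\<in>J. int Q * int M)"
      proof (rule sum_mono)
        fix j assume j: "j \<in> J"
        then have "c j \<in> {0..int Q}" using c(1) by auto
        then show "\<bar>c j * a j i\<bar> \<le> int Q * int M" using a[OF j] unfolding abs_mult by (intro mult_mono) auto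
      qed
      also have "\<dots> = ?R" using cJ by (simp add: algebra_simps)
      finally show "(\<Sum>j\<in>J. c j * a j i) \<in> {- ?R..?R}" by (simp add: abs_le_iff)
    qed
    then show "f \<in> ?cod" by (auto simp: c(2) comb_def)
  qed
  then have "card (comb ` ?dom) \<le> card ?cod"
    using fI by (intro card_mono finite_PiE) auto
  also have "card ?cod = (2 * ((N + 1) * M * Q) + 1) ^ N"
  proof -
    have "card (real_of_int ` {- ?R..?R}) = 2 * ((N + 1) * M * Q) + 1"
      by (subst card_image) (auto simp: inj_on_def simp del: of_nat_mult)
    then show ?thesis using fI by (simp only: card_PiE_const N_def)
  qed
  also have "\<dots> \<le> (D * (Q + 1)) ^ N"
  proof (rule power_mono)
    have "2 * ((N + 1) * M * Q) + 1 \<le> D * Q + D" using M by (simp add: D_def algebra_simps)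
    then show "2 * ((N + 1) * M * Q) + 1 \<le> D * (Q + 1)" by (simp add: algebra_simps)
  qed simp
  also have "\<dots> = Q * (Q + 1) ^ N" unfolding power_mult_distrib Q_def ..
  also have "\<dots> < (Q + 1) ^ (N + 1)" by simp
  also have "\<dots> = card ?dom" unfolding card_PiE_const[OF fJ] cJ by (simp add: nat_add_distrib)
  finally have "\<not> inj_on comb ?dom" by (rule pigeonhole)
  then obtain c c' where cc: "c \<in> ?dom" "c' \<in> ?dom" "c \<noteq> c'" "comb c = comb c'" by (auto simp: inj_on_def)
  define d where "d j = c j - c' j" for j
  have dQ: "\<bar>d j\<bar> \<le> int Q" if "j \<in> J" for j
  proof -
    have "c j \<in> {0..int Q}" "c' j \<in> {0..int Q}" using that cc by auto
    then show ?thesis by (auto simp: d_def)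
  qed
  have d0: "\<exists>j\<in>J. d j \<noteq> 0"
  proof (rule ccontr)
    assume "\<not> ?thesis"
    then have "c = c'" using PiE_ext[OF cc(1,2)] by (auto simp: d_def)
    then show False using cc(3) by simp
  qed
  have rel: "of_int (d None) * u k i + (\<Sum>b\<in>B. of_int (d (Some b)) * b i) = 0" for i
  proof (cases "i \<in> I")
    case True
    have "(\<Sum>j\<in>J. of_int (c j) * vec j i) = (\<Sum>j\<in>J. of_int (c' j) * vec j i)"
      using fun_cong[OF cc(4), of i] True by (simp add: comb_def)
    then have "(\<Sum>j\<in>J. of_int (d j) * vec j i) = 0" by (simp add: d_def algebra_simps sum_subtractf)
    then show ?thesis using fB by (simp add: J_def vec_def sum.reindex)
  next
    case False
    then have "(\<Sum>b\<in>B. real_of_int (d (Some b)) * b i) = 0" using BI by (intro sum.neutral) auto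
    moreover have "u k i = 0" using False k by (auto simp: u_def)
    ultimately show ?thesis by simp
  qed
  obtain \<beta> where \<beta>: "u k = (\<Sum>b\<in>B0. (\<lambda>i. \<beta> b * b i))"
    using ukB0 fv.span_finite[of B0] finite_subset[OF B(1) fB] by auto
  have indB: "\<gamma> b = 0" if "\<And>i. (\<Sum>b\<in>B. \<gamma> b * b i) = 0" "b \<in> B" for \<gamma> b
    using fv.independentD[OF B(3) fB, of \<gamma> b] that by (simp add: fun_eq_iff sum_fun_apply)
  have q0: "d None \<noteq> 0"
  proof
    assume "d None = 0"
    then have "(\<Sum>b\<in>B. of_int (d (Some b)) * b i) = 0" for i using rel[of i] by simp
    then have "of_int (d (Some b)) = (0::real)" if "b \<in> B" for b using indB[of "\<lambda>b. of_int (d (Some b))" b] that by simp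
    then show False using d0 \<open>d None = 0\<close> by (auto simp: J_def)
  qed
  \<comment> \<open>As \<open>u k\<close> lies in the span of \<open>B0\<close>, independence of
    \<open>B\<close> leaves only rows in the relation; pairing the relation with \<open>y\<close>
    then expresses \<open>y k\<close> by the integer values of the rows at \<open>y\<close>.\<close>
  have dout: "d (Some b) = 0" if b: "b \<in> B" "b \<notin> B0" for b
  proof -
    let ?g = "\<lambda>b. of_int (d None) * (if b \<in> B0 then \<beta> b else 0) + of_int (d (Some b))"
    have "(\<Sum>b\<in>B. ?g b * b i) = 0" for i
    proof -
      have "(\<Sum>b\<in>B. (if b \<in> B0 then \<beta> b else 0) * b i) = (\<Sum>b\<in>B0. \<beta> b * b i)"
        using fB B(1) by (intro sum.mono_neutral_cong_right) auto
      also have "\<dots> = u k i" using fun_cong[OF \<beta>, of i] by (simp add: sum_fun_apply)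
      finally have "(\<Sum>b\<in>B. (if b \<in> B0 then \<beta> b else 0) * b i) = u k i" .
      moreover have "(\<Sum>b\<in>B. ?g b * b i) = of_int (d None) * (\<Sum>b\<in>B. (if b \<in> B0 then \<beta> b else 0) * b i) +
          (\<Sum>b\<in>B. of_int (d (Some b)) * b i)"
        by (simp only: sum_distrib_left sum.distrib distrib_right mult.assoc)
      ultimately show ?thesis using rel[of i] by simp
    qed
    then have "?g b = 0" using indB[of ?g b] b by blast
    then show ?thesis using b by simp
  qed
  have "(\<Sum>i\<in>I. (of_int (d None) * u k i + (\<Sum>b\<in>B. of_int (d (Some b)) * b i)) * y i) = 0"
    using rel by simp
  then have "of_int (d None) * y k + (\<Sum>b\<in>B. of_int (d (Some b)) * (\<Sum>i\<in>I. b i * y i)) = 0"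
  proof -
    have "(\<Sum>i\<in>I. (of_int (d None) * u k i + (\<Sum>b\<in>B. of_int (d (Some b)) * b i)) * y i) =
      of_int (d None) * (\<Sum>i\<in>I. u k i * y i) + (\<Sum>i\<in>I. \<Sum>b\<in>B. of_int (d (Some b)) * (b i * y i))"
      by (simp add: algebra_simps sum.distrib sum_distrib_left sum_distrib_right)
    also have "(\<Sum>i\<in>I. u k i * y i) = y k" using fI k by (simp add: u_def if_distrib cong: if_cong)
    also have "(\<Sum>i\<in>I. \<Sum>b\<in>B. of_int (d (Some b)) * (b i * y i)) = (\<Sum>b\<in>B. of_int (d (Some b)) * (\<Sum>i\<in>I. b i * y i))"
      by (subst sum.swap) (simp add: sum_distrib_left)
    finally show ?thesis using \<open>(\<Sum>i\<in>I. _ i * y i) = 0\<close> by simp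
  qed
  moreover obtain \<eta> where \<eta>: "\<And>b. b \<in> B0 \<Longrightarrow> \<bar>\<eta> b\<bar> \<le> int M \<and> (\<Sum>i\<in>I. b i * y i) = of_int (\<eta> b)"
    using rowy B0(1) by (metis subsetD)
  moreover have "(\<Sum>b\<in>B. of_int (d (Some b)) * (\<Sum>i\<in>I. b i * y i)) = (\<Sum>b\<in>B0. of_int (d (Some b)) * (\<Sum>i\<in>I. b i * y i))"
    using fB B(1) dout by (intro sum.mono_neutral_right) auto
  ultimately have "of_int (d None) * y k = of_int (- (\<Sum>b\<in>B0. d (Some b) * \<eta> b))" by simp
  then have yk: "y k = of_int (- (\<Sum>b\<in>B0. d (Some b) * \<eta> b)) / of_int (d None)" using q0 by (simp add: field_simps)
  have "\<bar>- (\<Sum>b\<in>B0. d (Some b) * \<eta> b)\<bar> \<le> (\<Sum>b\<in>B0. \<bar>d (Some b) * \<eta> b\<bar>)" using sum_abs by simp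
  also have "\<dots> \<le> (\<Sum>b\<in>B0. int Q * int M)"
  proof (rule sum_mono)
    fix b assume b: "b \<in> B0"
    then have "\<bar>d (Some b)\<bar> \<le> int Q" using B(1) by (intro dQ) (auto simp: J_def)
    then show "\<bar>d (Some b) * \<eta> b\<bar> \<le> int Q * int M" using \<eta>[OF b] unfolding abs_mult by (intro mult_mono) auto
  qed
  also have "\<dots> = int (card B0) * (int Q * int M)" by simp
  also have "\<dots> \<le> int N * (int Q * int M)" using card_mono[OF fB B(1)] cB by (intro mult_right_mono) auto
  finally have "\<bar>- (\<Sum>b\<in>B0. d (Some b) * \<eta> b)\<bar> \<le> int (N * Q * M)" by (simp add: mult.assoc)
  moreover have "\<bar>d None\<bar> \<le> int Q" by (rule dQ) (simp add: J_def)
  ultimately show ?thesis using yk q0 unfolding Q_def D_def N_def by blast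
qed

section \<open>Least solutions of linear inequalities\<close>

text \<open>The factor \<open>D\<close> is a common denominator of all coefficients.\<close>

definition affine_int :: "'i set \<Rightarrow> nat \<Rightarrow> nat \<Rightarrow> (('i \<Rightarrow> real) \<Rightarrow> real) \<Rightarrow> bool" where
  "affine_int I D M \<phi> \<longleftrightarrow> (\<exists>a b. (\<forall>i\<in>I. \<bar>a i\<bar> \<le> int M) \<and> \<bar>b\<bar> \<le> int M \<and>
     (\<forall>y. real D * \<phi> y = (\<Sum>i\<in>I. of_int (a i) * y i) + of_int b))"

definition lin_system :: "'i set \<Rightarrow> nat \<Rightarrow> nat \<Rightarrow> (('i \<Rightarrow> real) \<Rightarrow> bool) \<Rightarrow> bool" where
  "lin_system I D M S \<longleftrightarrow> (\<exists>\<Phi>. finite \<Phi> \<and> (\<forall>\<phi>\<in>\<Phi>. affine_int I D M \<phi>) \<and> (\<forall>y. S y \<longleftrightarrow> (\<forall>\<phi>\<in>\<Phi>. 0 \<le> \<phi> y)))"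

section \<open>Rules for bounded affine forms and their systems\<close>

lemma affine_int_mono: "affine_int I D M \<phi> \<Longrightarrow> M \<le> M' \<Longrightarrow> affine_int I D M' \<phi>"
  unfolding affine_int_def by (meson of_nat_mono order_trans)

lemma affine_int_const: "real D * r = of_int b \<Longrightarrow> \<bar>b\<bar> \<le> int M \<Longrightarrow> affine_int I D M (\<lambda>_. r)"
  unfolding affine_int_def by (intro exI[of _ "\<lambda>_. 0"] exI[of _ b]) auto

lemma affine_int_var:
  assumes "finite I" "i \<in> I" "real D * r = of_int b" "\<bar>b\<bar> \<le> int M"
  shows "affine_int I D M (\<lambda>y. r * y i)"
proof -
  have "real D * (r * y i) = (\<Sum>j\<in>I. of_int (if j = i then b else 0) * y j)" for y
  proof -
    have "(\<Sum>j\<in>I. of_int (if j = i then b else 0) * y j) = (\<Sum>j\<in>I. if j = i then of_int b * y j else 0)"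
      by (rule sum.cong) auto
    then show ?thesis using assms(1,2) by (simp add: assms(3)[symmetric])
  qed
  then show ?thesis unfolding affine_int_def using assms(4)
    by (intro exI[of _ "\<lambda>j. if j = i then b else 0"] exI[of _ 0]) auto
qed

lemma affine_int_add:
  assumes "affine_int I D M1 \<phi>" "affine_int I D M2 \<psi>"
  shows "affine_int I D (M1 + M2) (\<lambda>y. \<phi> y + \<psi> y)"
proof -
  obtain a b where 1: "\<And>i. i \<in> I \<Longrightarrow> \<bar>a i\<bar> \<le> int M1" "\<bar>b\<bar> \<le> int M1"
    "\<And>y. real D * \<phi> y = (\<Sum>i\<in>I. of_int (a i) * y i) + of_int b" using assms(1) unfolding affine_int_def by blast
  obtain a' b' where 2: "\<And>i. i \<in> I \<Longrightarrow> \<bar>a' i\<bar> \<le> int M2" "\<bar>b'\<bar> \<le> int M2"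
    "\<And>y. real D * \<psi> y = (\<Sum>i\<in>I. of_int (a' i) * y i) + of_int b'" using assms(2) unfolding affine_int_def by blast
  have "\<bar>a i + a' i\<bar> \<le> int (M1 + M2)" if "i \<in> I" for i using 1(1)[OF that] 2(1)[OF that] by simp
  moreover have "\<bar>b + b'\<bar> \<le> int (M1 + M2)" using 1(2) 2(2) by simp
  moreover have "real D * (\<phi> y + \<psi> y) = (\<Sum>i\<in>I. of_int (a i + a' i) * y i) + of_int (b + b')" for y
    using 1(3)[of y] 2(3)[of y] by (simp add: distrib_left distrib_right sum.distrib)
  ultimately show ?thesis unfolding affine_int_def by (intro exI[of _ "\<lambda>i. a i + a' i"] exI[of _ "b + b'"]) blast
qed

lemma affine_int_scale:
  assumes "affine_int I D M \<phi>"
  shows "affine_int I D (nat \<bar>m\<bar> * M) (\<lambda>y. of_int m * \<phi> y)"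
proof -
  obtain a b where 1: "\<And>i. i \<in> I \<Longrightarrow> \<bar>a i\<bar> \<le> int M" "\<bar>b\<bar> \<le> int M"
    "\<And>y. real D * \<phi> y = (\<Sum>i\<in>I. of_int (a i) * y i) + of_int b" using assms(1) unfolding affine_int_def by blast
  have "\<bar>m * a i\<bar> \<le> int (nat \<bar>m\<bar> * M)" if "i \<in> I" for i using 1(1)[OF that] by (simp add: abs_mult mult_left_mono)
  moreover have "\<bar>m * b\<bar> \<le> int (nat \<bar>m\<bar> * M)" using 1(2) by (simp add: abs_mult mult_left_mono)
  moreover have "real D * (of_int m * \<phi> y) = (\<Sum>i\<in>I. of_int (m * a i) * y i) + of_int (m * b)" for y
  proof -
    have "real D * (of_int m * \<phi> y) = of_int m * (real D * \<phi> y)" by simp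
    then show ?thesis unfolding 1(3) by (simp add: distrib_left sum_distrib_left mult.assoc)
  qed
  ultimately show ?thesis unfolding affine_int_def by (intro exI[of _ "\<lambda>i. m * a i"] exI[of _ "m * b"]) blast
qed

lemma affine_int_diff:
  assumes "affine_int I D M1 \<phi>" "affine_int I D M2 \<psi>"
  shows "affine_int I D (M1 + M2) (\<lambda>y. \<phi> y - \<psi> y)"
  using affine_int_add[OF assms(1) affine_int_scale[OF assms(2), of "- 1"]] by simp

lemma affine_int_sum:
  assumes "finite A" "\<And>e. e \<in> A \<Longrightarrow> affine_int I D M (\<phi> e)"
  shows "affine_int I D (card A * M) (\<lambda>y. \<Sum>e\<in>A. \<phi> e y)"
  using assms
proof (induction A rule: finite_induct)
  case empty
  then show ?case by (auto intro: affine_int_const[where b = 0])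
next
  case (insert x A)
  then show ?case using affine_int_add[of I D M "\<phi> x" "card A * M" "\<lambda>y. \<Sum>e\<in>A. \<phi> e y"] by simp
qed

lemma lin_system_le:
  assumes "affine_int I D M (\<lambda>y. \<psi> y - \<phi> y)"
  shows "lin_system I D M (\<lambda>y. \<phi> y \<le> \<psi> y)"
  unfolding lin_system_def using assms by (intro exI[of _ "{\<lambda>y. \<psi> y - \<phi> y}"]) auto

lemma lin_system_conj:
  assumes "lin_system I D M S" "lin_system I D M S'"
  shows "lin_system I D M (\<lambda>y. S y \<and> S' y)"
proof -
  obtain \<Phi> \<Psi> where "finite \<Phi>" "\<forall>\<phi>\<in>\<Phi>. affine_int I D M \<phi>" "\<forall>y. S y \<longleftrightarrow> (\<forall>\<phi>\<in>\<Phi>. 0 \<le> \<phi> y)"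
    "finite \<Psi>" "\<forall>\<phi>\<in>\<Psi>. affine_int I D M \<phi>" "\<forall>y. S' y \<longleftrightarrow> (\<forall>\<phi>\<in>\<Psi>. 0 \<le> \<phi> y)"
    using assms unfolding lin_system_def by blast
  then show ?thesis unfolding lin_system_def by (intro exI[of _ "\<Phi> \<union> \<Psi>"]) blast
qed

lemma lin_system_eq:
  assumes "affine_int I D M (\<lambda>y. \<psi> y - \<phi> y)"
  shows "lin_system I D M (\<lambda>y. \<phi> y = \<psi> y)"
proof -
  have "affine_int I D M (\<lambda>y. \<phi> y - \<psi> y)" using affine_int_scale[OF assms, of "- 1"] by simp
  then show ?thesis
    using lin_system_conj[OF lin_system_le[OF assms] lin_system_le[of I D M \<phi> \<psi>]] by (simp add: eq_iff)
qed

text \<open>Combinatorial conditions enter the system either as no inequality or as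
  \<open>0 \<le> - 1\<close>, whose scaled constant is \<open>- D\<close>; hence the condition
  \<open>D \<le> M\<close>.\<close>

lemma lin_system_const:
  assumes "D \<le> M"
  shows "lin_system I D M (\<lambda>_. P)"
proof (cases P)
  case True
  then show ?thesis unfolding lin_system_def by (intro exI[of _ "{}"]) auto
next
  case False
  have "affine_int I D M (\<lambda>_. - 1)" by (rule affine_int_const[where b = "- int D"]) (use assms in auto)
  then show ?thesis unfolding lin_system_def using False by (intro exI[of _ "{\<lambda>_. - 1}"]) auto
qed

lemma lin_system_ball:
  assumes "finite A" "\<And>a. a \<in> A \<Longrightarrow> lin_system I D M (S a)"
  shows "lin_system I D M (\<lambda>y. \<forall>a\<in>A. S a y)"
proof -
  obtain \<Phi> where "\<And>a. a \<in> A \<Longrightarrow> finite (\<Phi> a) \<and> (\<forall>\<phi>\<in>\<Phi> a. affine_int I D M \<phi>) \<and> (\<forall>y. S a y \<longleftrightarrow> (\<forall>\<phi>\<in>\<Phi> a. 0 \<le> \<phi> y))"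
    using assms(2) unfolding lin_system_def by metis
  then show ?thesis unfolding lin_system_def using assms(1) by (intro exI[of _ "\<Union>a\<in>A. \<Phi> a"]) auto
qed

text \<open>A coordinate that is minimal among all solutions is already determined by the constraints that
  are tight at the minimum: otherwise it could be decreased along a direction in their kernel.\<close>

lemma least_solution_small:
  assumes fI: "finite I" and k: "k \<in> I" and M: "M \<ge> 1" and D: "D \<ge> 1" and S: "lin_system I D M S"
    and y: "S y" and least: "\<And>y'. S y' \<Longrightarrow> y k \<le> y' k"
  shows "\<exists>p q::int. q \<noteq> 0 \<and> \<bar>q\<bar> \<le> int ((2 * (card I + 1) * M) ^ card I) \<and>
    \<bar>p\<bar> \<le> int (card I * (2 * (card I + 1) * M) ^ card I * M) \<and> y k = of_int p / of_int q"
proof -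
  obtain \<Phi> where \<Phi>: "finite \<Phi>" "\<And>\<phi>. \<phi> \<in> \<Phi> \<Longrightarrow> affine_int I D M \<phi>" "\<And>y. S y \<longleftrightarrow> (\<forall>\<phi>\<in>\<Phi>. 0 \<le> \<phi> y)"
    using S unfolding lin_system_def by blast
  obtain a b where ab: "\<And>\<phi> i. \<phi> \<in> \<Phi> \<Longrightarrow> i \<in> I \<Longrightarrow> \<bar>a \<phi> i\<bar> \<le> int M" "\<And>\<phi>. \<phi> \<in> \<Phi> \<Longrightarrow> \<bar>b \<phi>\<bar> \<le> int M"
    "\<And>\<phi> y. \<phi> \<in> \<Phi> \<Longrightarrow> real D * \<phi> y = (\<Sum>i\<in>I. of_int (a \<phi> i) * y i) + of_int (b \<phi>)"
    using \<Phi>(2) unfolding affine_int_def by metis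
  define row where "row \<phi> i = (if i \<in> I then real_of_int (a \<phi> i) else 0)" for \<phi> i
  have row: "real D * \<phi> y = (\<Sum>i\<in>I. row \<phi> i * y i) + of_int (b \<phi>)" if "\<phi> \<in> \<Phi>" for \<phi> y
    unfolding ab(3)[OF that] by (simp add: row_def)
  define T where "T = {\<phi> \<in> \<Phi>. \<phi> y = 0}"
  show ?thesis
  proof (rule determined_coordinate_small[OF fI k M, where rows = "row ` T"])
    show "r i = 0" if "r \<in> row ` T" "i \<notin> I" for r i using that by (auto simp: row_def)
    show "\<exists>a::int. r i = of_int a \<and> \<bar>a\<bar> \<le> int M" if r: "r \<in> row ` T" for r i
    proof -
      obtain \<phi> where "\<phi> \<in> \<Phi>" "r = row \<phi>" using r by (auto simp: T_def)
      then show ?thesis using ab(1)[of \<phi> i]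
        by (intro exI[of _ "if i \<in> I then a \<phi> i else 0"]) (auto simp: row_def)
    qed
    show "\<exists>c::int. \<bar>c\<bar> \<le> int M \<and> (\<Sum>i\<in>I. r i * y i) = of_int c" if r: "r \<in> row ` T" for r
    proof -
      obtain \<phi> where "\<phi> \<in> \<Phi>" "\<phi> y = 0" "r = row \<phi>" using r by (auto simp: T_def)
      then show ?thesis using row[of \<phi> y] ab(2)[of \<phi>] by (intro exI[of _ "- b \<phi>"]) auto
    qed
    fix z assume z: "\<And>r. r \<in> row ` T \<Longrightarrow> (\<Sum>i\<in>I. r i * z i) = 0"
    show "z k = 0"
    proof (rule ccontr)
      assume zk: "z k \<noteq> 0"
      \<comment> \<open>Scaled so that the entry at \<open>k\<close> is minus a square, hence
        negative.\<close>
      define z' where "z' i = - (z k) * z i" for i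
      have z'k: "z' k < 0" using zk by (simp add: z'_def) (metis mult_pos_pos mult_neg_neg linorder_neqE_linordered_idom)
      have lin: "\<phi> (\<lambda>i. y i + t * z' i) = \<phi> y + t * ((\<Sum>i\<in>I. row \<phi> i * z' i) / real D)" if "\<phi> \<in> \<Phi>" for \<phi> t
      proof -
        have "real D * \<phi> (\<lambda>i. y i + t * z' i) = real D * \<phi> y + t * (\<Sum>i\<in>I. row \<phi> i * z' i)"
          unfolding row[OF that] by (simp add: distrib_left sum.distrib sum_distrib_left mult.left_commute)
        then show ?thesis using D by (simp add: field_simps)
      qed
      have "\<forall>\<^sub>F t in at_right 0. 0 \<le> \<phi> (\<lambda>i. y i + t * z' i)" if \<phi>: "\<phi> \<in> \<Phi>" for \<phi>
      \<comment> \<open>Tight constraints stay tight along \<open>z'\<close>; the others are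
        positive at \<open>y\<close> and survive a small step.\<close>
      proof (cases "\<phi> y = 0")
        case True
        then have "(\<Sum>i\<in>I. row \<phi> i * z i) = 0" using z[of "row \<phi>"] \<phi> by (simp add: T_def)
        then have "(\<Sum>i\<in>I. row \<phi> i * z' i) = 0"
          using sum_distrib_left[of "- z k" "\<lambda>i. row \<phi> i * z i" I] by (simp add: z'_def mult.left_commute)
        then show ?thesis unfolding lin[OF \<phi>] using True by simp
      next
        case False
        then have pos: "0 < \<phi> y" using y \<Phi>(3) \<phi> by (simp add: order_less_le)
        have "((\<lambda>t. \<phi> y + t * ((\<Sum>i\<in>I. row \<phi> i * z' i) / real D)) \<longlongrightarrow> \<phi> y + 0 * ((\<Sum>i\<in>I. row \<phi> i * z' i) / real D)) (at_right 0)"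
          by (intro tendsto_intros)
        then have "\<forall>\<^sub>F t in at_right 0. 0 < \<phi> y + t * ((\<Sum>i\<in>I. row \<phi> i * z' i) / real D)"
          using pos by (intro order_tendstoD(1)) auto
        then show ?thesis unfolding lin[OF \<phi>] by (rule eventually_mono) simp
      qed
      then have "\<forall>\<^sub>F t in at_right 0. \<forall>\<phi>\<in>\<Phi>. 0 \<le> \<phi> (\<lambda>i. y i + t * z' i)"
        using \<Phi>(1) by (intro eventually_ball_finite) auto
      then have "\<forall>\<^sub>F t in at_right (0::real). 0 < t \<and> S (\<lambda>i. y i + t * z' i)"
        unfolding \<Phi>(3) using eventually_at_right_less by (intro eventually_conj) auto
      then obtain t :: real where t: "0 < t" "S (\<lambda>i. y i + t * z' i)"
        using eventually_happens[of _ "at_right (0::real)"] by auto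
      then have "0 \<le> t * z' k" using least[OF t(2)] by simp
      then show False using t(1) z'k by (simp add: zero_le_mult_iff)
    qed
  qed
qed

section \<open>Certificates as linear systems\<close>

text \<open>Each vertex of finite requirement has a certificate of its own, which is the first index
  of potentials and flows; the second is the vertex of the region that carries the potential or
  makes the proposal.\<close>

datatype variable = LamV nat | PotV nat nat | FlowV nat nat "nat \<times> nat"

text \<open>Vertices outside \<open>A\<close> keep the value \<infinity> and contribute no unknown
  requirement; the upper inequality of a fixed point is void there.\<close>

definition req_of :: "nat set \<Rightarrow> (variable \<Rightarrow> real) \<Rightarrow> requirement" where
  "req_of A y t = (if t \<in> A then ereal (y (LamV t)) else \<infinity>)"

lemma wsum_int:
  assumes "\<And>e. e \<in> edges G \<Longrightarrow> \<exists>b::int. real D * rew G i e = of_int b \<and> \<bar>b\<bar> \<le> int U" "is_history G L"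
  shows "\<exists>b::int. real D * wsum (rew G i) L = of_int b \<and> \<bar>b\<bar> \<le> int (length L * U)"
  using assms(2)
proof (induction L rule: rev_induct)
  case (snoc x L)
  show ?case
  proof (cases "L = []")
    case False
    then obtain b b' :: int where "real D * wsum (rew G i) L = of_int b" "\<bar>b\<bar> \<le> int (length L * U)"
      "real D * rew G i (last L, x) = of_int b'" "\<bar>b'\<bar> \<le> int U"
      using snoc assms(1)[of "(last L, x)"] by (auto simp: is_history_snoc)
    then show ?thesis using False
      by (intro exI[of _ "b + b'"]) (auto simp: wsum_snoc distrib_left)
  qed (auto intro: exI[of _ 0])
qed (auto intro: exI[of _ 0])

lemma is_history_drop: "is_history G h \<Longrightarrow> k < length h \<Longrightarrow> is_history G (drop k h)"
  unfolding is_history_def using set_drop_subset[of k h] by auto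

text \<open>The threshold \<open>y (LamV v) + \<epsilon>\<close> is subtracted once per edge of a
  walk, so it occurs multiplied by a constant length, and no product of unknowns arises.
  \<open>M\<close> covers the largest constraints: conservation has two sums over edges, and a
  potential inequality takes about \<open>3 * card (verts G)\<close> units of
  \<open>U\<close>.\<close>

lemma certificate_lin_system:
  assumes wf: "wf_game G" and v: "v \<in> A" "A \<subseteq> verts G" and fI: "finite I"
    and IL: "\<And>t. t \<in> A \<Longrightarrow> LamV t \<in> I" and IP: "\<And>w. w \<in> verts G \<Longrightarrow> PotV v w \<in> I"
    and IX: "\<And>w e. w \<in> verts G \<Longrightarrow> e \<in> edges G \<Longrightarrow> FlowV v w e \<in> I"
    and rat: "\<And>t e. t \<in> verts G \<Longrightarrow> e \<in> edges G \<Longrightarrow> \<exists>b::int. real D * rew G (owner G t) e = of_int b \<and> \<bar>b\<bar> \<le> int U"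
    and eps: "\<exists>b::int. real D * \<epsilon> = of_int b \<and> \<bar>b\<bar> \<le> int U" and D: "D \<le> U"
    and ok: "\<And>w. w \<in> R \<Longrightarrow> proposal_ok G (owner G v) R w (pr w)" and RV: "R \<subseteq> verts G"
    and M: "M = (2 * card (edges G) + 3 * card (verts G) + 10) * U"
  shows "lin_system I D M (\<lambda>y. certificate G (owner G v) (req_of A y) (y (LamV v) + \<epsilon>) R pr
      (\<lambda>w. y (PotV v w)) (\<lambda>w e. y (FlowV v w e)))"
proof -
  let ?i = "owner G v"
  let ?V = "verts G"
  have vV: "v \<in> ?V" using v by blast
  have fV: "finite ?V" and fE: "finite (edges G)" using wf finite_edges by (auto simp: wf_game_def)
  have M': "M = 2 * (card (edges G) * U) + 3 * (card ?V * U) + 10 * U" unfolding M by (simp add: algebra_simps)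
  have DM: "D \<le> M" using D unfolding M' by linarith
  have var: "affine_int I D U (\<lambda>y. y j)" if "j \<in> I" for j
    using affine_int_var[OF fI that, of D 1 "int D" U] D by simp
  obtain be :: int where be: "real D * \<epsilon> = of_int be" "\<bar>be\<bar> \<le> int U" using eps by blast
  have thr: "affine_int I D (U + U) (\<lambda>y. y (LamV v) + \<epsilon>)"
    by (rule affine_int_add[OF var[OF IL[OF v(1)]] affine_int_const[OF be]])
  have walkc: "affine_int I D ((card ?V + 1) * U) (\<lambda>_. wsum (rew G ?i) (L @ [b]))"
    if h: "is_history G (L @ [b])" "length L \<le> card ?V" for L b
  proof -
    obtain c :: int where c: "real D * wsum (rew G ?i) (L @ [b]) = of_int c" "\<bar>c\<bar> \<le> int (length (L @ [b]) * U)"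
      using wsum_int[OF rat[OF vV] h(1)] by blast
    have "length (L @ [b]) * U \<le> (card ?V + 1) * U" using h(2) by (intro mult_right_mono) auto
    then have "\<bar>c\<bar> \<le> int ((card ?V + 1) * U)" using c(2) by linarith
    then show ?thesis by (rule affine_int_const[OF c(1)])
  qed
  have walkw: "affine_int I D ((card ?V + 1) * U + card ?V * (U + U)) (\<lambda>y. wsum (\<lambda>e. rew G ?i e - (y (LamV v) + \<epsilon>)) (L @ [b]))"
    if h: "is_history G (L @ [b])" "length L \<le> card ?V" for L b
  proof -
    have "affine_int I D (length L * (U + U)) (\<lambda>y. real (length L) * (y (LamV v) + \<epsilon>))"
      using affine_int_scale[OF thr, of "int (length L)"] by simp
    then have "affine_int I D (card ?V * (U + U)) (\<lambda>y. real (length L) * (y (LamV v) + \<epsilon>))"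
      by (rule affine_int_mono) (use h(2) in \<open>intro mult_right_mono, auto\<close>)
    from affine_int_diff[OF walkc[OF h] this] show ?thesis unfolding wsum_diff wsum_const .
  qed
  have body: "lin_system I D M (\<lambda>y. proposal_ok G ?i R w (pr w) \<and> cycle_ok G ?i (y (LamV v) + \<epsilon>) (pr w) \<and>
      flow_ok G ?i (req_of A y) (y (LamV v) + \<epsilon>) (\<lambda>e. y (FlowV v w e)) (pr w) \<and>
      pot_ok G ?i (y (LamV v) + \<epsilon>) (\<lambda>w. y (PotV v w)) w (pr w))" if w: "w \<in> R" for w
  proof -
    obtain p k T K where pw: "pr w = (p, k, T, K)" by (cases "pr w")
    have ok': "is_history G p" "distinct p" "k < length p" "(last p, p ! k) \<in> edges G" "T \<subseteq> ?V" "K \<subseteq> T"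
      using ok[OF w] unfolding pw proposal_ok_def by blast+
    have wV: "w \<in> ?V" using w RV by blast
    have lp: "length p \<le> card ?V" by (rule length_distinct_history[OF wf ok'(1,2)])
    let ?IE = "inner_edges G K"
    have fIE: "finite ?IE" by (rule finite_inner_edges[OF wf])
    have IEE: "?IE \<subseteq> edges G" by (auto simp: inner_edges_def)
    have fT: "finite T" by (rule finite_subset[OF ok'(5) fV])
    have fK: "finite K" by (rule finite_subset[OF ok'(6) fT])
    have sumx: "affine_int I D (card (edges G) * U) (\<lambda>y. \<Sum>e\<in>X. y (FlowV v w e))" if X: "X \<subseteq> ?IE" for X
    proof -
      have "affine_int I D (card X * U) (\<lambda>y. \<Sum>e\<in>X. y (FlowV v w e))"
      proof (rule affine_int_sum[OF finite_subset[OF X fIE]])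
        fix e assume "e \<in> X"
        then show "affine_int I D U (\<lambda>y. y (FlowV v w e))" using X IEE by (intro var IX[OF wV]) blast
      qed
      moreover have "card X \<le> card (edges G)" using X IEE fE by (intro card_mono) auto
      ultimately show ?thesis using affine_int_mono by (meson mult_le_mono1)
    qed
    have flow: "affine_int I D (card (edges G) * U) (\<lambda>y. flow_value G K (\<lambda>e. y (FlowV v w e)) (owner G t))" if t: "t \<in> ?V" for t
    proof -
      have "affine_int I D U (\<lambda>y. y (FlowV v w e) * rew G (owner G t) e)" if e: "e \<in> ?IE" for e
      proof -
        have eE: "e \<in> edges G" using e IEE by blast
        obtain b :: int where b: "real D * rew G (owner G t) e = of_int b" "\<bar>b\<bar> \<le> int U" using rat[OF t eE] by blast
        have "affine_int I D U (\<lambda>y. rew G (owner G t) e * y (FlowV v w e))"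
          by (rule affine_int_var[OF fI IX[OF wV eE] b])
        then show ?thesis by (simp add: mult.commute)
      qed
      then have "affine_int I D (card ?IE * U) (\<lambda>y. \<Sum>e\<in>?IE. y (FlowV v w e) * rew G (owner G t) e)"
        using fIE by (intro affine_int_sum)
      moreover have "card ?IE \<le> card (edges G)" using IEE fE by (intro card_mono)
      ultimately show ?thesis unfolding flow_value_def using affine_int_mono by (meson mult_le_mono1)
    qed
    have one: "affine_int I D U (\<lambda>_. 1)" by (rule affine_int_const[where b = "int D"]) (use D in auto)
    have zero: "affine_int I D U (\<lambda>_. 0)" by (rule affine_int_const[where b = 0]) auto
    have 1: "lin_system I D M (\<lambda>y. cycle_ok G ?i (y (LamV v) + \<epsilon>) (pr w))"
      unfolding cycle_ok_def pw prod.case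
    proof (rule lin_system_le)
      have "is_history G (drop k p @ [p ! k])"
        using is_history_drop[OF ok'(1,3)] ok' wf by (subst is_history_snoc) (auto simp: wf_game_def)
      then have "affine_int I D (U + ((card ?V + 1) * U + card ?V * (U + U))) (\<lambda>y. 0 - wsum (\<lambda>e. rew G ?i e - (y (LamV v) + \<epsilon>)) (drop k p @ [p ! k]))"
        using lp by (intro affine_int_diff zero walkw) auto
      then show "affine_int I D M (\<lambda>y. 0 - wsum (\<lambda>e. rew G ?i e - (y (LamV v) + \<epsilon>)) (drop k p @ [p ! k]))"
        by (rule affine_int_mono) (simp add: M' algebra_simps)
    qed
    have pot_eq: "pot_ok G ?i (y (LamV v) + \<epsilon>) (\<lambda>w. y (PotV v w)) w (p, k, T, K) \<longleftrightarrow>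
       (\<forall>m\<in>{m. m < length p \<and> owner G (p ! m) = ?i}. \<forall>w'\<in>{w'. (p ! m, w') \<in> edges G}.
         wsum (\<lambda>e. rew G ?i e - (y (LamV v) + \<epsilon>)) (take (Suc m) p @ [w']) + y (PotV v w') \<le> y (PotV v w))" for y
      by (auto simp: pot_ok_def)
    have 2: "lin_system I D M (\<lambda>y. pot_ok G ?i (y (LamV v) + \<epsilon>) (\<lambda>w. y (PotV v w)) w (pr w))"
      unfolding pw pot_eq
    proof (intro lin_system_ball lin_system_le)
      fix m w' assume m: "m \<in> {m. m < length p \<and> owner G (p ! m) = ?i}" and w': "w' \<in> {w'. (p ! m, w') \<in> edges G}"
      have w'V: "w' \<in> ?V" using w' wf by (auto simp: wf_game_def)
      have "is_history G (take (Suc m) p @ [w'])"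
        using is_history_take[OF ok'(1), of m] m w' w'V by (subst is_history_snoc) (auto simp: take_Suc_conv_app_nth)
      then have "affine_int I D (U + (((card ?V + 1) * U + card ?V * (U + U)) + U)) (\<lambda>y. y (PotV v w) -
          (wsum (\<lambda>e. rew G ?i e - (y (LamV v) + \<epsilon>)) (take (Suc m) p @ [w']) + y (PotV v w')))"
        using lp by (intro affine_int_diff affine_int_add var walkw IP wV w'V) auto
      then show "affine_int I D M (\<lambda>y. y (PotV v w) -
          (wsum (\<lambda>e. rew G ?i e - (y (LamV v) + \<epsilon>)) (take (Suc m) p @ [w']) + y (PotV v w')))"
        by (rule affine_int_mono) (simp add: M' algebra_simps)
    next
      fix m
      have "{w'. (p ! m, w') \<in> edges G} \<subseteq> snd ` edges G" by force
      then show "finite {w'. (p ! m, w') \<in> edges G}" using fE finite_subset by blast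
    qed simp
    have 3: "lin_system I D M (\<lambda>y. flow_ok G ?i (req_of A y) (y (LamV v) + \<epsilon>) (\<lambda>e. y (FlowV v w e)) (pr w))"
      unfolding flow_ok_def circulation_def pw prod.case
    proof (intro lin_system_conj lin_system_ball)
      fix e assume "e \<in> ?IE"
      then have "FlowV v w e \<in> I" using IEE IX[OF wV] by blast
      then have "affine_int I D (U + U) (\<lambda>y. y (FlowV v w e) - 0)" by (intro affine_int_diff var zero)
      then have "affine_int I D M (\<lambda>y. y (FlowV v w e) - 0)" by (rule affine_int_mono) (simp add: M')
      then show "lin_system I D M (\<lambda>y. 0 \<le> y (FlowV v w e))" by (rule lin_system_le)
    next
      have "affine_int I D (U + card (edges G) * U) (\<lambda>y. 1 - (\<Sum>e\<in>?IE. y (FlowV v w e)))"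
        by (intro affine_int_diff one sumx) simp
      then have "affine_int I D M (\<lambda>y. 1 - (\<Sum>e\<in>?IE. y (FlowV v w e)))" by (rule affine_int_mono) (simp add: M')
      then show "lin_system I D M (\<lambda>y. (\<Sum>e\<in>?IE. y (FlowV v w e)) = 1)" by (rule lin_system_eq)
    next
      fix u
      have "affine_int I D (card (edges G) * U + card (edges G) * U)
          (\<lambda>y. (\<Sum>e\<in>{e \<in> ?IE. snd e = u}. y (FlowV v w e)) - (\<Sum>e\<in>{e \<in> ?IE. fst e = u}. y (FlowV v w e)))"
        by (intro affine_int_diff sumx) auto
      then have "affine_int I D M (\<lambda>y. (\<Sum>e\<in>{e \<in> ?IE. snd e = u}. y (FlowV v w e)) - (\<Sum>e\<in>{e \<in> ?IE. fst e = u}. y (FlowV v w e)))"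
        by (rule affine_int_mono) (simp add: M')
      then show "lin_system I D M (\<lambda>y. (\<Sum>e\<in>{e \<in> ?IE. fst e = u}. y (FlowV v w e)) = (\<Sum>e\<in>{e \<in> ?IE. snd e = u}. y (FlowV v w e)))"
        by (rule lin_system_eq)
    next
      fix t assume t: "t \<in> T"
      show "lin_system I D M (\<lambda>y. req_of A y t \<le> ereal (flow_value G K (\<lambda>e. y (FlowV v w e)) (owner G t)))"
      proof (cases "t \<in> A")
        case True
        have "affine_int I D (card (edges G) * U + U) (\<lambda>y. flow_value G K (\<lambda>e. y (FlowV v w e)) (owner G t) - y (LamV t))"
          using t ok'(5) by (intro affine_int_diff flow var IL True) blast
        then have "affine_int I D M (\<lambda>y. flow_value G K (\<lambda>e. y (FlowV v w e)) (owner G t) - y (LamV t))"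
          by (rule affine_int_mono) (simp add: M')
        then show ?thesis using True by (simp add: req_of_def lin_system_le)
      next
        case False
        \<comment> \<open>No flow meets an infinite requirement, so the constraint is constantly
          false.\<close>
        then show ?thesis using lin_system_const[OF DM, where P = False] by (simp add: req_of_def)
      qed
    next
      have "affine_int I D ((U + U) + card (edges G) * U) (\<lambda>y. (y (LamV v) + \<epsilon>) - flow_value G K (\<lambda>e. y (FlowV v w e)) ?i)"
        by (intro affine_int_diff thr flow vV)
      then have "affine_int I D M (\<lambda>y. (y (LamV v) + \<epsilon>) - flow_value G K (\<lambda>e. y (FlowV v w e)) ?i)"
        by (rule affine_int_mono) (simp add: M')
      then show "lin_system I D M (\<lambda>y. flow_value G K (\<lambda>e. y (FlowV v w e)) ?i \<le> y (LamV v) + \<epsilon>)" by (rule lin_system_le)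
    qed (use fIE fK fT in auto)
    show ?thesis by (intro lin_system_conj lin_system_const[OF DM] 1 2 3)
  qed
  show ?thesis unfolding certificate_def
    by (rule lin_system_conj[OF lin_system_const[OF DM] lin_system_ball[OF finite_subset[OF RV fV] body]])
qed

section \<open>Sizes\<close>

abbreviation num :: "rat \<Rightarrow> int" where "num r \<equiv> fst (quotient_of r)"
abbreviation den :: "rat \<Rightarrow> int" where "den r \<equiv> snd (quotient_of r)"

lemma real_of_rat_num_den: "real_of_rat r = of_int (num r) / of_int (den r)"
proof -
  have "r = of_int (num r) / of_int (den r)" by (rule quotient_of_div) simp
  then have "real_of_rat r = real_of_rat (of_int (num r) / of_int (den r))" by (rule arg_cong)
  then show ?thesis by (simp add: of_rat_divide)
qed

lemma den_pos: "den r > 0"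
  using quotient_of_denom_pos' .

lemma le_power_ceiling_log:
  fixes x :: int assumes "x \<ge> 0"
  shows "x + 1 \<le> 2 ^ nat \<lceil>log 2 (real_of_int (x + 1))\<rceil>"
proof -
  let ?n = "nat \<lceil>log 2 (real_of_int (x + 1))\<rceil>"
  have "log 2 (real_of_int (x + 1)) \<le> real ?n" by linarith
  then have "real_of_int (x + 1) \<le> 2 powr real ?n" using assms by (subst (asm) log_le_iff) auto
  then have "real_of_int (x + 1) \<le> real_of_int (2 ^ ?n)" by (simp add: powr_realpow)
  then show ?thesis by (simp only: of_int_le_iff)
qed

lemma num_den_le: "\<bar>num r\<bar> \<le> 2 ^ size_rat r" "den r \<le> 2 ^ size_rat r"
proof -
  obtain p q where pq: "quotient_of r = (p, q)" by (cases "quotient_of r")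
  have q: "q > 0" using den_pos[of r] pq by simp
  define a where "a = nat \<lceil>log 2 (real_of_int (\<bar>p\<bar> + 1))\<rceil>"
  define b where "b = nat \<lceil>log 2 (real_of_int (\<bar>q\<bar> + 1))\<rceil>"
  have s: "size_rat r = 1 + a + b" by (simp add: size_rat_def pq a_def b_def)
  have "\<bar>p\<bar> + 1 \<le> 2 ^ a" "\<bar>q\<bar> + 1 \<le> 2 ^ b" unfolding a_def b_def by (rule le_power_ceiling_log, simp)+
  moreover have "(2::int) ^ a \<le> 2 ^ size_rat r" by (rule power_increasing) (simp_all add: s)
  moreover have "(2::int) ^ b \<le> 2 ^ size_rat r" by (rule power_increasing) (simp_all add: s)
  ultimately show "\<bar>num r\<bar> \<le> 2 ^ size_rat r" "den r \<le> 2 ^ size_rat r"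
    unfolding pq prod.sel using q by linarith+
qed

lemma nat_ceiling_log_le:
  fixes x :: int assumes "0 \<le> x" "x \<le> 2 ^ K"
  shows "nat \<lceil>log 2 (real_of_int (x + 1))\<rceil> \<le> K + 1"
proof -
  have "(1::int) \<le> 2 ^ K" by simp
  then have "x + 1 \<le> 2 ^ K + 2 ^ K" using assms(2) by (intro add_mono)
  then have "x + 1 \<le> 2 ^ (K + 1)" by simp
  then have "real_of_int (x + 1) \<le> real_of_int (2 ^ (K + 1))" by (simp only: of_int_le_iff)
  then have "real_of_int (x + 1) \<le> 2 powr real (K + 1)" by (simp only: powr_realpow) simp
  then have "log 2 (real_of_int (x + 1)) \<le> real (K + 1)" using assms(1) by (simp only: log_le_iff)
  then show ?thesis by linarith
qed

text \<open>Passing to lowest terms does not enlarge numerator or denominator; each takes at most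
  \<open>K + 1\<close> bits, and the definition of size adds 1.\<close>

lemma size_ereal_fraction_le:
  fixes p q :: int
  assumes "q \<noteq> 0" "\<bar>p\<bar> \<le> 2 ^ K" "\<bar>q\<bar> \<le> 2 ^ K"
  shows "size_ereal (ereal (of_int p / of_int q)) \<le> enat (2 * K + 3)"
proof -
  define r :: rat where "r = of_int p / of_int q"
  have r: "real_of_rat r = of_int p / of_int q" by (simp add: r_def of_rat_divide)
  have the: "(THE r'. real_of_rat r' = of_int p / of_int q) = r"
    unfolding r[symmetric] by (rule the_equality) auto
  have "of_int p / of_int q \<in> (\<rat> :: real set)" by auto
  then have sz: "size_ereal (ereal (of_int p / of_int q)) = enat (size_rat r)" by (simp add: size_ereal_def the)
  obtain a b where ab: "quotient_of r = (a, b)" by (cases "quotient_of r")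
  have b: "b > 0" "coprime a b" using ab den_pos[of r] quotient_of_coprime[OF ab] by auto
  have "real_of_int p / of_int q = of_int a / of_int b" using r real_of_rat_num_den[of r] ab by simp
  then have "real_of_int (p * b) = real_of_int (a * q)" using assms(1) b(1) by (simp add: field_simps)
  then have eq: "p * b = a * q" by (simp only: of_int_eq_iff)
  have "b dvd a * q" "a dvd p * b" using eq by (metis dvd_triv_right, metis dvd_triv_left)
  then have "b dvd q" "a dvd p" using b(2) by (auto simp: coprime_dvd_mult_right_iff coprime_dvd_mult_left_iff coprime_commute)
  then have "\<bar>b\<bar> \<le> \<bar>q\<bar>" "p \<noteq> 0 \<Longrightarrow> \<bar>a\<bar> \<le> \<bar>p\<bar>" using assms(1) dvd_imp_le_int by blast+
  moreover have "p = 0 \<Longrightarrow> a = 0" using eq assms(1) by simp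
  ultimately have "\<bar>a\<bar> \<le> 2 ^ K" "\<bar>b\<bar> \<le> 2 ^ K" using assms(2,3) by (cases "p = 0"; force)+
  then have "size_rat r \<le> 2 * K + 3"
    using nat_ceiling_log_le[of "\<bar>a\<bar>" K] nat_ceiling_log_le[of "\<bar>b\<bar>" K] unfolding size_rat_def ab prod.case by linarith
  then show ?thesis by (simp add: sz)
qed

lemma scaled_rat_int:
  assumes "den r dvd int D"
  shows "\<exists>b::int. real D * real_of_rat r = of_int b \<and> \<bar>b\<bar> \<le> int D * \<bar>num r\<bar>"
proof -
  obtain m where m: "int D = den r * m" using assms by blast
  have m': "\<bar>m\<bar> \<le> int D"
  proof (cases "D = 0")
    case False
    then have "\<bar>m\<bar> \<le> \<bar>int D\<bar>" by (intro dvd_imp_le_int) (use m in auto)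
    then show ?thesis by simp
  qed (use m den_pos[of r] in auto)
  have "real D = of_int (den r) * of_int m" using m by (metis of_int_mult of_int_of_nat_eq)
  then have "real D * real_of_rat r = of_int (m * num r)"
    using den_pos[of r] by (simp add: real_of_rat_num_den)
  moreover have "\<bar>m * num r\<bar> \<le> int D * \<bar>num r\<bar>" unfolding abs_mult using m' by (intro mult_right_mono) auto
  ultimately show ?thesis by blast
qed

text \<open>\<open>D\<close> is the product of all denominators, so its bit length is bounded by the
  sum of the sizes. The factor 2 in the exponent of the other bounds accounts for numerators
  multiplied by up to \<open>D\<close>.\<close>

lemma common_denominator:
  assumes wf: "wf_game G" and s: "s = game_size G + size_rat \<epsilon>"
  obtains D :: nat where "D \<ge> 1" "D \<le> 2 ^ s"
    "\<And>t e. t \<in> verts G \<Longrightarrow> e \<in> edges G \<Longrightarrow> \<exists>b::int. real D * rew G (owner G t) e = of_int b \<and> \<bar>b\<bar> \<le> 2 ^ (2 * s)"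
    "\<exists>b::int. real D * real_of_rat \<epsilon> = of_int b \<and> \<bar>b\<bar> \<le> 2 ^ (2 * s)"
proof -
  let ?X = "players G \<times> edges G"
  define Dn where "Dn = (\<Prod>(j, e)\<in>?X. den (reward G j e)) * den \<epsilon>"
  have fX: "finite ?X" using wf finite_edges[OF wf] by (auto simp: wf_game_def)
  have pos: "Dn > 0" unfolding Dn_def using den_pos by (intro mult_pos_pos prod_pos) auto
  define D where "D = nat Dn"
  have D: "int D = Dn" using pos by (simp add: D_def)
  have ssum: "(\<Sum>(j, e)\<in>?X. size_rat (reward G j e)) + size_rat \<epsilon> \<le> s"
    unfolding s game_size_def by (simp add: sum.cartesian_product)
  have Ds: "int D \<le> 2 ^ s"
  proof -
    have "(\<Prod>(j, e)\<in>?X. den (reward G j e)) \<le> (\<Prod>(j, e)\<in>?X. 2 ^ size_rat (reward G j e))"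
      using num_den_le den_pos by (intro prod_mono) (auto intro: less_imp_le)
    also have "\<dots> = 2 ^ (\<Sum>(j, e)\<in>?X. size_rat (reward G j e))" by (simp add: power_sum case_prod_unfold)
    finally have "Dn \<le> 2 ^ (\<Sum>(j, e)\<in>?X. size_rat (reward G j e)) * 2 ^ size_rat \<epsilon>"
      unfolding Dn_def using num_den_le den_pos[of \<epsilon>] by (intro mult_mono) (auto intro: less_imp_le)
    also have "\<dots> \<le> 2 ^ s" unfolding power_add[symmetric] using ssum by (intro power_increasing) auto
    finally show ?thesis by (simp add: D)
  qed
  have bnd: "\<exists>b::int. real D * real_of_rat r = of_int b \<and> \<bar>b\<bar> \<le> 2 ^ (2 * s)"
    if dv: "den r dvd int D" and sr: "size_rat r \<le> s" for r
  proof -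
    obtain b :: int where b: "real D * real_of_rat r = of_int b" "\<bar>b\<bar> \<le> int D * \<bar>num r\<bar>"
      using scaled_rat_int[OF dv] by blast
    have "\<bar>num r\<bar> \<le> 2 ^ s"
      by (rule order_trans[OF num_den_le(1)], rule power_increasing[OF sr]) simp
    then have "int D * \<bar>num r\<bar> \<le> 2 ^ s * 2 ^ s" using Ds by (intro mult_mono) auto
    then show ?thesis using b by (intro exI[of _ b]) (auto simp: power_add[symmetric] mult_2)
  qed
  show ?thesis
  proof
    show "D \<ge> 1" using pos by (simp add: D_def)
    have "int D \<le> int (2 ^ s)" using Ds by simp
    then show "D \<le> 2 ^ s" by (simp only: of_nat_le_iff)
    show "\<exists>b::int. real D * real_of_rat \<epsilon> = of_int b \<and> \<bar>b\<bar> \<le> 2 ^ (2 * s)"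
      using ssum by (intro bnd) (auto simp: D Dn_def)
    fix t e assume t: "t \<in> verts G" and e: "e \<in> edges G"
    have x: "(owner G t, e) \<in> ?X" using wf t e by (simp add: wf_game_def)
    have "(case (owner G t, e) of (j, e) \<Rightarrow> den (reward G j e)) dvd (\<Prod>(j, e)\<in>?X. den (reward G j e))"
      using fX x by (rule dvd_prodI)
    then have "den (reward G (owner G t) e) dvd int D" by (simp add: D Dn_def)
    moreover have "(case (owner G t, e) of (j, e) \<Rightarrow> size_rat (reward G j e)) \<le> (\<Sum>(j, e)\<in>?X. size_rat (reward G j e))"
      using fX x by (intro member_le_sum) auto
    ultimately show "\<exists>b::int. real D * rew G (owner G t) e = of_int b \<and> \<bar>b\<bar> \<le> 2 ^ (2 * s)"
      using ssum by (intro bnd) auto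
  qed
qed

section \<open>The least fixed point\<close>

text \<open>Keeps \<epsilon>-fixed points away from the value -\<infinity>: there the upper bound on
  \<open>nego\<close> would be -\<infinity> as well.\<close>

lemma nego_not_MInfty:
  assumes wf: "wf_game G" and v: "v \<in> verts G"
  shows "nego G lam v \<noteq> - \<infinity>"
proof -
  let ?i = "owner G v"
  obtain B where B: "B \<ge> 0" "\<And>e. e \<in> edges G \<Longrightarrow> \<bar>rew G ?i e\<bar> \<le> B"
    using finite_weight_bound[OF finite_edges[OF wf], of "rew G ?i"] by blast
  have "ereal (- B) \<le> (SUP \<tau>\<in>{\<tau>. is_strategy G ?i \<tau>}. mean_payoff G ?i (outcome G (\<sigma>(?i := \<tau>)) [v]))"
    if s: "\<sigma> \<in> lam_rat G lam v" for \<sigma>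
  proof -
    obtain \<tau> where t: "is_strategy G ?i \<tau>" and st: "\<And>j. j \<in> players G \<Longrightarrow> j \<noteq> ?i \<Longrightarrow> is_strategy G j (\<sigma> j)"
      using s by (auto simp: lam_rat_def Let_def)
    have "is_play G (outcome G (\<sigma>(?i := \<tau>)) [v])"
      by (rule is_play_outcome[OF wf]) (use t st v in auto)
    then have "ereal (- B) \<le> mean_payoff G ?i (outcome G (\<sigma>(?i := \<tau>)) [v])"
      using mean_payoff_bounds(1)[OF B(2)] by blast
    then show ?thesis using t by (intro SUP_upper2[of \<tau>]) auto
  qed
  then have "ereal (- B) \<le> nego G lam v" unfolding nego_def Let_def by (rule INF_greatest)
  then show ?thesis by auto
qed

lemma flow_ok_cong:
  assumes "\<And>t. t \<in> fst (snd (snd pr)) \<Longrightarrow> lam t = lam' t"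
  shows "flow_ok G i lam c x pr \<longleftrightarrow> flow_ok G i lam' c x pr"
  using assms by (auto simp: flow_ok_def split: prod.splits)

text \<open>The base \<open>2 * (N + 1) * M\<close> has at most \<open>13 * s\<close> bits and
  \<open>N \<le> 3 * (s * s * s)\<close>, which gives \<open>39 * s ^ 4\<close>. The outer factors
  \<open>N\<close> and \<open>M\<close> add at most \<open>2 + 3 * s\<close> and
  \<open>7 * s\<close>, together at most \<open>12 * s ^ 4\<close>.\<close>

lemma bit_length_estimates:
  fixes s N U M nE nV :: nat
  assumes s: "s \<ge> 1" and N: "N \<le> s + s * s + s * s * s" and nE: "nE \<le> s" and nV: "nV \<le> s"
    and U: "U = 2 ^ (2 * s)" and M: "M = (2 * nE + 3 * nV + 10) * U"
  shows "(2 * (N + 1) * M) ^ N \<le> 2 ^ (51 * s ^ 4)" "N * (2 * (N + 1) * M) ^ N * M \<le> 2 ^ (51 * s ^ 4)"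
proof -
  have s2: "s \<le> 2 ^ s" using less_exp[of s] by simp
  have s3: "s * s * s \<le> 2 ^ (3 * s)"
  proof -
    have "s * s * s \<le> 2 ^ s * 2 ^ s * 2 ^ s" using s2 by (intro mult_le_mono)
    also have "\<dots> = 2 ^ (3 * s)" by (simp flip: power_add)
    finally show ?thesis .
  qed
  have ss: "s \<le> s * s" "s * s \<le> s * s * s" using s by auto
  have N3: "N \<le> 3 * (s * s * s)" using N ss by linarith
  have N1: "N + 1 \<le> 4 * (s * s * s)" using N3 ss s by linarith
  have pow: "(2::nat) ^ a \<le> 2 ^ b" if "a \<le> b" for a b using that by (intro power_increasing) auto
  have M2: "M \<le> 2 ^ (7 * s)"
  proof -
    have "2 * nE + 3 * nV + 10 \<le> 15 * s" using s nE nV by linarith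
    also have "\<dots> \<le> 2 ^ 4 * 2 ^ s" using s2 by (intro mult_le_mono) auto
    finally have "M \<le> 2 ^ 4 * 2 ^ s * 2 ^ (2 * s)" unfolding M U by (rule mult_le_mono1)
    also have "\<dots> = 2 ^ (4 + s + 2 * s)" by (simp only: power_add)
    also have "\<dots> \<le> 2 ^ (7 * s)" using s by (intro pow) linarith
    finally show ?thesis .
  qed
  have base: "2 * (N + 1) * M \<le> 2 ^ (13 * s)"
  proof -
    have "2 * (N + 1) \<le> 2 ^ 3 * 2 ^ (3 * s)" using N1 s3 by simp
    then have "2 * (N + 1) * M \<le> 2 ^ 3 * 2 ^ (3 * s) * 2 ^ (7 * s)" using M2 by (rule mult_le_mono)
    also have "\<dots> = 2 ^ (3 + 3 * s + 7 * s)" by (simp only: power_add)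
    also have "\<dots> \<le> 2 ^ (13 * s)" using s by (intro pow) linarith
    finally show ?thesis .
  qed
  have s4: "s ^ 4 = s * (s * s * s)" by (simp add: numeral_eq_Suc)
  have s14: "s \<le> s ^ 4" "1 \<le> s ^ 4" using s by (auto simp: s4)
  have Q: "(2 * (N + 1) * M) ^ N \<le> 2 ^ (39 * s ^ 4)"
  proof -
    have "(2 * (N + 1) * M) ^ N \<le> (2 ^ (13 * s)) ^ N" using base by (intro power_mono) auto
    also have "\<dots> = 2 ^ (13 * s * N)" by (simp only: power_mult)
    also have "\<dots> \<le> 2 ^ (39 * s ^ 4)"
    proof (rule pow)
      have "13 * s * N \<le> 13 * s * (3 * (s * s * s))" using N3 by (intro mult_le_mono2)
      then show "13 * s * N \<le> 39 * s ^ 4" by (simp add: s4)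
    qed
    finally show ?thesis .
  qed
  also have "\<dots> \<le> 2 ^ (51 * s ^ 4)" by (intro pow) simp
  finally show "(2 * (N + 1) * M) ^ N \<le> 2 ^ (51 * s ^ 4)" .
  have "N \<le> 2 ^ 2 * 2 ^ (3 * s)" using N3 s3 by simp
  then have "N * (2 * (N + 1) * M) ^ N * M \<le> 2 ^ 2 * 2 ^ (3 * s) * 2 ^ (39 * s ^ 4) * 2 ^ (7 * s)"
    using Q M2 by (intro mult_le_mono)
  also have "\<dots> = 2 ^ (2 + 3 * s + 39 * s ^ 4 + 7 * s)" by (simp only: power_add)
  also have "\<dots> \<le> 2 ^ (51 * s ^ 4)" using s14 by (intro pow) linarith
  finally show "N * (2 * (N + 1) * M) ^ N * M \<le> 2 ^ (51 * s ^ 4)" .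
qed

text \<open>A least fixed point minimises all coordinates simultaneously, so \<open>v0\<close> can
  be treated alone. The tight constraints have to determine only \<open>lam v0\<close>; potentials
  and flows may remain free.\<close>

lemma least_eps_fixed_point_value:
  assumes wf: "wf_game G" and e0: "\<epsilon> \<ge> 0" and least: "least_eps_fixed_point G \<epsilon> lam" and v0: "v0 \<in> verts G"
    and fin: "lam v0 \<noteq> \<infinity>" and s: "s = game_size G + size_rat \<epsilon>"
  shows "\<exists>p q::int. q \<noteq> 0 \<and> \<bar>p\<bar> \<le> 2 ^ (51 * s ^ 4) \<and> \<bar>q\<bar> \<le> 2 ^ (51 * s ^ 4) \<and> lam v0 = ereal (of_int p / of_int q)"
proof -
  let ?V = "verts G"
  let ?e = "real_of_rat \<epsilon>"
  have fp: "eps_fixed_point G \<epsilon> lam" and lst: "\<And>lam' v. eps_fixed_point G \<epsilon> lam' \<Longrightarrow> v \<in> ?V \<Longrightarrow> lam v \<le> lam' v"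
    using least by (auto simp: least_eps_fixed_point_def)
  have fV: "finite ?V" using wf by (simp add: wf_game_def)
  have fE: "finite (edges G)" by (rule finite_edges[OF wf])
  have up: "nego G lam v \<le> lam v + ereal ?e" if "v \<in> ?V" for v using fp that by (simp add: eps_fixed_point_def)
  define A where "A = {v \<in> ?V. lam v \<noteq> \<infinity>}"
  have A: "A \<subseteq> ?V" by (auto simp: A_def)
  have lamA: "lam v = ereal (real_of_ereal (lam v))" if "v \<in> A" for v
  proof (cases "lam v")
    case MInf
    then show ?thesis using up[of v] nego_not_MInfty[OF wf, of v lam] that by (auto simp: A_def)
  qed (use that in \<open>auto simp: A_def\<close>)
  have "\<exists>R pr f x. v \<in> R \<and> certificate G (owner G v) lam (real_of_ereal (lam v) + ?e) R pr f x" if v: "v \<in> A" for v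
  proof -
    have "nego G lam v \<le> ereal (real_of_ereal (lam v) + ?e)" using up[of v] lamA[OF v] v A by (metis plus_ereal.simps(1) subsetD)
    then show ?thesis using certificate_if_nego_le[OF wf _ refl, of v lam] v A by (metis subsetD)
  qed
  then obtain R pr f x where cert: "\<And>v. v \<in> A \<Longrightarrow> v \<in> R v \<and>
      certificate G (owner G v) lam (real_of_ereal (lam v) + ?e) (R v) (pr v) (f v) (x v)" by metis
  obtain D :: nat where D: "D \<ge> 1" "D \<le> 2 ^ s"
    "\<And>t e. t \<in> verts G \<Longrightarrow> e \<in> edges G \<Longrightarrow> \<exists>b::int. real D * rew G (owner G t) e = of_int b \<and> \<bar>b\<bar> \<le> 2 ^ (2 * s)"
    "\<exists>b::int. real D * ?e = of_int b \<and> \<bar>b\<bar> \<le> 2 ^ (2 * s)"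
    by (rule common_denominator[OF wf s], rule that)
  define U :: nat where "U = 2 ^ (2 * s)"
  have U: "int U = 2 ^ (2 * s)" by (simp add: U_def)
  define M where "M = (2 * card (edges G) + 3 * card ?V + 10) * U"
  define I where "I = LamV ` ?V \<union> (\<lambda>(v, w). PotV v w) ` (?V \<times> ?V) \<union> (\<lambda>(v, w, e). FlowV v w e) ` (?V \<times> ?V \<times> edges G)"
  have fI: "finite I" unfolding I_def using fV fE by auto
  define S where "S y \<longleftrightarrow> (\<forall>v\<in>A. certificate G (owner G v) (req_of A y) (y (LamV v) + ?e) (R v) (pr v)
      (\<lambda>w. y (PotV v w)) (\<lambda>w e. y (FlowV v w e)))" for y
  have RV: "R v \<subseteq> ?V" and ok: "\<And>w. w \<in> R v \<Longrightarrow> proposal_ok G (owner G v) (R v) w (pr v w)" if "v \<in> A" for v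
    using cert[OF that] by (auto simp: certificate_def)
  have lin: "lin_system I D M S"
    unfolding S_def
  proof (rule lin_system_ball[OF finite_subset[OF A fV]])
    fix v assume v: "v \<in> A"
    have vV: "v \<in> ?V" using v A by blast
    show "lin_system I D M (\<lambda>y. certificate G (owner G v) (req_of A y) (y (LamV v) + ?e) (R v) (pr v)
      (\<lambda>w. y (PotV v w)) (\<lambda>w e. y (FlowV v w e)))"
    proof (rule certificate_lin_system[OF wf v A fI, where U = U])
      show "D \<le> U" unfolding U_def by (rule order_trans[OF D(2)], rule power_increasing) auto
      show "FlowV v w e \<in> I" if "w \<in> ?V" "e \<in> edges G" for w e
        unfolding I_def using that vV by (intro UnI2 image_eqI[of _ _ "(v, w, e)"]) auto
      show "PotV v w \<in> I" if "w \<in> ?V" for w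
        unfolding I_def using that vV by (intro UnI1 UnI2 image_eqI[of _ _ "(v, w)"]) auto
      show "LamV t \<in> I" if "t \<in> A" for t unfolding I_def using that A by blast
    qed (use D(3,4) ok[OF v] RV[OF v] in \<open>simp_all add: M_def U\<close>)
  qed
  define y0 where "y0 j = (case j of LamV t \<Rightarrow> real_of_ereal (lam t) | PotV v w \<Rightarrow> f v w | FlowV v w e \<Rightarrow> x v w e)" for j
  have S0: "S y0"
    unfolding S_def
  proof
    fix v assume v: "v \<in> A"
    have eq: "req_of A y0 t = lam t" if "t \<in> ?V" for t
      using lamA[of t] that by (auto simp: req_of_def y0_def A_def)
    have "flow_ok G (owner G v) (req_of A y0) c z (pr v w) \<longleftrightarrow> flow_ok G (owner G v) lam c z (pr v w)" if "w \<in> R v" for w c z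
    proof (rule flow_ok_cong)
      fix t assume "t \<in> fst (snd (snd (pr v w)))"
      then have "t \<in> ?V" using ok[OF v that] by (auto simp: proposal_ok_def split: prod.splits)
      then show "req_of A y0 t = lam t" by (rule eq)
    qed
    then show "certificate G (owner G v) (req_of A y0) (y0 (LamV v) + ?e) (R v) (pr v)
      (\<lambda>w. y0 (PotV v w)) (\<lambda>w e. y0 (FlowV v w e))"
      using cert[OF v] unfolding certificate_def by (simp add: y0_def)
  qed
  have v0A: "v0 \<in> A" using v0 fin by (simp add: A_def)
  have min: "y0 (LamV v0) \<le> y (LamV v0)" if Sy: "S y" for y
  proof -
    have "eps_fixed_point G \<epsilon> (req_of A y)"
      unfolding eps_fixed_point_def
    proof (intro ballI conjI)
      fix v assume v: "v \<in> ?V"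
      have "req_of A y v \<le> nego G (req_of A y) v" by (rule nego_ge[OF wf v])
      moreover have "req_of A y v - ereal ?e \<le> req_of A y v" using e0 by (cases "req_of A y v") auto
      ultimately show "req_of A y v - ereal ?e \<le> nego G (req_of A y) v" by (rule order_trans[rotated])
      show "nego G (req_of A y) v \<le> req_of A y v + ereal ?e"
      proof (cases "v \<in> A")
        case True
        then have "nego G (req_of A y) v \<le> ereal (y (LamV v) + ?e)"
          using Sy cert[OF True] unfolding S_def by (intro nego_le_if_certificate[OF wf]) blast+
        then show ?thesis using True by (simp add: req_of_def)
      qed (simp add: req_of_def)
    qed
    then have "lam v0 \<le> req_of A y v0" using lst v0 by blast
    then have "ereal (y0 (LamV v0)) \<le> ereal (y (LamV v0))" using v0A lamA[OF v0A] by (simp add: req_of_def y0_def)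
    then show ?thesis by simp
  qed
  have s1: "s \<ge> 1" unfolding s by (simp add: size_rat_def split: prod.splits)
  have nE: "card (edges G) \<le> s" and nV: "card ?V \<le> s" unfolding s game_size_def by auto
  have M1: "M \<ge> 1" unfolding M_def U_def by simp
  have cI: "card I \<le> s + s * s + s * s * s"
  proof -
    have "card I \<le> card (LamV ` ?V) + card ((\<lambda>(v, w). PotV v w) ` (?V \<times> ?V)) + card ((\<lambda>(v, w, e). FlowV v w e) ` (?V \<times> ?V \<times> edges G))"
      unfolding I_def by (meson card_Un_le add_le_mono le_refl order_trans)
    also have "\<dots> \<le> card ?V + card (?V \<times> ?V) + card (?V \<times> ?V \<times> edges G)"
      using fV fE by (intro add_mono card_image_le) auto
    also have "\<dots> \<le> s + s * s + s * s * s"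
      unfolding card_cartesian_product mult.assoc[symmetric] using nE nV by (intro add_mono mult_le_mono)
    finally show ?thesis .
  qed
  have kI: "LamV v0 \<in> I" using v0 by (simp add: I_def)
  obtain p q :: int where pq: "q \<noteq> 0" "\<bar>q\<bar> \<le> int ((2 * (card I + 1) * M) ^ card I)"
    "\<bar>p\<bar> \<le> int (card I * (2 * (card I + 1) * M) ^ card I * M)" "y0 (LamV v0) = of_int p / of_int q"
    using least_solution_small[OF fI kI M1 D(1) lin S0] min by blast
  note est = bit_length_estimates[OF s1 cI nE nV U_def M_def]
  have "int ((2 * (card I + 1) * M) ^ card I) \<le> int (2 ^ (51 * s ^ 4))" "int (card I * (2 * (card I + 1) * M) ^ card I * M) \<le> int (2 ^ (51 * s ^ 4))"
    using est by (simp_all only: of_nat_le_iff)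
  then have "\<bar>q\<bar> \<le> int (2 ^ (51 * s ^ 4))" "\<bar>p\<bar> \<le> int (2 ^ (51 * s ^ 4))" using pq(2,3) by (meson order_trans)+
  moreover have "lam v0 = ereal (of_int p / of_int q)" using lamA[OF v0A] pq(4) by (simp add: y0_def)
  ultimately show ?thesis using pq(1) by (intro exI[of _ p] exI[of _ q]) simp
qed

theorem theorem5:
  "\<exists>P3 :: nat poly. \<forall>G \<epsilon> lamstar.
     wf_game G \<and> \<epsilon> \<ge> 0 \<and> least_eps_fixed_point G \<epsilon> lamstar \<longrightarrow>
     req_size G lamstar \<le> enat (poly P3 (game_size G + size_rat \<epsilon>))"
proof (intro exI allI impI)
  fix G \<epsilon> lamstar
  assume as: "wf_game G \<and> \<epsilon> \<ge> 0 \<and> least_eps_fixed_point G \<epsilon> lamstar"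
  define s where "s = game_size G + size_rat \<epsilon>"
  have s1: "s \<ge> 1" unfolding s_def by (simp add: size_rat_def split: prod.splits)
  have nV: "card (verts G) \<le> s" unfolding s_def game_size_def by auto
  have s14: "1 \<le> s ^ 4" "1 \<le> s ^ 5" "s \<le> s ^ 5" using s1 self_le_power[of s 5] by auto
  \<comment> \<open>105 is \<open>2 * 51 + 3\<close>: numerator and denominator are bounded by
    \<open>2 ^ (51 * s ^ 4)\<close> each, and the constant 3 is absorbed by
    \<open>1 \<le> s ^ 4\<close>.\<close>
  have "size_ereal (lamstar v) \<le> enat (105 * s ^ 4)" if v: "v \<in> verts G" for v
  proof (cases "lamstar v = \<infinity>")
    case True
    then show ?thesis using s14(1) by (simp add: size_ereal_def one_enat_def)
  next
    case False
    obtain p q :: int where pq: "q \<noteq> 0" "\<bar>p\<bar> \<le> 2 ^ (51 * s ^ 4)" "\<bar>q\<bar> \<le> 2 ^ (51 * s ^ 4)" "lamstar v = ereal (of_int p / of_int q)"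
      using least_eps_fixed_point_value[of G \<epsilon> lamstar v s] as v False s_def by blast
    have "size_ereal (lamstar v) \<le> enat (2 * (51 * s ^ 4) + 3)" unfolding pq(4) using pq(1-3) by (rule size_ereal_fraction_le)
    also have "\<dots> \<le> enat (105 * s ^ 4)" using s14(1) by simp
    finally show ?thesis .
  qed
  then have "(\<Sum>v\<in>verts G. size_ereal (lamstar v)) \<le> (\<Sum>v\<in>verts G. enat (105 * s ^ 4))" by (rule sum_mono)
  also have "\<dots> = enat (card (verts G) * (105 * s ^ 4))" by (simp add: of_nat_eq_enat)
  finally have "req_size G lamstar \<le> enat (card (verts G)) + enat (card (verts G) * (105 * s ^ 4))"
    unfolding req_size_def by (rule add_left_mono)
  also have "\<dots> \<le> enat (s + s * (105 * s ^ 4))" using nV by (simp add: add_mono mult_le_mono1)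
  also have "\<dots> \<le> enat (106 * s ^ 5)"
  proof -
    have "s * s ^ 4 = s ^ 5" by (simp add: numeral_eq_Suc)
    then show ?thesis using s14(3) by simp
  qed
  also have "106 * s ^ 5 = poly (monom 106 5) s" by (simp add: poly_monom)
  finally show "req_size G lamstar \<le> enat (poly (monom 106 5) (game_size G + size_rat \<epsilon>))" by (simp add: s_def)
qed

end
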